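(* Let $\Omega\subset\mathbb{H}^2$ be a bounded domain with connected smooth boundary $\mathrm{b}\,\Omega$. Then every smooth admissible function $f:\mathrm{b}\,\Omega\to\mathbb{H}$ extends to $\Omega$ by an $\mathbb{H}$-holomorphic function, smooth up to $\mathrm{b}\,\Omega$.
   Context: Smooth means $C^\infty$; a domain is a connected open set. $\mathbb{H}$ is the quaternion algebra with real basis $\mathsf{i}_0=1,\mathsf{i}_1=\mathsf{i},\mathsf{i}_2=\mathsf{j},\mathsf{i}_3=\mathsf{k}$. Points of $\mathbb{H}^2\simeq\mathbb{R}^8$ are $(q_1,q_2)$, $q_1=\sum_{\alpha=0}^3 x_\alpha\mathsf{i}_\alpha$, $q_2=\sum_{\alpha=0}^3 y_\alpha\mathsf{i}_\alpha$. For a $C^1$ $\mathbb{H}$-valued function $F$ put $\frac{\partial F}{\partial\bar q_1}=\sum_\alpha\mathsf{i}_\alpha\frac{\partial F}{\partial x_\alpha}$, $\frac{\partial F}{\partial\bar q_2}=\sum_\alpha\mathsf{i}_\alpha\frac{\partial F}{\partial y_\alpha}$, $\overline{\mathfrak D}F=\big(\frac{\partial F}{\partial\bar q_1},\frac{\partial F}{\partial\bar q_2}\big)$. A $C^1$ function $F$ is (left) $\mathbb{H}$-holomorphic if $\overline{\mathfrak D}F=0$. CRF functions: let $S=\{\rho=0\}$ be an orientable smooth real hypersurface, where $\rho$ is a smooth real function on an open set containing $S$ with $\nabla\rho\neq0$ on $S$. A smooth $f:S\to\mathbb{H}$ is a CRF function if it has a smooth extension $F$ to a neighborhood of $S$ with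 $\overline{\mathfrak D}F=\rho A+\overline{\mathfrak D}\rho\cdot B$, $A$ ($\mathbb{H}^2$-valued) and $B$ ($\mathbb{H}$-valued) smooth, where $\overline{\mathfrak D}\rho\cdot B=\big(\frac{\partial\rho}{\partial\bar q_1}B,\frac{\partial\rho}{\partial\bar q_2}B\big)$ (the condition is independent of $F$ and $\rho$). Admissible functions: let $dq_1=\sum\mathsf{i}_\alpha dx_\alpha$, $\overline{dq}_1=\sum\bar{\mathsf{i}}_\alpha dx_\alpha$, $dq_2=\sum\mathsf{i}_\alpha dy_\alpha$, $\overline{dq}_2=\sum\bar{\mathsf{i}}_\alpha dy_\alpha$, $dx=dx_0\wedge\dots\wedge dx_3$, $dy=dy_0\wedge\dots\wedge dy_3$ (in wedge products of $\mathbb{H}$-valued forms the coefficients are multiplied in the written order). Let $\nu$ be a unit normal field of $S$ and $\omega$ the volume form of $S$ with $\omega=-\iota_\nu(dx\wedge dy)|_S$. For smooth $f:S\to\mathbb{H}$ define $f^\perp:S\to\mathbb{H}$ by $$-\tfrac12\big(\overline{dq}_1\wedge dq_1\wedge dy+dx\wedge\overline{dq}_2\wedge dq_2\big)\big|_S\wedge df=f^\perp\,\omega .$$ Let $\tau_{x_\alpha},\tau_{y_\alpha}$ be the components of $\frac{\partial}{\partial x_\alpha},\frac{\partial}{\partial y_\alpha}$ tangential to $S$, and $f_{(x_\alpha)}=\tau_{x_\alpha}(f)+(\frac{\partial}{\partial x_\alpha},\nu)f^\perp$, $f_{(y_\alpha)}=\tau_{y_\alpha}(f)+(\frac{\partial}{\partial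 y_\alpha},\nu)f^\perp$, with $(\cdot,\cdot)$ the Euclidean scalar product of $\mathbb{R}^8$. These do not depend on the choice of $\nu$. A smooth CRF function $f$ is admissible if all $f_{(x_\alpha)},f_{(y_\alpha)}$, $\alpha=0,1,2,3$, are CRF functions. Here these notions are applied to $S=\mathrm{b}\,\Omega$. *)

theory Defs
  imports "HOL-Analysis.Analysis"
begin

subsection \<open>Quaternions\<close>

text \<open>
  A quaternion is its coordinate vector with respect to the basis \<open>1, i, j, k\<close>, indexed by
  \<open>0, 1, 2, 3 :: 4\<close>; so \<open>axis \<alpha> 1\<close> is the basis unit with index \<open>\<alpha>\<close>, and the unit element is
  \<open>axis 0 1\<close>.  The operations \<open>*\<close> and \<open>1\<close> of the vector type are componentwise and are
  not used; the quaternion product is \<open>qmult\<close>.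
\<close>

type_synonym quat = "real ^ 4"

type_synonym quat2 = "quat \<times> quat"

definition quat_of_real :: "real \<Rightarrow> quat" where
  "quat_of_real r = axis 0 r"

definition qmult :: "quat \<Rightarrow> quat \<Rightarrow> quat"  (infixl "\<bullet>\<^sub>H" 70) where
  "p \<bullet>\<^sub>H q =
      axis 0 (p $ 0 * q $ 0 - p $ 1 * q $ 1 - p $ 2 * q $ 2 - p $ 3 * q $ 3)
    + axis 1 (p $ 0 * q $ 1 + p $ 1 * q $ 0 + p $ 2 * q $ 3 - p $ 3 * q $ 2)
    + axis 2 (p $ 0 * q $ 2 - p $ 1 * q $ 3 + p $ 2 * q $ 0 + p $ 3 * q $ 1)
    + axis 3 (p $ 0 * q $ 3 + p $ 1 * q $ 2 - p $ 2 * q $ 1 + p $ 3 * q $ 0)"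

definition qcnj :: "quat \<Rightarrow> quat" where
  "qcnj q = (\<chi> \<alpha>. if \<alpha> = 0 then q $ 0 else - q $ \<alpha>)"

definition ddx :: "4 \<Rightarrow> quat2" where
  "ddx \<alpha> = (axis \<alpha> 1, 0)"

definition ddy :: "4 \<Rightarrow> quat2" where
  "ddy \<alpha> = (0, axis \<alpha> 1)"


subsection \<open>Smoothness\<close>

primrec iterated_derivative ::
    "'a::real_normed_vector list \<Rightarrow> ('a \<Rightarrow> 'b::real_normed_vector) \<Rightarrow> 'a \<Rightarrow> 'b" where
  "iterated_derivative [] F = F"
| "iterated_derivative (v # vs) F =
     (\<lambda>x. frechet_derivative (iterated_derivative vs F) (at x) v)"

text \<open>Only meant for open sets \<open>U\<close>.\<close>

definition smooth_on :: "'a::real_normed_vector set \<Rightarrow> ('a \<Rightarrow> 'b::real_normed_vector) \<Rightarrow> bool" where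
  "smooth_on U F \<longleftrightarrow> (\<forall>vs. iterated_derivative vs F differentiable_on U)"

text \<open>
  Smoothness of a map defined on an arbitrary (e.g. lower-dimensional) subset \<open>S\<close>: locally it is
  the restriction of a smooth map on an open set.
\<close>

definition smooth_map_on :: "'a::real_normed_vector set \<Rightarrow> ('a \<Rightarrow> 'b::real_normed_vector) \<Rightarrow> bool" where
  "smooth_map_on S f \<longleftrightarrow>
     (\<forall>p\<in>S. \<exists>U F. open U \<and> p \<in> U \<and> smooth_on U F \<and> (\<forall>x\<in>S \<inter> U. F x = f x))"

text \<open>\<open>F\<close> and all its partial derivatives on \<open>\<Omega>\<close> extend continuously to the closure.\<close>

definition smooth_up_to_boundary ::
    "'a::real_normed_vector set \<Rightarrow> ('a \<Rightarrow> 'b::real_normed_vector) \<Rightarrow> bool" where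
  "smooth_up_to_boundary \<Omega> F \<longleftrightarrow>
     smooth_on \<Omega> F \<and> continuous_on (closure \<Omega>) F \<and>
     (\<forall>vs. \<exists>G. continuous_on (closure \<Omega>) G \<and> (\<forall>x\<in>\<Omega>. G x = iterated_derivative vs F x))"


subsection \<open>Quaternionic holomorphic functions\<close>

definition dbar1 :: "(quat2 \<Rightarrow> quat) \<Rightarrow> quat2 \<Rightarrow> quat" where
  "dbar1 F p = (\<Sum>\<alpha>\<in>UNIV. axis \<alpha> 1 \<bullet>\<^sub>H frechet_derivative F (at p) (ddx \<alpha>))"

definition dbar2 :: "(quat2 \<Rightarrow> quat) \<Rightarrow> quat2 \<Rightarrow> quat" where
  "dbar2 F p = (\<Sum>\<alpha>\<in>UNIV. axis \<alpha> 1 \<bullet>\<^sub>H frechet_derivative F (at p) (ddy \<alpha>))"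

definition Dbar :: "(quat2 \<Rightarrow> quat) \<Rightarrow> quat2 \<Rightarrow> quat2" where
  "Dbar F p = (dbar1 F p, dbar2 F p)"

definition H_holomorphic_on :: "quat2 set \<Rightarrow> (quat2 \<Rightarrow> quat) \<Rightarrow> bool" where
  "H_holomorphic_on U F \<longleftrightarrow>
     F differentiable_on U \<and>
     (\<forall>v. continuous_on U (\<lambda>x. frechet_derivative F (at x) v)) \<and>
     (\<forall>x\<in>U. Dbar F x = 0)"


subsection \<open>Hypersurfaces and CRF functions\<close>

definition defining_function :: "quat2 set \<Rightarrow> quat2 set \<Rightarrow> (quat2 \<Rightarrow> real) \<Rightarrow> bool" where
  "defining_function S U \<rho> \<longleftrightarrow>
     open U \<and> S \<subseteq> U \<and> smooth_on U \<rho> \<and> S = {x \<in> U. \<rho> x = 0} \<and>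
     (\<forall>p\<in>S. frechet_derivative \<rho> (at p) \<noteq> (\<lambda>v. 0))"

definition smooth_hypersurface :: "quat2 set \<Rightarrow> bool" where
  "smooth_hypersurface S \<longleftrightarrow> (\<exists>U \<rho>. defining_function S U \<rho>)"

definition CRF :: "quat2 set \<Rightarrow> (quat2 \<Rightarrow> quat) \<Rightarrow> bool" where
  "CRF S f \<longleftrightarrow>
     smooth_map_on S f \<and>
     (\<exists>U \<rho> F A B.
        defining_function S U \<rho> \<and>
        smooth_on U F \<and> smooth_on U (A :: quat2 \<Rightarrow> quat2) \<and> smooth_on U (B :: quat2 \<Rightarrow> quat) \<and>
        (\<forall>p\<in>S. F p = f p) \<and>
        (\<forall>x\<in>U. Dbar F x =
            \<rho> x *\<^sub>R A x
            + (dbar1 (\<lambda>y. quat_of_real (\<rho> y)) x \<bullet>\<^sub>H B x,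
               dbar2 (\<lambda>y. quat_of_real (\<rho> y)) x \<bullet>\<^sub>H B x)))"

text \<open>The kernel of the differential of a defining function does not depend on its choice.\<close>

definition tangent_space :: "quat2 set \<Rightarrow> quat2 \<Rightarrow> quat2 set" where
  "tangent_space S p =
     {v. \<exists>U \<rho>. defining_function S U \<rho> \<and> frechet_derivative \<rho> (at p) v = 0}"

definition unit_normal_field :: "quat2 set \<Rightarrow> (quat2 \<Rightarrow> quat2) \<Rightarrow> bool" where
  "unit_normal_field S \<nu> \<longleftrightarrow>
     continuous_on S \<nu> \<and>
     (\<forall>p\<in>S. norm (\<nu> p) = 1 \<and> (\<forall>v\<in>tangent_space S p. v \<bullet> \<nu> p = 0))"

text \<open>
  The differential at \<open>p\<close> of a function on the hypersurface \<open>S\<close>.  The derivative within \<open>S\<close>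
  is determined only on vectors tangent to \<open>S\<close>; below it is applied to such vectors only.
\<close>

definition surface_diff :: "quat2 set \<Rightarrow> (quat2 \<Rightarrow> quat) \<Rightarrow> quat2 \<Rightarrow> quat2 \<Rightarrow> quat" where
  "surface_diff S f p = frechet_derivative f (at p within S)"


subsection \<open>Quaternion-valued exterior forms\<close>

text \<open>
  A \<open>k\<close>-form at a point is a function of the vectors \<open>v 0, \<dots>, v (k - 1)\<close>.  The wedge product is
  normalised so that \<open>(dx\<^sub>1 \<and> \<dots> \<and> dx\<^sub>k) (e\<^sub>1, \<dots>, e\<^sub>k) = 1\<close>.
\<close>

type_synonym qform = "(nat \<Rightarrow> quat2) \<Rightarrow> quat"

definition wedge :: "nat \<Rightarrow> nat \<Rightarrow> qform \<Rightarrow> qform \<Rightarrow> qform" where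
  "wedge k l a b = (\<lambda>v. (1 / (fact k * fact l)) *\<^sub>R
     (\<Sum>\<sigma> | \<sigma> permutes {..<k + l}.
        of_int (sign \<sigma>) *\<^sub>R (a (\<lambda>i. v (\<sigma> i)) \<bullet>\<^sub>H b (\<lambda>i. v (\<sigma> (k + i))))))"

definition one_form :: "(quat2 \<Rightarrow> quat) \<Rightarrow> qform" where
  "one_form L = (\<lambda>v. L (v 0))"

definition dq1 :: qform where "dq1 = one_form fst"

definition dq2 :: qform where "dq2 = one_form snd"

definition dq1_bar :: qform where "dq1_bar = one_form (\<lambda>w. qcnj (fst w))"

definition dq2_bar :: qform where "dq2_bar = one_form (\<lambda>w. qcnj (snd w))"

definition dx_coord :: "4 \<Rightarrow> qform" where
  "dx_coord \<alpha> = one_form (\<lambda>w. quat_of_real (fst w $ \<alpha>))"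

definition dy_coord :: "4 \<Rightarrow> qform" where
  "dy_coord \<alpha> = one_form (\<lambda>w. quat_of_real (snd w $ \<alpha>))"

definition dx :: qform where
  "dx = wedge 3 1 (wedge 2 1 (wedge 1 1 (dx_coord 0) (dx_coord 1)) (dx_coord 2)) (dx_coord 3)"

definition dy :: qform where
  "dy = wedge 3 1 (wedge 2 1 (wedge 1 1 (dy_coord 0) (dy_coord 1)) (dy_coord 2)) (dy_coord 3)"

definition interior_product :: "quat2 \<Rightarrow> qform \<Rightarrow> qform" where
  "interior_product n a = (\<lambda>v. a (case_nat n v))"


subsection \<open>Admissible functions\<close>

text \<open>
  The two sides are compared as \<open>7\<close>-forms on the tangent space of \<open>S\<close> at \<open>p\<close>, which is
  \<open>7\<close>-dimensional, so the quaternion \<open>h\<close> exists and is unique for smooth \<open>f\<close>.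
\<close>

definition f_perp ::
    "quat2 set \<Rightarrow> (quat2 \<Rightarrow> quat2) \<Rightarrow> (quat2 \<Rightarrow> quat) \<Rightarrow> quat2 \<Rightarrow> quat" where
  "f_perp S \<nu> f p = (THE h. \<forall>v. (\<forall>i<7. v i \<in> tangent_space S p) \<longrightarrow>
     wedge 6 1
       (\<lambda>w. - (1 / 2) *\<^sub>R (wedge 2 4 (wedge 1 1 dq1_bar dq1) dy w
                        + wedge 4 2 dx (wedge 1 1 dq2_bar dq2) w))
       (one_form (surface_diff S f p)) v
     = h \<bullet>\<^sub>H (- interior_product (\<nu> p) (wedge 4 4 dx dy) v))"

text \<open>
  For \<open>e = ddx \<alpha>\<close> and \<open>e = ddy \<alpha>\<close> these are the functions
  \<open>f\<^bsub>(x\<^sub>\<alpha>)\<^esub>\<close> and \<open>f\<^bsub>(y\<^sub>\<alpha>)\<^esub>\<close>; the vector \<open>e - (e \<bullet> \<nu> p) *\<^sub>R \<nu> p\<close> is the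
  tangential component of \<open>e\<close>.
\<close>

definition f_deriv ::
    "quat2 set \<Rightarrow> (quat2 \<Rightarrow> quat2) \<Rightarrow> (quat2 \<Rightarrow> quat) \<Rightarrow> quat2 \<Rightarrow> quat2 \<Rightarrow> quat" where
  "f_deriv S \<nu> f e p =
     surface_diff S f p (e - (e \<bullet> \<nu> p) *\<^sub>R \<nu> p) + (e \<bullet> \<nu> p) *\<^sub>R f_perp S \<nu> f p"

definition admissible :: "quat2 set \<Rightarrow> (quat2 \<Rightarrow> quat) \<Rightarrow> bool" where
  "admissible S f \<longleftrightarrow>
     CRF S f \<and>
     (\<exists>\<nu>. unit_normal_field S \<nu> \<and>
        (\<forall>\<alpha>. CRF S (f_deriv S \<nu> f (ddx \<alpha>)) \<and> CRF S (f_deriv S \<nu> f (ddy \<alpha>))))"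

end

theory Submission
  imports Defs "HOL-Complex_Analysis.Conformal_Mappings"
begin

text \<open>
  Let \<open>S = b\<Omega>\<close>. A CRF function \<open>f\<close> has a smooth extension \<open>F\<close> with \<open>\<partial>\<bar>F = 0\<close> on
  \<open>S\<close>. For such an \<open>F\<close> the form identity defining \<open>f\<^sup>\<bottom>\<close> gives \<open>f\<^sup>\<bottom> = \<partial>\<^sub>\<nu>F\<close>, so the
  functions \<open>f\<^bsub>(x\<^sub>\<alpha>)\<^esub>\<close>, \<open>f\<^bsub>(y\<^sub>\<alpha>)\<^esub>\<close> are the restrictions of the first derivatives of \<open>F\<close>.
  That they are CRF means exactly that the normal derivative of \<open>\<partial>\<bar>F\<close> on \<open>S\<close> is of the
  form \<open>\<partial>\<bar>\<rho> C\<close>, so that subtracting \<open>\<rho>\<^sup>2 C / 2\<close> makes \<open>\<partial>\<bar>F\<close> vanish to second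
  order. From then on the second-order compatibility condition of the \<open>\<partial>\<bar>\<close>-system lets one
  continue, with \<open>\<partial>\<bar>F\<close> vanishing on \<open>S\<close> to any prescribed order \<open>k\<close>.

  Then \<open>\<partial>\<bar>F\<close>, cut off and extended by zero outside \<open>\<Omega>\<close>, is compactly supported, of class
  \<open>C\<^sup>k\<^sup>-\<^sup>1\<close> and satisfies the compatibility condition, so it equals \<open>\<partial>\<bar>u\<close> for a convolution \<open>u\<close>
  with the Newton kernel in the variable \<open>q\<^sub>1\<close>. Since \<open>u = 0\<close> for large \<open>q\<^sub>2\<close>, unique
  continuation gives \<open>u = 0\<close> on the outer component of the complement of \<open>\<Omega>\<close>, whose closure
  contains \<open>S\<close> because \<open>S\<close> is connected. Hence \<open>F - u\<close> is an holomorphic extension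
  of \<open>f\<close>; by the maximum principle it does not depend on \<open>k\<close>, so it is smooth up to \<open>S\<close>.
\<close>

subsection \<open>Directional derivatives and \<open>C\<^sup>k\<close> functions\<close>

text \<open>A second-order equation sees data flat to order k only through their leading coefficient
  at order k - 2, so the compatibility condition is silent for k = 0 and k = 1. These are the two
  orders supplied by the CRF condition on f and on its derivatives. From k = 2 on, let s1, s2 be the
  symbols of the two operators at d\<rho> and a1, a2 the leading coefficients. The condition and its
  mirror image read |s1|^2 a2 = s2 conj(s1) a1 and |s2|^2 a1 = s1 conj(s2) a2. As |s1|^2 + |s2|^2 =
  |grad \<rho>|^2 is nonzero, they force (a1, a2) = (s1 c, s2 c), even where one symbol vanishes.
  Each finite order is treated separately, so no infinite series in \<rho> has to be summed, and
  cut-offs of finite smoothness do. Unique continuation works because dbar u = 0 makes u harmonic in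
  each quaternionic variable, and representing a harmonic function as a Newton potential makes it
  analytic along lines. The regularity of the potential comes from moving derivatives onto the data,
  never onto the singular kernel.\<close>

definition dir_deriv :: "'a::real_normed_vector \<Rightarrow> ('a \<Rightarrow> 'b::real_normed_vector) \<Rightarrow> 'a \<Rightarrow> 'b" where
  "dir_deriv v F = (\<lambda>x. frechet_derivative F (at x) v)"

text \<open>Iterating directional derivatives keeps the codomain fixed, unlike iterating the Frechet
  derivative, so that inductions on k only have to generalise over F.\<close>

primrec Ck_on :: "nat \<Rightarrow> 'a::real_normed_vector set \<Rightarrow> ('a \<Rightarrow> 'b::real_normed_vector) \<Rightarrow> bool" where
  "Ck_on 0 U F \<longleftrightarrow> continuous_on U F"
| "Ck_on (Suc k) U F \<longleftrightarrow> F differentiable_on U \<and> (\<forall>v. Ck_on k U (dir_deriv v F))"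

lemma dir_deriv_eqI: "(F has_derivative F') (at x) \<Longrightarrow> dir_deriv v F x = F' v"
  by (metis dir_deriv_def frechet_derivative_at)

lemma has_derivative_dir_deriv:
  "F differentiable (at x) \<Longrightarrow> (F has_derivative (\<lambda>v. dir_deriv v F x)) (at x)"
  by (simp add: dir_deriv_def frechet_derivative_works[symmetric])

lemma dir_deriv_cong:
  assumes "open U" "x \<in> U" "\<And>y. y \<in> U \<Longrightarrow> F y = G y"
  shows "dir_deriv v F x = dir_deriv v G x"
proof -
  have "(F has_derivative L) (at x) \<longleftrightarrow> (G has_derivative L) (at x)" for L
    using assms has_derivative_transform_within_open[of _ L x UNIV U] by metis
  then show ?thesis by (simp add: dir_deriv_def frechet_derivative_def)
qed

lemma differentiable_on_openD:
  "\<lbrakk>F differentiable_on U; open U; x \<in> U\<rbrakk> \<Longrightarrow> F differentiable (at x)"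
  by (metis at_within_open differentiable_on_def)

lemma Ck_on_cong:
  assumes "open U" "\<And>y. y \<in> U \<Longrightarrow> F y = G y"
  shows "Ck_on k U F \<longleftrightarrow> Ck_on k U G"
  using assms(2)
proof (induction k arbitrary: F G)
  case 0 then show ?case by (auto intro: continuous_on_cong[THEN iffD1])
next
  case (Suc k)
  have 1: "F differentiable_on U \<longleftrightarrow> G differentiable_on U"
    using Suc.prems by (auto simp: differentiable_on_def intro: differentiable_transform_within[OF _ zero_less_one])
  have 2: "Ck_on k U (dir_deriv v F) \<longleftrightarrow> Ck_on k U (dir_deriv v G)" for v
    by (rule Suc.IH) (use Suc.prems assms(1) dir_deriv_cong in blast)
  show ?case using 1 2 by simp
qed

lemma Ck_on_imp_continuous_on: "Ck_on k U F \<Longrightarrow> continuous_on U F"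
  by (cases k) (auto intro: differentiable_imp_continuous_on)

lemma Ck_on_SucD: "Ck_on (Suc k) U F \<Longrightarrow> Ck_on k U F"
  by (induction k arbitrary: F) (auto intro: differentiable_imp_continuous_on)

lemma Ck_on_le: "Ck_on k U F \<Longrightarrow> j \<le> k \<Longrightarrow> Ck_on j U F"
  by (induction k) (auto simp: le_Suc_eq dest: Ck_on_SucD simp del: Ck_on.simps)

lemma Ck_on_differentiable: "\<lbrakk>Ck_on k U F; 0 < k; open U; x \<in> U\<rbrakk> \<Longrightarrow> F differentiable (at x)"
  by (cases k) (auto dest: differentiable_on_openD)

lemma Ck_on_subset: "Ck_on k U F \<Longrightarrow> V \<subseteq> U \<Longrightarrow> Ck_on k V F"
  by (induction k arbitrary: F) (auto intro: continuous_on_subset differentiable_on_subset)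

text \<open>Used through \<open>Ck_on_Un\<close> to glue a cut-off function from its formula near
  the support and zero off the support.\<close>

lemma Ck_on_local:
  assumes "open U" "\<And>p. p \<in> U \<Longrightarrow> \<exists>V. open V \<and> p \<in> V \<and> Ck_on k V F"
  shows "Ck_on k U F"
  using assms(2)
proof (induction k arbitrary: F)
  case 0 then show ?case
    by (simp add: continuous_on_eq_continuous_at assms(1)) (meson continuous_on_eq_continuous_at)
next
  case (Suc k)
  have "F differentiable (at p)" if "p \<in> U" for p
    using Suc.prems[OF that] by (auto dest: differentiable_on_openD)
  moreover have "Ck_on k U (dir_deriv v F)" for v
    by (rule Suc.IH) (use Suc.prems in fastforce)
  ultimately show ?case
    by (auto simp: differentiable_on_def intro: differentiable_at_withinI)
qed

lemma Ck_on_Un: "\<lbrakk>open U; open V; Ck_on k U F; Ck_on k V F\<rbrakk> \<Longrightarrow> Ck_on k (U \<union> V) F"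
  by (rule Ck_on_local) auto

lemma Ck_on_dir_deriv: "Ck_on (Suc k) U F \<Longrightarrow> Ck_on k U (dir_deriv v F)"
  by simp

lemma dir_deriv_const [simp]: "dir_deriv v (\<lambda>x. c) = (\<lambda>x. 0)"
  by (simp add: dir_deriv_def)

lemma Ck_on_const [simp, intro]: "Ck_on k U (\<lambda>x. c)"
  by (induction k arbitrary: c) auto

lemma dir_deriv_linear: "bounded_linear L \<Longrightarrow> dir_deriv v L = (\<lambda>x. L v)"
  by (simp add: dir_deriv_eqI fun_eq_iff bounded_linear_imp_has_derivative)

lemma Ck_on_linear: "bounded_linear L \<Longrightarrow> Ck_on k U L"
  by (cases k) (auto simp: linear_continuous_on dir_deriv_linear differentiable_on_def
      intro: bounded_linear_imp_differentiable differentiable_at_withinI)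

lemma dir_deriv_compose_linear:
  assumes "bounded_linear L" "F differentiable (at x)"
  shows "dir_deriv v (\<lambda>x. L (F x)) x = L (dir_deriv v F x)"
  by (rule dir_deriv_eqI[OF bounded_linear.has_derivative[OF assms(1) has_derivative_dir_deriv[OF assms(2)]]])

lemma Ck_on_compose_linear:
  assumes L: "bounded_linear L" and U: "open U"
  shows "Ck_on k U F \<Longrightarrow> Ck_on k U (\<lambda>x. L (F x))"
proof (induction k arbitrary: F)
  case 0 then show ?case using L by (simp add: bounded_linear.continuous_on)
next
  case (Suc k)
  have "Ck_on k U (dir_deriv v (\<lambda>x. L (F x)))" for v
    using Suc by (subst Ck_on_cong[OF U, of _ "\<lambda>x. L (dir_deriv v F x)"])
      (auto intro: dir_deriv_compose_linear[OF L] differentiable_on_openD[OF _ U])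
  moreover have "(\<lambda>x. L (F x)) differentiable_on U"
    using Suc.prems bounded_linear.has_derivative[OF L] unfolding Ck_on.simps differentiable_on_def differentiable_def
    by fast
  ultimately show ?case by simp
qed

lemma dir_deriv_add:
  assumes "F differentiable (at x)" "G differentiable (at x)"
  shows "dir_deriv v (\<lambda>x. F x + G x) x = dir_deriv v F x + dir_deriv v G x"
  by (rule dir_deriv_eqI[OF has_derivative_add[OF assms[THEN has_derivative_dir_deriv]]])

lemma Ck_on_add:
  assumes U: "open U"
  shows "Ck_on k U F \<Longrightarrow> Ck_on k U G \<Longrightarrow> Ck_on k U (\<lambda>x. F x + G x)"
proof (induction k arbitrary: F G)
  case 0 then show ?case by (auto intro: continuous_on_add)
next
  case (Suc k)
  have "Ck_on k U (dir_deriv v (\<lambda>x. F x + G x))" for v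
    using Suc U
    by (subst Ck_on_cong[OF U, of _ "\<lambda>x. dir_deriv v F x + dir_deriv v G x"])
       (auto simp: differentiable_on_openD dir_deriv_add)
  moreover have "(\<lambda>x. F x + G x) differentiable_on U"
    using Suc.prems by (auto simp: differentiable_on_def)
  ultimately show ?case by simp
qed

lemma dir_deriv_minus:
  assumes "F differentiable (at x)"
  shows "dir_deriv v (\<lambda>x. - F x) x = - dir_deriv v F x"
  using dir_deriv_compose_linear[OF bounded_linear_minus[OF bounded_linear_ident] assms] .

lemma Ck_on_minus: "open U \<Longrightarrow> Ck_on k U F \<Longrightarrow> Ck_on k U (\<lambda>x. - F x)"
  using Ck_on_compose_linear[OF bounded_linear_minus[OF bounded_linear_ident]] .

lemma dir_deriv_diff:
  assumes "F differentiable (at x)" "G differentiable (at x)"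
  shows "dir_deriv v (\<lambda>x. F x - G x) x = dir_deriv v F x - dir_deriv v G x"
  by (rule dir_deriv_eqI[OF has_derivative_diff[OF assms[THEN has_derivative_dir_deriv]]])

lemma Ck_on_diff: "\<lbrakk>open U; Ck_on k U F; Ck_on k U G\<rbrakk> \<Longrightarrow> Ck_on k U (\<lambda>x. F x - G x)"
  using Ck_on_add[of U k F "\<lambda>x. - G x"] Ck_on_minus[of U k G] by simp

lemma dir_deriv_sum:
  assumes "\<And>i. i \<in> I \<Longrightarrow> F i differentiable (at x)"
  shows "dir_deriv v (\<lambda>x. \<Sum>i\<in>I. F i x) x = (\<Sum>i\<in>I. dir_deriv v (F i) x)"
  by (rule dir_deriv_eqI[OF has_derivative_sum[OF assms[THEN has_derivative_dir_deriv]]])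

lemma Ck_on_sum:
  assumes U: "open U"
  shows "(\<And>i. i \<in> I \<Longrightarrow> Ck_on k U (F i)) \<Longrightarrow> Ck_on k U (\<lambda>x. \<Sum>i\<in>I. F i x)"
  by (induction I rule: infinite_finite_induct) (auto intro!: Ck_on_add U)

lemma (in bounded_bilinear) dir_deriv:
  assumes "F differentiable (at x)" "G differentiable (at x)"
  shows "dir_deriv v (\<lambda>x. prod (F x) (G x)) x
    = prod (dir_deriv v F x) (G x) + prod (F x) (dir_deriv v G x)"
  by (subst add.commute, rule dir_deriv_eqI[OF FDERIV[OF assms[THEN has_derivative_dir_deriv]]])

lemma (in bounded_bilinear) Ck_on:
  assumes U: "open U"
  shows "Ck_on k U F \<Longrightarrow> Ck_on k U G \<Longrightarrow> Ck_on k U (\<lambda>x. prod (F x) (G x))"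
proof (induction k arbitrary: F G)
  case 0 then show ?case by (auto intro: continuous_on)
next
  case (Suc k)
  note FG = Ck_on_SucD[OF Suc.prems(1)] Ck_on_SucD[OF Suc.prems(2)]
  have d: "F differentiable_on U" "G differentiable_on U" using Suc.prems by auto
  have "Ck_on k U (dir_deriv v (\<lambda>x. prod (F x) (G x)))" for v
    using Suc U FG
    by (subst Ck_on_cong[OF U, of _ "\<lambda>x. prod (dir_deriv v F x) (G x) + prod (F x) (dir_deriv v G x)"])
       (auto simp: differentiable_on_openD dir_deriv intro!: Ck_on_add)
  moreover have "(\<lambda>x. prod (F x) (G x)) differentiable_on U"
    using d FDERIV unfolding differentiable_on_def differentiable_def by fast
  ultimately show ?case by simp
qed

lemmas dir_deriv_scaleR = bounded_bilinear.dir_deriv[OF bounded_bilinear_scaleR]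
lemmas Ck_on_scaleR = bounded_bilinear.Ck_on[OF bounded_bilinear_scaleR]
lemmas Ck_on_mult = bounded_bilinear.Ck_on[OF bounded_bilinear_mult]
lemmas Ck_on_inner = bounded_bilinear.Ck_on[OF bounded_bilinear_inner]

lemma Ck_on_power: "open U \<Longrightarrow> Ck_on k U F \<Longrightarrow> Ck_on k U (\<lambda>x. F x ^ n)"
  for F :: "_ \<Rightarrow> 'b::real_normed_algebra_1"
  by (induction n) (auto intro: Ck_on_mult)

lemma dir_deriv_inverse:
  fixes r :: "'a::real_normed_vector \<Rightarrow> real"
  assumes "r differentiable (at x)" "r x \<noteq> 0"
  shows "dir_deriv v (\<lambda>x. inverse (r x)) x = - (dir_deriv v r x * (inverse (r x) * inverse (r x)))"
  by (subst dir_deriv_eqI[OF Deriv.has_derivative_inverse[OF assms(2) has_derivative_dir_deriv[OF assms(1)]]])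
     (simp add: algebra_simps)

lemma Ck_on_inverse:
  fixes r :: "'a::real_normed_vector \<Rightarrow> real"
  assumes U: "open U" and nz: "\<And>x. x \<in> U \<Longrightarrow> r x \<noteq> 0"
  shows "Ck_on k U r \<Longrightarrow> Ck_on k U (\<lambda>x. inverse (r x))"
proof (induction k)
  case 0 then show ?case using nz by (auto intro: continuous_on_inverse)
next
  case (Suc k)
  have d: "r differentiable_on U" using Suc.prems by auto
  have "Ck_on k U (dir_deriv v (\<lambda>x. inverse (r x)))" for v
    using Suc U nz d Ck_on_SucD[OF Suc.prems]
    by (subst Ck_on_cong[OF U, of _ "\<lambda>x. - (dir_deriv v r x * (inverse (r x) * inverse (r x)))"])
       (auto simp: differentiable_on_openD dir_deriv_inverse intro!: Ck_on_minus Ck_on_mult)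
  moreover have "(\<lambda>x. inverse (r x)) differentiable_on U"
    using d nz by (auto simp: differentiable_on_def)
  ultimately show ?case by simp
qed

lemma dir_deriv_affine:
  assumes L: "bounded_linear L" and F: "F differentiable (at (c + L x))"
  shows "dir_deriv v (\<lambda>x. F (c + L x)) x = dir_deriv (L v) F (c + L x)"
proof (rule dir_deriv_eqI)
  have "((\<lambda>x. c + L x) has_derivative (\<lambda>h. L h)) (at x)"
    using bounded_linear_imp_has_derivative[OF L] by (auto intro!: derivative_eq_intros)
  from has_derivative_compose[OF this has_derivative_dir_deriv[OF F]]
  show "((\<lambda>x. F (c + L x)) has_derivative (\<lambda>h. dir_deriv (L h) F (c + L x))) (at x)" by simp
qed

lemma Ck_on_affine:
  assumes L: "bounded_linear L" and U: "open U" and V: "open V" "\<And>x. x \<in> V \<Longrightarrow> c + L x \<in> U"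
  shows "Ck_on k U F \<Longrightarrow> Ck_on k V (\<lambda>x. F (c + L x))"
proof (induction k arbitrary: F)
  case 0
  have "continuous_on V (\<lambda>x. c + L x)"
    using L by (intro continuous_intros linear_continuous_on)
  with 0 show ?case using V by (auto intro: continuous_on_compose2)
next
  case (Suc k)
  have d: "F differentiable_on U" using Suc.prems by auto
  have "Ck_on k V (dir_deriv v (\<lambda>x. F (c + L x)))" for v
    using Suc U V d
    by (subst Ck_on_cong[OF V(1), of _ "\<lambda>x. dir_deriv (L v) F (c + L x)"])
       (auto simp: differentiable_on_openD dir_deriv_affine[OF L])
  moreover have "(\<lambda>x. F (c + L x)) differentiable_on V"
    unfolding differentiable_on_def
  proof
    fix x assume "x \<in> V"
    then have "F differentiable (at (c + L x))" using d U V differentiable_on_openD by blast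
    moreover have "(\<lambda>x. c + L x) differentiable (at x)"
      by (intro differentiable_add differentiable_const bounded_linear_imp_differentiable L)
    ultimately show "(\<lambda>x. F (c + L x)) differentiable (at x within V)"
      using differentiable_chain_at[of "\<lambda>x. c + L x" x F]
      by (simp add: o_def differentiable_at_withinI)
  qed
  ultimately show ?case by simp
qed

section \<open>Smooth functions\<close>

definition Cinf_on :: "'a::real_normed_vector set \<Rightarrow> ('a \<Rightarrow> 'b::real_normed_vector) \<Rightarrow> bool" where
  "Cinf_on U F \<longleftrightarrow> (\<forall>k. Ck_on k U F)"

text \<open>\<open>iterated_derivative\<close> peels off the outermost derivative,
  \<open>Ck_on\<close> the innermost one; hence the inductions relating the two start at the end of
  the list of directions.\<close>

lemma iterated_derivative_snoc:
  "iterated_derivative (vs @ [v]) F = iterated_derivative vs (dir_deriv v F)"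
  by (induction vs) (auto simp: dir_deriv_def)

lemma smooth_on_iff_Cinf_on: "smooth_on U F \<longleftrightarrow> Cinf_on U F"
proof
  assume F: "smooth_on U F"
  have "(\<forall>vs. iterated_derivative vs F differentiable_on U) \<Longrightarrow> Ck_on k U F" for k
  proof (induction k arbitrary: F)
    case 0 then show ?case
      using 0[rule_format, of "[]"] by (auto intro: differentiable_imp_continuous_on)
  next
    case (Suc k)
    then show ?case
      using Suc.prems[rule_format, of "[]"] by (auto simp flip: iterated_derivative_snoc)
  qed
  then show "Cinf_on U F" using F by (auto simp: Cinf_on_def smooth_on_def)
next
  assume F: "Cinf_on U F"
  have "(\<forall>k. Ck_on k U F) \<Longrightarrow> iterated_derivative vs F differentiable_on U" for vs
  proof (induction vs arbitrary: F rule: rev_induct)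
    case Nil
    then have "Ck_on (Suc 0) U F" by blast
    then show ?case by simp
  next
    case (snoc v vs)
    have "Ck_on k U (dir_deriv v F)" for k using snoc.prems[rule_format, of "Suc k"] by simp
    then show ?case using snoc.IH unfolding iterated_derivative_snoc by blast
  qed
  then show "smooth_on U F" using F by (auto simp: Cinf_on_def smooth_on_def)
qed

lemma continuous_on_iterated_derivative:
  "Ck_on (length vs) U F \<Longrightarrow> continuous_on U (iterated_derivative vs F)"
  by (induction vs arbitrary: F rule: rev_induct) (auto simp: iterated_derivative_snoc)

lemma iterated_derivative_cong:
  assumes "open U" "\<And>y. y \<in> U \<Longrightarrow> F y = G y"
  shows "x \<in> U \<Longrightarrow> iterated_derivative vs F x = iterated_derivative vs G x"
proof (induction vs arbitrary: x)
  case (Cons v vs)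
  then show ?case using dir_deriv_cong[OF assms(1) Cons.prems Cons.IH] by (simp flip: dir_deriv_def)
qed (simp add: assms)

lemma Cinf_on_dir_deriv: "Cinf_on U F \<Longrightarrow> Cinf_on U (dir_deriv v F)"
  by (metis Cinf_on_def Ck_on.simps(2))

lemma Cinf_on_differentiable: "\<lbrakk>Cinf_on U F; open U; x \<in> U\<rbrakk> \<Longrightarrow> F differentiable (at x)"
  using Ck_on_differentiable[of 1] by (auto simp: Cinf_on_def simp del: Ck_on.simps)

lemma Cinf_on_const [simp, intro]: "Cinf_on U (\<lambda>x. c)"
  by (simp add: Cinf_on_def)

lemma Cinf_on_subset: "Cinf_on U F \<Longrightarrow> V \<subseteq> U \<Longrightarrow> Cinf_on V F"
  by (auto simp: Cinf_on_def intro: Ck_on_subset)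

lemma Cinf_on_add: "\<lbrakk>open U; Cinf_on U F; Cinf_on U G\<rbrakk> \<Longrightarrow> Cinf_on U (\<lambda>x. F x + G x)"
  by (auto simp: Cinf_on_def intro: Ck_on_add)

lemma Cinf_on_diff: "\<lbrakk>open U; Cinf_on U F; Cinf_on U G\<rbrakk> \<Longrightarrow> Cinf_on U (\<lambda>x. F x - G x)"
  by (auto simp: Cinf_on_def intro: Ck_on_diff)

lemma Cinf_on_minus: "\<lbrakk>open U; Cinf_on U F\<rbrakk> \<Longrightarrow> Cinf_on U (\<lambda>x. - F x)"
  by (auto simp: Cinf_on_def intro: Ck_on_minus)

lemma Cinf_on_sum: "\<lbrakk>open U; \<And>i. i \<in> I \<Longrightarrow> Cinf_on U (F i)\<rbrakk> \<Longrightarrow> Cinf_on U (\<lambda>x. \<Sum>i\<in>I. F i x)"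
  by (auto simp: Cinf_on_def intro: Ck_on_sum)

lemma (in bounded_bilinear) Cinf_on:
  "\<lbrakk>open U; Cinf_on U F; Cinf_on U G\<rbrakk> \<Longrightarrow> Cinf_on U (\<lambda>x. prod (F x) (G x))"
  by (auto simp: Cinf_on_def intro: Ck_on)

lemmas Cinf_on_scaleR = bounded_bilinear.Cinf_on[OF bounded_bilinear_scaleR]
lemmas Cinf_on_mult = bounded_bilinear.Cinf_on[OF bounded_bilinear_mult]

lemma Cinf_on_power: "open U \<Longrightarrow> Cinf_on U F \<Longrightarrow> Cinf_on U (\<lambda>x. F x ^ n)"
  for F :: "_ \<Rightarrow> 'b::real_normed_algebra_1"
  by (auto simp: Cinf_on_def intro: Ck_on_power)

lemma Cinf_on_inverse:
  fixes r :: "'a::real_normed_vector \<Rightarrow> real"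
  shows "\<lbrakk>open U; \<And>x. x \<in> U \<Longrightarrow> r x \<noteq> 0; Cinf_on U r\<rbrakk> \<Longrightarrow> Cinf_on U (\<lambda>x. inverse (r x))"
  by (auto simp: Cinf_on_def intro: Ck_on_inverse)

lemma Cinf_on_compose_linear:
  "\<lbrakk>bounded_linear L; open U; Cinf_on U F\<rbrakk> \<Longrightarrow> Cinf_on U (\<lambda>x. L (F x))"
  by (auto simp: Cinf_on_def intro: Ck_on_compose_linear)

section \<open>Mean values and the symmetry of second derivatives\<close>

lemma dir_deriv_basis_sum:
  fixes F :: "'a::euclidean_space \<Rightarrow> 'b::real_normed_vector"
  assumes "F differentiable (at x)"
  shows "dir_deriv v F x = (\<Sum>b\<in>Basis. (v \<bullet> b) *\<^sub>R dir_deriv b F x)"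
proof -
  have "linear (\<lambda>v. dir_deriv v F x)"
    using has_derivative_dir_deriv[OF assms] has_derivative_linear by blast
  then have "dir_deriv (\<Sum>b\<in>Basis. (v \<bullet> b) *\<^sub>R b) F x = (\<Sum>b\<in>Basis. (v \<bullet> b) *\<^sub>R dir_deriv b F x)"
    by (subst linear_sum[where f = "\<lambda>v. dir_deriv v F x"]) (simp_all add: linear_cmul[where f = "\<lambda>v. dir_deriv v F x"])
  then show ?thesis by (simp add: euclidean_representation)
qed

lemma has_real_derivative_along_line:
  fixes F :: "'a::real_normed_vector \<Rightarrow> real"
  assumes "F differentiable (at (p + s *\<^sub>R v))"
  shows "((\<lambda>t. F (p + t *\<^sub>R v)) has_real_derivative dir_deriv v F (p + s *\<^sub>R v)) (at s)"
proof -
  have "((\<lambda>t. F (p + t *\<^sub>R v)) has_derivative (\<lambda>h. dir_deriv (h *\<^sub>R v) F (p + s *\<^sub>R v))) (at s)"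
    by (rule has_derivative_compose[where f = "\<lambda>t. p + t *\<^sub>R v" and g = F, OF _ has_derivative_dir_deriv[OF assms]])
       (auto intro!: derivative_eq_intros)
  moreover have "(\<lambda>h. dir_deriv (h *\<^sub>R v) F (p + s *\<^sub>R v)) = (*) (dir_deriv v F (p + s *\<^sub>R v))"
    using linear_cmul[OF has_derivative_linear[OF has_derivative_dir_deriv[OF assms]]] by (simp add: fun_eq_iff)
  ultimately show ?thesis by (simp add: has_field_derivative_def)
qed

text \<open>The mean value theorem is used along v for the increment in direction w, then along w
  for the derivative along v. Exchanging v and w leaves the second difference unchanged but produces
  the other mixed derivative.\<close>

lemma mixed_difference_mean_value:
  fixes F :: "'a::real_normed_vector \<Rightarrow> real"
  assumes U: "open U" "Ck_on 2 U F" and t: "0 < t"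
    and sub: "\<And>a b. \<lbrakk>0 \<le> a; a \<le> t; 0 \<le> b; b \<le> t\<rbrakk> \<Longrightarrow> x + a *\<^sub>R v + b *\<^sub>R w \<in> U"
  shows "\<exists>a b. 0 \<le> a \<and> a \<le> t \<and> 0 \<le> b \<and> b \<le> t \<and>
     F (x + t *\<^sub>R v + t *\<^sub>R w) - F (x + t *\<^sub>R v) - F (x + t *\<^sub>R w) + F x
       = t * t * dir_deriv w (dir_deriv v F) (x + a *\<^sub>R v + b *\<^sub>R w)"
proof -
  have dF: "F differentiable (at y)" "dir_deriv v F differentiable (at y)" if "y \<in> U" for y
    using U that by (auto simp: numeral_2_eq_2 intro: differentiable_on_openD)
  let ?\<phi> = "\<lambda>s. F (x + t *\<^sub>R w + s *\<^sub>R v) - F (x + s *\<^sub>R v)"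
  have in1: "x + t *\<^sub>R w + s *\<^sub>R v \<in> U" "x + s *\<^sub>R v \<in> U" if "0 \<le> s" "s \<le> t" for s
    using sub[of s t] sub[of s 0] that t by (auto simp: algebra_simps)
  have "\<exists>z>0. z < t \<and> ?\<phi> t - ?\<phi> 0 = (t - 0) *
     (dir_deriv v F (x + t *\<^sub>R w + z *\<^sub>R v) - dir_deriv v F (x + z *\<^sub>R v))"
    by (rule MVT2[OF t]) (intro DERIV_diff has_real_derivative_along_line dF in1; simp)
  then obtain a where a: "0 < a" "a < t" and
    1: "?\<phi> t - ?\<phi> 0 = t * (dir_deriv v F (x + t *\<^sub>R w + a *\<^sub>R v) - dir_deriv v F (x + a *\<^sub>R v))" by auto
  let ?\<psi> = "\<lambda>s. dir_deriv v F (x + a *\<^sub>R v + s *\<^sub>R w)"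
  have "\<exists>z>0. z < t \<and> ?\<psi> t - ?\<psi> 0 = (t - 0) * dir_deriv w (dir_deriv v F) (x + a *\<^sub>R v + z *\<^sub>R w)"
    by (rule MVT2[OF t]) (intro has_real_derivative_along_line dF sub; use a in simp)
  then obtain b where b: "0 < b" "b < t" and
    2: "?\<psi> t - ?\<psi> 0 = t * dir_deriv w (dir_deriv v F) (x + a *\<^sub>R v + b *\<^sub>R w)" by auto
  have "F (x + t *\<^sub>R v + t *\<^sub>R w) - F (x + t *\<^sub>R v) - F (x + t *\<^sub>R w) + F x = ?\<phi> t - ?\<phi> 0"
    by (simp add: algebra_simps)
  also have "\<dots> = t * (?\<psi> t - ?\<psi> 0)" unfolding 1 by (simp add: algebra_simps)
  also have "\<dots> = t * t * dir_deriv w (dir_deriv v F) (x + a *\<^sub>R v + b *\<^sub>R w)" unfolding 2 by simp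
  finally show ?thesis using a b by (intro exI[of _ a] exI[of _ b]) simp
qed

lemma dir_deriv_commute_real:
  fixes F :: "'a::real_normed_vector \<Rightarrow> real"
  assumes U: "open U" "Ck_on 2 U F" "x \<in> U"
  shows "dir_deriv v (dir_deriv w F) x = dir_deriv w (dir_deriv v F) x"
proof (rule ccontr)
  assume neq: "dir_deriv v (dir_deriv w F) x \<noteq> dir_deriv w (dir_deriv v F) x"
  \<comment> \<open>Half the gap: the two mixed derivatives take a common value at suitable points
    near x, and each varies by less than e there.\<close>
  define e where "e = \<bar>dir_deriv v (dir_deriv w F) x - dir_deriv w (dir_deriv v F) x\<bar> / 2"
  have e: "e > 0" using neq by (simp add: e_def)
  have "continuous_on U (dir_deriv v (dir_deriv w F))" "continuous_on U (dir_deriv w (dir_deriv v F))"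
    using U(2) by (simp_all add: numeral_2_eq_2)
  then have "isCont (dir_deriv v (dir_deriv w F)) x" "isCont (dir_deriv w (dir_deriv v F)) x"
    using U continuous_on_eq_continuous_at by blast+
  then have "\<forall>\<^sub>F y in nhds x. dist (dir_deriv v (dir_deriv w F) y) (dir_deriv v (dir_deriv w F) x) < e"
    "\<forall>\<^sub>F y in nhds x. dist (dir_deriv w (dir_deriv v F) y) (dir_deriv w (dir_deriv v F) x) < e"
    using e by (auto simp: isCont_def tendsto_at_iff_tendsto_nhds dest: tendstoD)
  moreover have "\<forall>\<^sub>F y in nhds x. y \<in> U" using U eventually_nhds by blast
  ultimately have "\<forall>\<^sub>F y in nhds x. y \<in> U \<and>
     dist (dir_deriv v (dir_deriv w F) y) (dir_deriv v (dir_deriv w F) x) < e \<and>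
     dist (dir_deriv w (dir_deriv v F) y) (dir_deriv w (dir_deriv v F) x) < e"
    by eventually_elim auto
  then obtain d where d: "d > 0" and near: "\<And>y. dist y x < d \<Longrightarrow> y \<in> U \<and>
     dist (dir_deriv v (dir_deriv w F) y) (dir_deriv v (dir_deriv w F) x) < e \<and>
     dist (dir_deriv w (dir_deriv v F) y) (dir_deriv w (dir_deriv v F) x) < e"
    unfolding eventually_nhds_metric by blast
  \<comment> \<open>Small enough for the whole parallelogram with sides t v and t w to stay within
    distance d of x.\<close>
  define t where "t = d / (norm v + norm w + 1)"
  have t: "t > 0" using d by (simp add: t_def add_nonneg_pos)
  have tn: "t * norm v + t * norm w < d"
  proof -
    have "t * norm v + t * norm w < t * (norm v + norm w + 1)" using t by (simp add: algebra_simps)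
    also have "\<dots> = d"
      using add_nonneg_pos[of "norm v + norm w" 1] by (simp add: t_def)
    finally show ?thesis .
  qed
  have close: "dist (x + a *\<^sub>R v + b *\<^sub>R w) x < d" if "0 \<le> a" "a \<le> t" "0 \<le> b" "b \<le> t" for a b
  proof -
    have "dist (x + a *\<^sub>R v + b *\<^sub>R w) x = norm (a *\<^sub>R v + b *\<^sub>R w)" by (simp add: dist_norm algebra_simps)
    also have "\<dots> \<le> a * norm v + b * norm w" using norm_triangle_ineq[of "a *\<^sub>R v" "b *\<^sub>R w"] that by simp
    also have "\<dots> \<le> t * norm v + t * norm w" using that by (intro add_mono mult_right_mono) auto
    finally show ?thesis using tn by simp
  qed
  obtain a b where ab: "0 \<le> a" "a \<le> t" "0 \<le> b" "b \<le> t" and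
    1: "F (x + t *\<^sub>R v + t *\<^sub>R w) - F (x + t *\<^sub>R v) - F (x + t *\<^sub>R w) + F x
       = t * t * dir_deriv w (dir_deriv v F) (x + a *\<^sub>R v + b *\<^sub>R w)"
    using mixed_difference_mean_value[OF U(1,2) t, of x v w] close near by blast
  obtain a' b' where ab': "0 \<le> a'" "a' \<le> t" "0 \<le> b'" "b' \<le> t" and
    2: "F (x + t *\<^sub>R w + t *\<^sub>R v) - F (x + t *\<^sub>R w) - F (x + t *\<^sub>R v) + F x
       = t * t * dir_deriv v (dir_deriv w F) (x + a' *\<^sub>R w + b' *\<^sub>R v)"
  proof -
    have *: "x + a *\<^sub>R w + b *\<^sub>R v \<in> U" if "0 \<le> a" "a \<le> t" "0 \<le> b" "b \<le> t" for a b
      using close[of b a] near that by (auto simp: algebra_simps)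
    show ?thesis using mixed_difference_mean_value[OF U(1,2) t, of x w v] * that by blast
  qed
  have swap: "x + t *\<^sub>R w + t *\<^sub>R v = x + t *\<^sub>R v + t *\<^sub>R w"
    "x + a' *\<^sub>R w + b' *\<^sub>R v = x + b' *\<^sub>R v + a' *\<^sub>R w" by (auto simp: algebra_simps)
  have "t * t * dir_deriv w (dir_deriv v F) (x + a *\<^sub>R v + b *\<^sub>R w)
      = t * t * dir_deriv v (dir_deriv w F) (x + b' *\<^sub>R v + a' *\<^sub>R w)"
    using 1 2 unfolding swap by linarith
  then have "dir_deriv w (dir_deriv v F) (x + a *\<^sub>R v + b *\<^sub>R w)
      = dir_deriv v (dir_deriv w F) (x + b' *\<^sub>R v + a' *\<^sub>R w)" using t by simp
  moreover have "dist (dir_deriv w (dir_deriv v F) (x + a *\<^sub>R v + b *\<^sub>R w)) (dir_deriv w (dir_deriv v F) x) < e"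
    using close[OF ab] near by blast
  moreover have "dist (dir_deriv v (dir_deriv w F) (x + b' *\<^sub>R v + a' *\<^sub>R w)) (dir_deriv v (dir_deriv w F) x) < e"
    using close[OF ab'(3,4,1,2)] near by blast
  ultimately show False unfolding e_def dist_real_def by (smt (verit) field_sum_of_halves)
qed

lemma dir_deriv_commute:
  fixes F :: "'a::real_normed_vector \<Rightarrow> 'b::euclidean_space"
  assumes U: "open U" "Ck_on 2 U F" "x \<in> U"
  shows "dir_deriv v (dir_deriv w F) x = dir_deriv w (dir_deriv v F) x"
proof (rule euclidean_eqI)
  fix b :: 'b assume "b \<in> Basis"
  have L: "bounded_linear (\<lambda>y. y \<bullet> b)" by (rule bounded_linear_inner_left)
  have c: "Ck_on 2 U (\<lambda>x. F x \<bullet> b)" by (rule Ck_on_compose_linear[OF L U(1,2)])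
  have d: "F differentiable (at y)" "dir_deriv u F differentiable (at y)" if "y \<in> U" for y u
    using U that by (auto simp: numeral_2_eq_2 intro: differentiable_on_openD)
  have *: "dir_deriv u (dir_deriv u' (\<lambda>x. F x \<bullet> b)) x = dir_deriv u (dir_deriv u' F) x \<bullet> b" for u u'
  proof -
    have "dir_deriv u (dir_deriv u' (\<lambda>x. F x \<bullet> b)) x = dir_deriv u (\<lambda>x. dir_deriv u' F x \<bullet> b) x"
      by (rule dir_deriv_cong[OF U(1,3)]) (rule dir_deriv_compose_linear[OF L d(1)])
    also have "\<dots> = dir_deriv u (dir_deriv u' F) x \<bullet> b"
      by (rule dir_deriv_compose_linear[OF L d(2)[OF U(3)]])
    finally show ?thesis .
  qed
  show "dir_deriv v (dir_deriv w F) x \<bullet> b = dir_deriv w (dir_deriv v F) x \<bullet> b"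
    using dir_deriv_commute_real[OF U(1) c U(3), of v w] unfolding * .
qed

subsection \<open>Convolution with a locally integrable kernel\<close>

lemma lborel_integral_affine:
  fixes f :: "'a::euclidean_space \<Rightarrow> 'b::{banach, second_countable_topology}" and c :: real
  assumes [measurable]: "f \<in> borel_measurable borel" and c: "c \<noteq> 0"
  shows "(\<integral>x. f x \<partial>lborel) = \<bar>c\<bar> ^ DIM('a) *\<^sub>R (\<integral>x. f (t + c *\<^sub>R x) \<partial>lborel)"
  by (subst lborel_affine[OF c, of t]) (simp add: integral_density integral_distr)

lemma lborel_integral_reflect:
  fixes f :: "'a::euclidean_space \<Rightarrow> 'b::{banach, second_countable_topology}"
  assumes "f \<in> borel_measurable borel"
  shows "(\<integral>x. f (t - x) \<partial>lborel) = (\<integral>x. f x \<partial>lborel)"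
  using lborel_integral_affine[OF assms, of "-1" t] by simp

definition vanishes_outside :: "real \<Rightarrow> ('a::real_normed_vector \<Rightarrow> 'b::zero) \<Rightarrow> bool" where
  "vanishes_outside r G \<longleftrightarrow> (\<forall>x. r < norm x \<longrightarrow> G x = 0)"

lemma vanishes_outsideD: "vanishes_outside r G \<Longrightarrow> r < norm x \<Longrightarrow> G x = 0"
  by (simp add: vanishes_outside_def)

lemma vanishes_outside_dir_deriv:
  assumes "vanishes_outside r G"
  shows "vanishes_outside r (dir_deriv v G)"
  unfolding vanishes_outside_def
proof (intro allI impI)
  fix x :: 'a assume x: "r < norm x"
  have "open {x. r < norm x}" by (intro open_Collect_less continuous_intros)
  then have "dir_deriv v G x = dir_deriv v (\<lambda>_. 0) x"
    by (rule dir_deriv_cong) (use x assms in \<open>auto dest: vanishes_outsideD\<close>)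
  then show "dir_deriv v G x = 0" by simp
qed

lemma compact_support_bounded:
  fixes G :: "'a::euclidean_space \<Rightarrow> 'b::real_normed_vector"
  assumes "continuous_on UNIV G" "vanishes_outside r G"
  shows "\<exists>M>0. \<forall>x. norm (G x) \<le> M"
proof -
  have "bounded (G ` cball 0 r)"
    by (meson assms(1) compact_cball compact_continuous_image compact_imp_bounded continuous_on_subset subset_UNIV)
  then obtain M where "0 < M" "\<And>x. x \<in> cball 0 r \<Longrightarrow> norm (G x) \<le> M"
    unfolding bounded_pos by blast
  then have "norm (G x) \<le> M" for x
    by (cases "r < norm x") (use assms(2) in \<open>auto simp: less_imp_le vanishes_outsideD\<close>)
  with \<open>0 < M\<close> show ?thesis by blast
qed

lemma compact_support_uniformly_continuous:
  fixes G :: "'a::euclidean_space \<Rightarrow> 'b::real_normed_vector"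
  assumes G: "continuous_on UNIV G" "vanishes_outside r G" and "0 < e"
  shows "\<exists>d. 0 < d \<and> d \<le> 1 \<and> (\<forall>x y. norm (y - x) < d \<longrightarrow> norm (G y - G x) \<le> e)"
proof -
  have "uniformly_continuous_on (cball 0 (r+1)) G"
    by (intro compact_uniformly_continuous continuous_on_subset[OF G(1)]) auto
  then obtain d where d: "d > 0" "\<And>x y. \<lbrakk>x \<in> cball 0 (r+1); y \<in> cball 0 (r+1); dist y x < d\<rbrakk> \<Longrightarrow> dist (G y) (G x) < e"
    using \<open>0 < e\<close> unfolding uniformly_continuous_on_def by metis
  have "norm (G y - G x) \<le> e" if h: "norm (y - x) < min d 1" for x y
  proof (cases "norm x \<le> r + 1 \<and> norm y \<le> r + 1")
    case True then show ?thesis using d(2)[of x y] h by (simp add: dist_norm)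
  next
    case False
    have "\<bar>norm y - norm x\<bar> < 1" using norm_triangle_ineq3[of y x] h by linarith
    then have "r < norm x" "r < norm y" using False by linarith+
    then show ?thesis using G(2) \<open>0 < e\<close> by (simp add: vanishes_outsideD)
  qed
  then show ?thesis using d by (intro exI[of _ "min d 1"]) simp
qed

text \<open>The remainder is o(|h|) uniformly in x because the first derivatives are uniformly
  continuous. This uniformity is what permits differentiation under the convolution
  integral.\<close>

lemma compact_support_uniform_derivative:
  fixes G :: "'a::euclidean_space \<Rightarrow> 'b::real_normed_vector"
  assumes G: "Ck_on 1 UNIV G" "vanishes_outside r G" and e: "0 < e"
  shows "\<exists>d. 0 < d \<and> d \<le> 1 \<and>
    (\<forall>x h. norm h < d \<longrightarrow> norm (G (x + h) - G x - dir_deriv h G x) \<le> e * norm h)"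
proof -
  \<comment> \<open>Each of the \<open>DIM('a)\<close> coordinates of the derivative may contribute
    e'.\<close>
  define e' where "e' = e / DIM('a)"
  have e': "e' > 0" using e by (simp add: e'_def)
  have diff: "G differentiable (at x)" for x
    using Ck_on_differentiable[OF G(1)] by simp
  have "\<exists>d. 0 < d \<and> d \<le> 1 \<and> (\<forall>x y. norm (y - x) < d \<longrightarrow> norm (dir_deriv b G y - dir_deriv b G x) \<le> e')" for b
  proof -
    have c: "continuous_on UNIV (dir_deriv b G)" using G(1) by simp
    show ?thesis by (rule compact_support_uniformly_continuous[OF c vanishes_outside_dir_deriv[OF G(2)] e'])
  qed
  then obtain d where d: "\<And>b. 0 < d b" "\<And>b. d b \<le> 1"
    "\<And>b x y. norm (y - x) < d b \<Longrightarrow> norm (dir_deriv b G y - dir_deriv b G x) \<le> e'" by metis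
  define m where "m = Min (d ` (Basis :: 'a set))"
  have m: "0 < m" "\<And>b. b \<in> Basis \<Longrightarrow> m \<le> d b" using d(1) by (auto simp: m_def)
  moreover have "m \<le> 1" using m(2) d(2) SOME_Basis order_trans by blast
  moreover have "norm (G (x + h) - G x - dir_deriv h G x) \<le> e * norm h" if h: "norm h < m" for x h
  proof -
    have "norm (G (x + h) - G x - dir_deriv (x + h - x) G x) \<le> norm (x + h - x) * e"
    proof (rule differentiable_bound_linearization[where f = G and S = "ball x m" and f' = "\<lambda>y v. dir_deriv v G y"])
      fix t :: real assume t: "t \<in> {0..1}"
      have "norm (t *\<^sub>R h) \<le> norm h" using t by (simp add: mult_left_le_one_le)
      then show "x + t *\<^sub>R (x + h - x) \<in> ball x m" using h by (simp add: dist_norm)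
    next
      show "(G has_derivative (\<lambda>v. dir_deriv v G y)) (at y within ball x m)" for y
        by (rule has_derivative_at_withinI[OF has_derivative_dir_deriv[OF diff]])
    next
      fix y assume y: "y \<in> ball x m"
      show "onorm ((\<lambda>v. dir_deriv v G y) - (\<lambda>v. dir_deriv v G x)) \<le> e"
      proof (rule onorm_le)
        fix v :: 'a
        have "norm (dir_deriv v G y - dir_deriv v G x)
            = norm (\<Sum>b\<in>Basis. (v \<bullet> b) *\<^sub>R (dir_deriv b G y - dir_deriv b G x))"
          unfolding dir_deriv_basis_sum[OF diff, of v] by (simp add: sum_subtractf algebra_simps)
        also have "\<dots> \<le> (\<Sum>b\<in>(Basis :: 'a set). norm v * e')"
        proof (rule sum_norm_le)
          fix b :: 'a assume b: "b \<in> Basis"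
          have "norm (dir_deriv b G y - dir_deriv b G x) \<le> e'"
            using d(3)[of y x b] y m(2)[OF b] by (simp add: dist_norm norm_minus_commute)
          then show "norm ((v \<bullet> b) *\<^sub>R (dir_deriv b G y - dir_deriv b G x)) \<le> norm v * e'"
            by (simp add: mult_mono Basis_le_norm[OF b])
        qed
        also have "\<dots> = e * norm v" by (simp add: e'_def)
        finally show "norm (((\<lambda>v. dir_deriv v G y) - (\<lambda>v. dir_deriv v G x)) v) \<le> e * norm v" by simp
      qed
    qed (use m in simp)
    then show ?thesis by (simp add: mult.commute)
  qed
  ultimately show ?thesis by blast
qed

text \<open>
  Convolution in the variables singled out by the isometric embedding \<open>\<iota>\<close>; the remaining
  variables are parameters.
\<close>

locale convolution_kernel =
  fixes w :: "'c::euclidean_space \<Rightarrow> real" and \<iota> :: "'c \<Rightarrow> 'a::euclidean_space"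
  assumes w_measurable [measurable]: "w \<in> borel_measurable borel"
    and w_nonneg: "\<And>\<zeta>. 0 \<le> w \<zeta>"
    and w_integrable: "\<And>r. integrable lborel (\<lambda>\<zeta>. indicator (cball 0 r) \<zeta> * w \<zeta>)"
    and iota_linear: "linear \<iota>" and iota_norm: "\<And>\<zeta>. norm (\<iota> \<zeta>) = norm \<zeta>"
begin

definition conv :: "('a \<Rightarrow> 'b::euclidean_space) \<Rightarrow> 'a \<Rightarrow> 'b" where
  "conv G p = (\<integral>\<zeta>. w \<zeta> *\<^sub>R G (p - \<iota> \<zeta>) \<partial>lborel)"

lemma iota_continuous: "continuous_on A \<iota>"
  by (simp add: iota_linear linear_continuous_on linear_conv_bounded_linear[symmetric])

text \<open>Local integrability of w suffices for convolutions, since the integrand lives on the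
  ball of radius \<open>r + norm p\<close>.\<close>

lemma conv_integrand_bound:
  assumes G: "\<And>x. norm (G x) \<le> M" "vanishes_outside r G"
  shows "norm (w \<zeta> *\<^sub>R G (p - \<iota> \<zeta>)) \<le> M * (indicator (cball 0 (r + norm p)) \<zeta> * w \<zeta>)"
proof (cases "norm \<zeta> \<le> r + norm p")
  case True then show ?thesis using G(1)[of "p - \<iota> \<zeta>"] w_nonneg[of \<zeta>] by (simp add: mult_right_mono mult.commute[of M] mult_left_mono)
next
  case False
  then have "r < norm (p - \<iota> \<zeta>)"
    using norm_triangle_ineq2[of "\<iota> \<zeta>" p] by (simp add: iota_norm norm_minus_commute)
  then show ?thesis using False G(2) by (simp add: vanishes_outsideD)
qed

lemma conv_measurable:
  fixes G :: "'a \<Rightarrow> 'b::euclidean_space"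
  assumes "continuous_on UNIV G"
  shows "(\<lambda>\<zeta>. w \<zeta> *\<^sub>R G (p - \<iota> \<zeta>)) \<in> borel_measurable borel"
proof -
  have "continuous_on UNIV (\<lambda>\<zeta>. G (p - \<iota> \<zeta>))"
    by (rule continuous_on_compose2[OF assms]) (auto intro!: continuous_intros iota_continuous)
  then have [measurable]: "(\<lambda>\<zeta>. G (p - \<iota> \<zeta>)) \<in> borel_measurable borel"
    by (rule borel_measurable_continuous_onI)
  show ?thesis by measurable
qed

lemma conv_integrable:
  fixes G :: "'a \<Rightarrow> 'b::euclidean_space"
  assumes G: "continuous_on UNIV G" "vanishes_outside r G"
  shows "integrable lborel (\<lambda>\<zeta>. w \<zeta> *\<^sub>R G (p - \<iota> \<zeta>))"
proof -
  obtain M where M: "0 < M" "\<And>x. norm (G x) \<le> M" using compact_support_bounded[OF G] by blast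
  have "integrable lborel (\<lambda>\<zeta>. M * (indicator (cball 0 (r + norm p)) \<zeta> * w \<zeta>))"
    using w_integrable by simp
  then show ?thesis
    by (rule Bochner_Integration.integrable_bound)
       (use conv_measurable[OF G(1)] conv_integrand_bound[OF M(2) G(2)] M(1) w_nonneg in \<open>auto simp: abs_mult\<close>)
qed

lemma conv_bound:
  fixes G :: "'a \<Rightarrow> 'b::euclidean_space"
  assumes "continuous_on UNIV G" "\<And>x. norm (G x) \<le> M" "vanishes_outside r G"
  shows "norm (conv G p) \<le> M * (\<integral>\<zeta>. indicator (cball 0 (r + norm p)) \<zeta> * w \<zeta> \<partial>lborel)"
proof -
  have "norm (conv G p) \<le> (\<integral>\<zeta>. M * (indicator (cball 0 (r + norm p)) \<zeta> * w \<zeta>) \<partial>lborel)"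
    unfolding conv_def
    by (rule order_trans[OF integral_norm_bound integral_mono])
       (use integrable_norm[OF conv_integrable[OF assms(1,3)]] conv_integrand_bound[OF assms(2,3)] w_integrable in auto)
  then show ?thesis by simp
qed

lemma conv_diff:
  fixes F G :: "'a \<Rightarrow> 'b::euclidean_space"
  assumes "continuous_on UNIV F" "vanishes_outside r F"
    and "continuous_on UNIV G" "vanishes_outside r G"
  shows "conv (\<lambda>x. F x - G x) p = conv F p - conv G p"
  unfolding conv_def scaleR_diff_right
  using conv_integrable[OF assms(1,2)] conv_integrable[OF assms(3,4)] by simp

lemma conv_sum:
  fixes F :: "'i \<Rightarrow> 'a \<Rightarrow> 'b::euclidean_space"
  assumes "\<And>i. i \<in> I \<Longrightarrow> continuous_on UNIV (F i)" "\<And>i. i \<in> I \<Longrightarrow> vanishes_outside r (F i)"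
  shows "conv (\<lambda>x. \<Sum>i\<in>I. F i x) p = (\<Sum>i\<in>I. conv (F i) p)"
  unfolding conv_def scaleR_sum_right
  by (rule Bochner_Integration.integral_sum) (use conv_integrable assms in blast)

lemma conv_linear:
  fixes G :: "'a \<Rightarrow> 'b::euclidean_space" and L :: "'b \<Rightarrow> 'd::euclidean_space"
  assumes "bounded_linear L" "continuous_on UNIV G" "vanishes_outside r G"
  shows "conv (\<lambda>x. L (G x)) p = L (conv G p)"
  unfolding conv_def
  using integral_bounded_linear[OF assms(1) conv_integrable[OF assms(2,3)], of p]
  by (simp add: linear_cmul[OF bounded_linear.linear[OF assms(1)]])

lemma conv_shift: "conv (\<lambda>x. G (x + h)) p = conv G (p + h)"
  by (simp add: conv_def algebra_simps)

lemma conv_continuous: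
  fixes G :: "'a \<Rightarrow> 'b::euclidean_space"
  assumes G: "continuous_on UNIV G" "vanishes_outside r G"
  shows "continuous_on UNIV (conv G)"
  unfolding continuous_on_iff
proof safe
  fix p :: 'a and e :: real assume e: "0 < e"
  \<comment> \<open>Shifts by less than d \<le> 1 keep the support inside radius
    \<open>r + 1\<close>. Dividing by \<open>K + 1\<close> below covers the case K = 0.\<close>
  define K where "K = (\<integral>\<zeta>. indicator (cball 0 (r + 1 + norm p)) \<zeta> * w \<zeta> \<partial>lborel)"
  have K: "K \<ge> 0" unfolding K_def by (rule integral_nonneg_AE) (simp add: w_nonneg)
  have "0 < e / (K + 1)" using e K by simp
  then obtain d where d: "0 < d" "d \<le> 1" "\<And>x y. norm (y - x) < d \<Longrightarrow> norm (G y - G x) \<le> e / (K + 1)"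
    using compact_support_uniformly_continuous[OF G] by blast
  have "dist (conv G y) (conv G p) < e" if y: "dist y p < d" for y
  proof -
    define h where "h = y - p"
    have h: "norm h < d" using y by (simp add: h_def dist_norm)
    have shift: "r < norm (x + h)" if "r + 1 < norm x" for x
      using that h d(2) norm_triangle_ineq2[of x "-h"] by simp
    have sup: "vanishes_outside (r + 1) (\<lambda>x. G (x + h))" and sup': "vanishes_outside (r + 1) G"
      and sup'': "vanishes_outside (r + 1) (\<lambda>x. G (x + h) - G x)"
      using G(2) shift by (simp_all add: vanishes_outside_def)
    have c: "continuous_on UNIV (\<lambda>x. G (x + h))"
      by (rule continuous_on_compose2[OF G(1)]) (auto intro!: continuous_intros)
    have "norm (conv (\<lambda>x. G (x + h) - G x) p) \<le> e / (K + 1) * K"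
      unfolding K_def
      by (rule conv_bound) (use d(3) h sup'' c G(1) in \<open>auto simp: K_def[symmetric] intro!: continuous_intros\<close>)
    also have "\<dots> < e" using e K by (simp add: field_simps)
    finally show ?thesis
      using conv_diff[OF c sup G(1) sup', of p] conv_shift[of G h p] by (simp add: h_def dist_norm)
  qed
  then show "\<exists>d>0. \<forall>x'\<in>UNIV. dist x' p < d \<longrightarrow> dist (conv G x') (conv G p) < e" using d(1) by blast
qed

text \<open>The derivative falls on G and never on w, which may be singular: the uniform first-order
  remainder of G is integrated against w.\<close>

lemma conv_has_derivative:
  fixes G :: "'a \<Rightarrow> 'b::euclidean_space"
  assumes G: "Ck_on 1 UNIV G" "vanishes_outside r G"
  shows "(conv G has_derivative (\<lambda>h. conv (dir_deriv h G) p)) (at p)"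
  unfolding has_derivative_at_alt
proof (intro conjI allI impI)
  have diff: "G differentiable (at x)" for x
    using Ck_on_differentiable[OF G(1)] by simp
  have lin: "linear (\<lambda>v. dir_deriv v G x)" for x
    using has_derivative_linear[OF has_derivative_dir_deriv[OF diff]] .
  have cont: "continuous_on UNIV (dir_deriv v G)" for v using G(1) by simp
  note supp = vanishes_outside_dir_deriv[OF G(2)]
  note contG = Ck_on_imp_continuous_on[OF G(1)]
  have int: "integrable lborel (\<lambda>\<zeta>. w \<zeta> *\<^sub>R dir_deriv v G (p - \<iota> \<zeta>))" for v
    using conv_integrable[OF cont supp] .
  have "linear (\<lambda>h. conv (dir_deriv h G) p)"
  proof (rule linearI)
    show "conv (dir_deriv (u + v) G) p = conv (dir_deriv u G) p + conv (dir_deriv v G) p" for u v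
      using int by (simp add: conv_def linear_add[OF lin] scaleR_add_right)
    show "conv (dir_deriv (c *\<^sub>R v) G) p = c *\<^sub>R conv (dir_deriv v G) p" for c v
      unfolding conv_def linear_cmul[OF lin] scaleR_left_commute[of _ c] integral_scaleR_right ..
  qed
  then show "bounded_linear (\<lambda>h. conv (dir_deriv h G) p)" by (simp add: linear_conv_bounded_linear)
  fix e :: real assume e: "0 < e"
  define K where "K = (\<integral>\<zeta>. indicator (cball 0 (r + 1 + norm p)) \<zeta> * w \<zeta> \<partial>lborel)"
  have K: "K \<ge> 0" unfolding K_def by (rule integral_nonneg_AE) (simp add: w_nonneg)
  have "0 < e / (K + 1)" using e K by simp
  then obtain d where d: "0 < d" "d \<le> 1"
    "\<And>x h. norm h < d \<Longrightarrow> norm (G (x + h) - G x - dir_deriv h G x) \<le> e / (K + 1) * norm h"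
    using compact_support_uniform_derivative[OF G] by blast
  have "norm (conv G y - conv G p - conv (dir_deriv (y - p) G) p) \<le> e * norm (y - p)" if y: "norm (y - p) < d" for y
  proof -
    define h where "h = y - p"
    have h: "norm h < d" using y by (simp add: h_def)
    have shift: "r < norm (x + h)" if "r + 1 < norm x" for x
      using that h d(2) norm_triangle_ineq2[of x "-h"] by simp
    have sup: "vanishes_outside (r + 1) (\<lambda>x. G (x + h))" "vanishes_outside (r + 1) G"
      "vanishes_outside (r + 1) (dir_deriv h G)" "vanishes_outside (r + 1) (\<lambda>x. G (x + h) - G x)"
      "vanishes_outside (r + 1) (\<lambda>x. G (x + h) - G x - dir_deriv h G x)"
      using G(2) supp[of h] shift by (simp_all add: vanishes_outside_def)
    have c: "continuous_on UNIV (\<lambda>x. G (x + h))"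
      by (rule continuous_on_compose2[OF contG]) (auto intro!: continuous_intros)
    have c2: "continuous_on UNIV (\<lambda>x. G (x + h) - G x)" using c contG by (intro continuous_intros)
    have "norm (conv (\<lambda>x. G (x + h) - G x - dir_deriv h G x) p) \<le> e / (K + 1) * norm h * K"
      unfolding K_def
      by (rule conv_bound)
         (use d(3) h sup(5) c contG cont in \<open>auto simp: K_def[symmetric] intro!: continuous_intros\<close>)
    also have "\<dots> \<le> e * norm h"
    proof -
      have "e / (K + 1) * norm h * K = e * norm h * (K / (K + 1))" by simp
      also have "\<dots> \<le> e * norm h * 1" using e K by (intro mult_left_mono) (auto simp: field_simps)
      finally show ?thesis by simp
    qed
    finally have "norm (conv (\<lambda>x. G (x + h) - G x - dir_deriv h G x) p) \<le> e * norm h" .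
    moreover have "conv (\<lambda>x. G (x + h) - G x - dir_deriv h G x) p
        = conv G (p + h) - conv G p - conv (dir_deriv h G) p"
      by (simp add: conv_diff[OF c2 sup(4) cont sup(3)] conv_diff[OF c sup(1) contG sup(2)] conv_shift)
    ultimately show ?thesis by (simp add: h_def)
  qed
  then show "\<exists>d>0. \<forall>y. norm (y - p) < d \<longrightarrow> norm (conv G y - conv G p - conv (dir_deriv (y - p) G) p) \<le> e * norm (y - p)"
    using d(1) by blast
qed

lemma dir_deriv_conv:
  fixes G :: "'a \<Rightarrow> 'b::euclidean_space"
  assumes "Ck_on 1 UNIV G" "vanishes_outside r G"
  shows "dir_deriv v (conv G) = conv (dir_deriv v G)"
  using dir_deriv_eqI[OF conv_has_derivative[OF assms]] by auto

lemma Ck_on_conv: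
  fixes G :: "'a \<Rightarrow> 'b::euclidean_space"
  assumes "Ck_on k UNIV G" "vanishes_outside r G"
  shows "Ck_on k UNIV (conv G)"
  using assms
proof (induction k arbitrary: G)
  case 0 then show ?case using conv_continuous[of G r] by (metis Ck_on.simps(1))
next
  case (Suc k)
  have 1: "Ck_on 1 UNIV G" using Ck_on_le[OF Suc.prems(1), of 1] by simp
  have "Ck_on k UNIV (dir_deriv v (conv G))" for v
    unfolding dir_deriv_conv[OF 1 Suc.prems(2)]
    by (rule Suc.IH[OF _ vanishes_outside_dir_deriv[OF Suc.prems(2)]]) (use Suc.prems(1) in auto)
  moreover have "conv G differentiable_on UNIV"
    using conv_has_derivative[OF 1 Suc.prems(2)] by (auto simp: differentiable_on_def differentiable_def)
  ultimately show ?case by simp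
qed

end

text \<open>Convolution with the constant kernel 1 gives a constant function, so its derivative is
  zero; but this derivative is the convolution of the derivative of G.\<close>

lemma integral_dir_deriv_eq_0:
  fixes G :: "'a::euclidean_space \<Rightarrow> 'b::euclidean_space"
  assumes G: "Ck_on 1 UNIV G" "vanishes_outside r G"
  shows "(\<integral>x. dir_deriv v G x \<partial>lborel) = 0"
proof -
  interpret convolution_kernel "\<lambda>_::'a. 1::real" "\<lambda>\<zeta>::'a. \<zeta>"
    by unfold_locales (auto simp: linear_ident intro!: integrable_real_indicator emeasure_bounded_finite)
  have m: "G \<in> borel_measurable borel" "dir_deriv v G \<in> borel_measurable borel"
    using G(1) by (auto intro!: borel_measurable_continuous_onI Ck_on_imp_continuous_on[OF G(1)])
  have "conv G = (\<lambda>p. \<integral>x. G x \<partial>lborel)"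
    using lborel_integral_reflect[OF m(1)] by (simp add: conv_def fun_eq_iff)
  then have "dir_deriv v (conv G) 0 = 0" by simp
  then show ?thesis
    using lborel_integral_reflect[OF m(2), of 0] by (simp add: dir_deriv_conv[OF G] conv_def)
qed

lemma integrable_compact_support:
  fixes G :: "'a::euclidean_space \<Rightarrow> 'b::euclidean_space"
  assumes G: "continuous_on UNIV G" "vanishes_outside r G"
  shows "integrable lborel G"
proof -
  have "integrable lborel (\<lambda>x. indicator (cball 0 r) x *\<^sub>R G x)"
    using borel_integrable_compact[OF compact_cball continuous_on_subset[OF G(1)], of 0 r]
    by (simp add: indicator_def if_distrib cong: if_cong)
  moreover have "(\<lambda>x. indicator (cball 0 r) x *\<^sub>R G x) = G"
    using G(2) by (auto simp: fun_eq_iff indicator_def vanishes_outsideD)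
  ultimately show ?thesis by simp
qed

lemma integral_by_parts:
  fixes \<phi> :: "'a::euclidean_space \<Rightarrow> real" and G :: "'a \<Rightarrow> 'b::euclidean_space"
  assumes \<phi>: "Ck_on 1 UNIV \<phi>" and G: "Ck_on 1 UNIV G" "vanishes_outside r G"
  shows "(\<integral>x. \<phi> x *\<^sub>R dir_deriv v G x \<partial>lborel) = - (\<integral>x. dir_deriv v \<phi> x *\<^sub>R G x \<partial>lborel)"
proof -
  have d: "\<phi> differentiable (at x)" "G differentiable (at x)" for x
    using Ck_on_differentiable \<phi> G by (metis UNIV_I open_UNIV zero_less_one)+
  have c: "continuous_on UNIV \<phi>" "continuous_on UNIV (dir_deriv v \<phi>)"
    "continuous_on UNIV G" "continuous_on UNIV (dir_deriv v G)"
    using \<phi> G(1) by (auto intro: differentiable_imp_continuous_on)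
  have i: "integrable lborel (\<lambda>x. \<phi> x *\<^sub>R dir_deriv v G x)" "integrable lborel (\<lambda>x. dir_deriv v \<phi> x *\<^sub>R G x)"
    by (rule integrable_compact_support[where r = r], use c G(2) vanishes_outside_dir_deriv[OF G(2), of v]
        in \<open>auto intro!: continuous_intros simp: vanishes_outside_def\<close>)+
  have vo: "vanishes_outside r (\<lambda>x. \<phi> x *\<^sub>R G x)" using G(2) by (simp add: vanishes_outside_def)
  have "Ck_on 1 UNIV (\<lambda>x. \<phi> x *\<^sub>R G x)" by (rule Ck_on_scaleR[OF open_UNIV \<phi> G(1)])
  from integral_dir_deriv_eq_0[OF this vo, of v]
  have "(\<integral>x. dir_deriv v \<phi> x *\<^sub>R G x + \<phi> x *\<^sub>R dir_deriv v G x \<partial>lborel) = 0"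
    by (simp add: dir_deriv_scaleR[OF d])
  then show ?thesis using i by (simp add: add_eq_0_iff)
qed

subsection \<open>The Newton kernel in dimension four\<close>

lemma nn_integral_even:
  fixes g :: "real \<Rightarrow> ennreal"
  assumes [measurable]: "g \<in> borel_measurable borel"
  shows "(\<integral>\<^sup>+t. g \<bar>t\<bar> \<partial>lborel) \<le> 2 * (\<integral>\<^sup>+t. g t * indicator {0..} t \<partial>lborel)"
proof -
  have "(\<integral>\<^sup>+t. g \<bar>t\<bar> \<partial>lborel) \<le> (\<integral>\<^sup>+t. g t * indicator {0..} t + g (0 + -1 * t) * indicator {0..} (0 + -1 * t) \<partial>lborel)"
    by (rule nn_integral_mono) (auto simp: indicator_def)
  also have "\<dots> = (\<integral>\<^sup>+t. g t * indicator {0..} t \<partial>lborel) + (\<integral>\<^sup>+t. g (0 + -1 * t) * indicator {0..} (0 + -1 * t) \<partial>lborel)"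
    by (rule nn_integral_add) auto
  also have "(\<integral>\<^sup>+t. g (0 + -1 * t) * indicator {0..} (0 + -1 * t) \<partial>lborel) = (\<integral>\<^sup>+t. g t * indicator {0..} t \<partial>lborel)"
    using nn_integral_real_affine[of "\<lambda>t. g t * indicator {0..} t" "-1" 0] by simp
  finally show ?thesis by (simp add: mult_2)
qed

text \<open>Stands in for polar coordinates: a bound by a product of functions of single coordinates
  reduces integrability to dimension one.\<close>

lemma nn_integral_product_finite:
  fixes g :: "real \<Rightarrow> real" and f :: "'a::euclidean_space \<Rightarrow> real"
  assumes [measurable]: "g \<in> borel_measurable borel" and g: "\<And>t. 0 \<le> g t"
    and fin: "(\<integral>\<^sup>+t. ennreal (g \<bar>t\<bar>) \<partial>lborel) < \<infinity>"
    and [measurable]: "f \<in> borel_measurable borel"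
    and f: "AE x in lborel. norm (f x) \<le> (\<Prod>b\<in>Basis. g \<bar>x \<bullet> b\<bar>)"
  shows "integrable lborel f"
proof (rule integrableI_bounded)
  have "(\<integral>\<^sup>+x. ennreal (norm (f x)) \<partial>lborel) \<le> (\<integral>\<^sup>+x. (\<Prod>b\<in>(Basis::'a set). ennreal (g \<bar>x \<bullet> b\<bar>)) \<partial>lborel)"
    by (rule nn_integral_mono_AE) (use f g in \<open>auto simp: prod_ennreal intro: ennreal_leI\<close>)
  also have "\<dots> = (\<Prod>b\<in>(Basis::'a set). \<integral>\<^sup>+t. ennreal (g \<bar>t\<bar>) \<partial>lborel)"
    by (rule nn_integral_lborel_prod) (use g in auto)
  also have "\<dots> < \<infinity>" using fin by (simp add: power_less_top_ennreal)
  finally show "(\<integral>\<^sup>+x. ennreal (norm (f x)) \<partial>lborel) < \<infinity>" .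
qed simp

lemma AE_lborel_coordinate_nonzero:
  assumes "b \<in> Basis"
  shows "AE x in lborel. x \<bullet> b \<noteq> (0::real)"
proof -
  have "{x. x \<bullet> b = 0} \<in> null_sets lebesgue"
    using negligible_standard_hyperplane[OF assms, of 0] negligible_iff_null_sets by blast
  moreover have "{x. x \<bullet> b = 0} \<in> sets lborel"
    by (simp add: borel_closed closed_hyperplane[of b 0, unfolded inner_commute[of b]])
  ultimately have "{x. x \<bullet> b = 0} \<in> null_sets lborel"
    by (simp add: null_sets_completion_iff)
  then show ?thesis by (rule AE_I') auto
qed

text \<open>In four real dimensions, those of one quaternionic variable, this is a constant multiple
  of the fundamental solution of the Laplacian.\<close>

definition newton_kernel :: "'c::euclidean_space \<Rightarrow> real" where
  "newton_kernel \<zeta> = inverse (\<zeta> \<bullet> \<zeta>)"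

lemma newton_kernel_measurable [measurable]: "newton_kernel \<in> borel_measurable borel"
  unfolding newton_kernel_def[abs_def] by measurable

text \<open>|x|^(-2) is the product of four factors |x|^(-1/2), each at most |x_b|^(-1/2), which is
  integrable near 0.\<close>

lemma newton_kernel_integrable:
  assumes D: "DIM('c::euclidean_space) = 4"
  shows "integrable lborel (\<lambda>\<zeta>::'c. indicator (cball 0 r) \<zeta> * newton_kernel \<zeta>)"
proof (rule nn_integral_product_finite[where g = "\<lambda>t. indicator {..\<bar>r\<bar>} t * t powr (-1/2)"])
  have "(\<integral>\<^sup>+t. ennreal (indicator {..\<bar>r\<bar>} t * t powr (-1/2)) * indicator {0..} t \<partial>lborel)
      = (\<integral>\<^sup>+t. ennreal (t powr (-1/2)) * indicator {0..\<bar>r\<bar>} t \<partial>lborel)"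
    by (rule nn_integral_cong) (auto simp: indicator_def)
  also have "\<dots> < \<infinity>"
    using nn_integral_has_integral_lebesgue'[OF _ has_integral_powr_from_0[of "-1/2" "\<bar>r\<bar>"]] by simp
  finally have "2 * (\<integral>\<^sup>+t. ennreal (indicator {..\<bar>r\<bar>} t * t powr (-1/2)) * indicator {0..} t \<partial>lborel) < \<infinity>"
    by (simp add: ennreal_mult_less_top)
  then show "(\<integral>\<^sup>+t. ennreal (indicator {..\<bar>r\<bar>} \<bar>t\<bar> * \<bar>t\<bar> powr (-1/2)) \<partial>lborel) < \<infinity>"
    by (rule le_less_trans[OF nn_integral_even[where g = "\<lambda>t. ennreal (indicator {..\<bar>r\<bar>} t * t powr (-1/2))"], rotated]) measurable
  \<comment> \<open>Since \<open>0 powr a\<close> is 0, the product bound fails on the coordinate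
    hyperplanes; these are null sets.\<close>
  have "AE x in lborel. \<forall>b\<in>(Basis::'c set). x \<bullet> b \<noteq> 0"
    by (rule AE_finite_allI) (auto intro: AE_lborel_coordinate_nonzero)
  then show "AE x in lborel. norm (indicator (cball 0 r) x * newton_kernel x)
      \<le> (\<Prod>b\<in>(Basis::'c set). indicator {..\<bar>r\<bar>} \<bar>x \<bullet> b\<bar> * \<bar>x \<bullet> b\<bar> powr (-1/2))"
  proof eventually_elim
    case (elim x)
    obtain b :: 'c where "b \<in> Basis" using nonempty_Basis by blast
    then have x0: "x \<noteq> 0" using elim by auto
    show ?case
    proof (cases "norm x \<le> r")
      case True
      have "norm (indicator (cball 0 r) x * newton_kernel x) = norm x powr (-2)"
        using True x0 by (simp add: newton_kernel_def powr_minus power2_norm_eq_inner[symmetric])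
      also have "\<dots> = (\<Prod>b\<in>(Basis::'c set). norm x powr (-1/2))"
        using x0 by (simp add: D powr_power)
      also have "\<dots> \<le> (\<Prod>b\<in>(Basis::'c set). indicator {..\<bar>r\<bar>} \<bar>x \<bullet> b\<bar> * \<bar>x \<bullet> b\<bar> powr (-1/2))"
      proof (rule prod_mono)
        fix b :: 'c assume b: "b \<in> Basis"
        have "\<bar>x \<bullet> b\<bar> \<le> norm x" using Basis_le_norm[OF b] .
        then show "0 \<le> norm x powr (-1/2) \<and>
            norm x powr (-1/2) \<le> indicator {..\<bar>r\<bar>} \<bar>x \<bullet> b\<bar> * \<bar>x \<bullet> b\<bar> powr (-1/2)"
          using True elim b by (auto simp: indicator_def intro!: powr_mono2')
      qed
      finally show ?thesis .
    qed (simp add: prod_nonneg)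
  qed
  show "(\<lambda>\<zeta>::'c. indicator (cball 0 r) \<zeta> * newton_kernel \<zeta>) \<in> borel_measurable borel"
    by (intro borel_measurable_times borel_measurable_indicator newton_kernel_measurable) simp
qed auto

text \<open>Removes the singularity at 0. In dimension four its Laplacian is -8 \<epsilon>^2 times
  its own cube, and these Laplacians are, up to a constant factor, an approximate identity as
  \<epsilon> tends to 0.\<close>

definition regularized_kernel :: "real \<Rightarrow> 'c::euclidean_space \<Rightarrow> real" where
  "regularized_kernel \<epsilon> \<zeta> = inverse (\<zeta> \<bullet> \<zeta> + \<epsilon>\<^sup>2)"

lemma regularized_kernel_measurable [measurable]: "regularized_kernel \<epsilon> \<in> borel_measurable borel"
  unfolding regularized_kernel_def[abs_def] by measurable

text \<open>The cube is the product of four factors (|x|^2 + 1)^(-3/4), each at most 1 and at most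
  |x_b|^(-3/2).\<close>

lemma regularized_kernel_cubed_integrable:
  assumes D: "DIM('c::euclidean_space) = 4"
  shows "integrable lborel (\<lambda>\<zeta>::'c. regularized_kernel 1 \<zeta> ^ 3)"
proof (rule nn_integral_product_finite[where g = "\<lambda>t. indicator {..1} t + indicator {1..} t * t powr (-3/2)"])
  have "(\<integral>\<^sup>+t. ennreal (indicator {..1} t + indicator {1..} t * t powr (-3/2)) * indicator {0..} t \<partial>lborel)
      = (\<integral>\<^sup>+t. indicator {0..1} t + ennreal (t powr (-3/2)) * indicator {1..} t \<partial>lborel)"
    by (rule nn_integral_cong) (auto simp: indicator_def)
  also have "\<dots> = (\<integral>\<^sup>+t. indicator {0..1::real} t \<partial>lborel) + (\<integral>\<^sup>+t. ennreal (t powr (-3/2)) * indicator {1..} t \<partial>lborel)"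
    by (rule nn_integral_add) auto
  also have "\<dots> < \<infinity>"
    using nn_integral_has_integral_lebesgue'[OF _ has_integral_powr_to_inf[of "-3/2" 1]] by simp
  finally have "2 * (\<integral>\<^sup>+t. ennreal (indicator {..1} t + indicator {1..} t * t powr (-3/2)) * indicator {0..} t \<partial>lborel) < \<infinity>"
    by (simp add: ennreal_mult_less_top)
  then show "(\<integral>\<^sup>+t. ennreal (indicator {..1} \<bar>t\<bar> + indicator {1..} \<bar>t\<bar> * \<bar>t\<bar> powr (-3/2)) \<partial>lborel) < \<infinity>"
    by (rule le_less_trans[OF nn_integral_even[where g = "\<lambda>t. ennreal (indicator {..1} t + indicator {1..} t * t powr (-3/2))"], rotated]) measurable
  have "norm (regularized_kernel 1 x ^ 3)
      \<le> (\<Prod>b\<in>(Basis::'c set). indicator {..1} \<bar>x \<bullet> b\<bar> + indicator {1..} \<bar>x \<bullet> b\<bar> * \<bar>x \<bullet> b\<bar> powr (-3/2))" for x :: 'c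
  proof -
    let ?q = "x \<bullet> x + 1"
    have q: "?q > 0" by (simp add: add_nonneg_pos)
    have "norm (regularized_kernel 1 x ^ 3) = ?q powr (-3)"
      using q by (simp add: regularized_kernel_def powr_minus power_inverse)
    also have "\<dots> = (\<Prod>b\<in>(Basis::'c set). ?q powr (-3/4))"
      using q by (simp add: D powr_power)
    also have "\<dots> \<le> (\<Prod>b\<in>(Basis::'c set). indicator {..1} \<bar>x \<bullet> b\<bar> + indicator {1..} \<bar>x \<bullet> b\<bar> * \<bar>x \<bullet> b\<bar> powr (-3/2))"
    proof (rule prod_mono)
      fix b :: 'c assume b: "b \<in> Basis"
      show "0 \<le> ?q powr (-3/4) \<and>
          ?q powr (-3/4) \<le> indicator {..1} \<bar>x \<bullet> b\<bar> + indicator {1..} \<bar>x \<bullet> b\<bar> * \<bar>x \<bullet> b\<bar> powr (-3/2)"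
      proof (cases "\<bar>x \<bullet> b\<bar> \<le> 1")
        case True
        have "?q powr (-3/4) \<le> 1 powr (-3/4)" by (rule powr_mono2') auto
        then show ?thesis using True by (auto simp: indicator_def)
      next
        case False
        have "(\<bar>x \<bullet> b\<bar>)\<^sup>2 \<le> ?q"
          using power_mono[OF Basis_le_norm[OF b, of x], of 2] by (simp add: power2_norm_eq_inner)
        then have "?q powr (-3/4) \<le> (\<bar>x \<bullet> b\<bar>\<^sup>2) powr (-3/4)"
          using False by (intro powr_mono2') auto
        also have "\<dots> = (\<bar>x \<bullet> b\<bar> powr 2) powr (-3/4)" using False by simp
        also have "\<dots> = \<bar>x \<bullet> b\<bar> powr (-3/2)" unfolding powr_powr by simp
        finally show ?thesis using False by (auto simp: indicator_def)
      qed
    qed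
    finally show ?thesis .
  qed
  then show "AE x in lborel. norm (regularized_kernel 1 x ^ 3)
      \<le> (\<Prod>b\<in>(Basis::'c set). indicator {..1} \<bar>x \<bullet> b\<bar> + indicator {1..} \<bar>x \<bullet> b\<bar> * \<bar>x \<bullet> b\<bar> powr (-3/2))" by simp
qed (auto simp: indicator_def)

lemma regularized_kernel_pos: "\<epsilon> \<noteq> 0 \<Longrightarrow> 0 < regularized_kernel \<epsilon> \<zeta>"
  by (simp add: regularized_kernel_def add_nonneg_pos)

lemma dir_deriv_inner_self: "dir_deriv v (\<lambda>\<zeta>::'c::real_inner. \<zeta> \<bullet> \<zeta> + c) x = 2 * (x \<bullet> v)"
  by (rule dir_deriv_eqI) (auto intro!: derivative_eq_intros simp: inner_commute)

lemma Ck_on_regularized_kernel: "\<epsilon> \<noteq> 0 \<Longrightarrow> Ck_on k UNIV (regularized_kernel \<epsilon> :: 'c::euclidean_space \<Rightarrow> real)"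
  unfolding regularized_kernel_def[abs_def]
  by (intro Ck_on_inverse Ck_on_add Ck_on_inner Ck_on_const Ck_on_linear[OF bounded_linear_ident])
     (auto simp: add_nonneg_eq_0_iff)

lemma dir_deriv_regularized_kernel:
  assumes "\<epsilon> \<noteq> 0"
  shows "dir_deriv v (regularized_kernel \<epsilon>) = (\<lambda>x. - 2 * (x \<bullet> v) * (regularized_kernel \<epsilon> x)\<^sup>2)"
proof
  fix x :: 'a
  have "Ck_on 1 UNIV (\<lambda>\<zeta>::'a. \<zeta> \<bullet> \<zeta> + \<epsilon>\<^sup>2)"
    by (intro Ck_on_add Ck_on_inner Ck_on_const Ck_on_linear[OF bounded_linear_ident] open_UNIV)
  then have "(\<lambda>\<zeta>. \<zeta> \<bullet> \<zeta> + \<epsilon>\<^sup>2) differentiable (at x)"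
    by (rule Ck_on_differentiable) auto
  moreover have "x \<bullet> x + \<epsilon>\<^sup>2 \<noteq> 0" using assms by (simp add: add_nonneg_eq_0_iff)
  ultimately show "dir_deriv v (regularized_kernel \<epsilon>) x = - 2 * (x \<bullet> v) * (regularized_kernel \<epsilon> x)\<^sup>2"
    unfolding regularized_kernel_def[abs_def]
    by (subst dir_deriv_inverse) (simp_all add: dir_deriv_inner_self power2_eq_square)
qed

lemma dir_deriv2_regularized_kernel:
  assumes e: "\<epsilon> \<noteq> 0"
  shows "dir_deriv v (dir_deriv v (regularized_kernel \<epsilon>)) x
    = - 2 * (v \<bullet> v) * (regularized_kernel \<epsilon> x)\<^sup>2 + 8 * (x \<bullet> v)\<^sup>2 * (regularized_kernel \<epsilon> x) ^ 3"
proof -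
  have d: "regularized_kernel \<epsilon> differentiable (at x)"
    using Ck_on_differentiable[OF Ck_on_regularized_kernel[OF e, of 1]] by simp
  show ?thesis
    unfolding dir_deriv_regularized_kernel[OF e]
    by (rule trans[OF dir_deriv_eqI])
       (auto intro!: derivative_eq_intros has_derivative_dir_deriv[OF d]
         simp: dir_deriv_regularized_kernel[OF e] power2_eq_square power3_eq_cube algebra_simps)
qed

lemma laplacian_regularized_kernel:
  assumes "\<epsilon> \<noteq> 0" "DIM('c::euclidean_space) = 4"
  shows "(\<Sum>b\<in>Basis. dir_deriv b (dir_deriv b (regularized_kernel \<epsilon>)) (x::'c)) = - 8 * \<epsilon>\<^sup>2 * (regularized_kernel \<epsilon> x) ^ 3"
proof -
  have *: "(\<Sum>b\<in>Basis. (x \<bullet> b) * (x \<bullet> b)) = x \<bullet> x"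
    by (rule euclidean_inner[symmetric])
  let ?N = "regularized_kernel \<epsilon> x"
  \<comment> \<open>With this the terms quadratic in the kernel cancel: their coefficients are 8 and
    -2 times the dimension, and the dimension is four.\<close>
  have q: "(x \<bullet> x) * ?N = 1 - \<epsilon>\<^sup>2 * ?N"
    using assms(1) by (simp add: regularized_kernel_def field_simps add_nonneg_eq_0_iff)
  have "(\<Sum>b\<in>Basis. dir_deriv b (dir_deriv b (regularized_kernel \<epsilon>)) x) = - 8 * ?N\<^sup>2 + 8 * ((x \<bullet> x) * ?N) * ?N\<^sup>2"
    unfolding dir_deriv2_regularized_kernel[OF assms(1)] sum.distrib
    using assms(2) by (simp add: * sum_distrib_left[symmetric] sum_distrib_right[symmetric] power2_eq_square power3_eq_cube)
  also have "\<dots> = - 8 * \<epsilon>\<^sup>2 * ?N ^ 3" unfolding q by (simp add: algebra_simps power2_eq_square power3_eq_cube)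
  finally show ?thesis .
qed

lemma convolution_kernel_newton:
  fixes \<iota> :: "'c::euclidean_space \<Rightarrow> 'a::euclidean_space"
  assumes "DIM('c) = 4" "linear \<iota>" "\<And>\<zeta>. norm (\<iota> \<zeta>) = norm \<zeta>"
  shows "convolution_kernel newton_kernel \<iota>"
  by (rule convolution_kernel.intro)
     (use assms newton_kernel_integrable[OF assms(1)] in \<open>auto simp: newton_kernel_def[abs_def]\<close>)

text \<open>In dimension four, the integral of minus the Laplacian of
  \<open>regularized_kernel \<epsilon>\<close>, which by scaling is the same for all \<epsilon> > 0.
  The type argument records the space that is integrated over.\<close>

definition newton_mass :: "'c::euclidean_space itself \<Rightarrow> real" where
  "newton_mass _ = 8 * (\<integral>\<zeta>. regularized_kernel 1 (\<zeta>::'c) ^ 3 \<partial>lborel)"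

lemma newton_mass_pos:
  assumes "DIM('c::euclidean_space) = 4"
  shows "0 < newton_mass TYPE('c)"
proof -
  have "0 \<le> (\<integral>\<zeta>. regularized_kernel 1 (\<zeta>::'c) ^ 3 \<partial>lborel)"
    by (rule integral_nonneg_AE) (simp add: regularized_kernel_pos less_imp_le)
  moreover have "(\<integral>\<zeta>. regularized_kernel 1 (\<zeta>::'c) ^ 3 \<partial>lborel) \<noteq> 0"
  proof
    assume "(\<integral>\<zeta>. regularized_kernel 1 (\<zeta>::'c) ^ 3 \<partial>lborel) = 0"
    then have "AE \<zeta> in lborel. regularized_kernel 1 (\<zeta>::'c) ^ 3 = 0"
      by (subst (asm) integral_nonneg_eq_0_iff_AE)
         (auto simp: regularized_kernel_cubed_integrable[OF assms] regularized_kernel_pos less_imp_le)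
    moreover have "regularized_kernel 1 (\<zeta>::'c) \<noteq> 0" for \<zeta>
      using regularized_kernel_pos[of 1 \<zeta>] by simp
    ultimately have "AE \<zeta> in (lborel :: 'c measure). False" by simp
    then show False by (simp add: AE_iff_null null_sets_def)
  qed
  ultimately show ?thesis by (simp add: newton_mass_def)
qed

text \<open>Both derivatives are moved onto the smooth kernel, whose Laplacian is known; then the
  variable is rescaled by \<epsilon>.\<close>

lemma integral_regularized_kernel_laplacian:
  fixes \<phi> :: "'c::euclidean_space \<Rightarrow> 'b::euclidean_space"
  assumes D: "DIM('c) = 4" and e: "0 < \<epsilon>" and \<phi>: "Ck_on 2 UNIV \<phi>" "vanishes_outside r \<phi>"
  shows "(\<integral>\<zeta>. regularized_kernel \<epsilon> \<zeta> *\<^sub>R (\<Sum>b\<in>Basis. dir_deriv b (dir_deriv b \<phi>) \<zeta>) \<partial>lborel)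
    = - 8 *\<^sub>R (\<integral>\<zeta>. regularized_kernel 1 \<zeta> ^ 3 *\<^sub>R \<phi> (\<epsilon> *\<^sub>R \<zeta>) \<partial>lborel)"
proof -
  let ?N = "regularized_kernel \<epsilon> :: 'c \<Rightarrow> real"
  have N: "Ck_on k UNIV ?N" for k by (rule Ck_on_regularized_kernel) (use e in simp)
  have N': "Ck_on 1 UNIV (dir_deriv b ?N)" for b by (rule Ck_on_dir_deriv[OF N])
  have \<phi>1: "Ck_on 1 UNIV \<phi>" by (rule Ck_on_le[OF \<phi>(1)]) simp
  have \<phi>1': "Ck_on 1 UNIV (dir_deriv b \<phi>)" for b
    using \<phi>(1) Ck_on_dir_deriv[of 1] by (simp add: numeral_2_eq_2)
  have c: "continuous_on UNIV (dir_deriv b (dir_deriv b \<phi>))" "continuous_on UNIV \<phi>"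
    "continuous_on UNIV ?N" "continuous_on UNIV (dir_deriv b (dir_deriv b ?N))" for b
    using \<phi>1' N' Ck_on_imp_continuous_on[OF \<phi>1] Ck_on_imp_continuous_on[OF N] by auto
  have i: "integrable lborel (\<lambda>\<zeta>. ?N \<zeta> *\<^sub>R dir_deriv b (dir_deriv b \<phi>) \<zeta>)"
    "integrable lborel (\<lambda>\<zeta>. dir_deriv b (dir_deriv b ?N) \<zeta> *\<^sub>R \<phi> \<zeta>)" for b
    by (rule integrable_compact_support[where r = r],
        use c \<phi>(2) vanishes_outside_dir_deriv[OF vanishes_outside_dir_deriv[OF \<phi>(2)], of b b]
        in \<open>auto intro!: continuous_intros simp: vanishes_outside_def\<close>)+
  have "(\<integral>\<zeta>. ?N \<zeta> *\<^sub>R (\<Sum>b\<in>Basis. dir_deriv b (dir_deriv b \<phi>) \<zeta>) \<partial>lborel)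
      = (\<Sum>b\<in>Basis. \<integral>\<zeta>. ?N \<zeta> *\<^sub>R dir_deriv b (dir_deriv b \<phi>) \<zeta> \<partial>lborel)"
    unfolding scaleR_sum_right by (rule Bochner_Integration.integral_sum) (rule i)
  also have "\<dots> = (\<Sum>b\<in>Basis. \<integral>\<zeta>. dir_deriv b (dir_deriv b ?N) \<zeta> *\<^sub>R \<phi> \<zeta> \<partial>lborel)"
    by (simp add: integral_by_parts[OF N \<phi>1' vanishes_outside_dir_deriv[OF \<phi>(2)]] integral_by_parts[OF N' \<phi>1 \<phi>(2)])
  also have "\<dots> = (\<integral>\<zeta>. (\<Sum>b\<in>Basis. dir_deriv b (dir_deriv b ?N) \<zeta>) *\<^sub>R \<phi> \<zeta> \<partial>lborel)"
    unfolding scaleR_sum_left by (rule Bochner_Integration.integral_sum[symmetric]) (rule i)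
  also have "\<dots> = (\<integral>\<zeta>. - 8 *\<^sub>R ((\<epsilon>\<^sup>2 * ?N \<zeta> ^ 3) *\<^sub>R \<phi> \<zeta>) \<partial>lborel)"
    using e by (subst laplacian_regularized_kernel) (simp_all add: D mult.assoc)
  also have "\<dots> = - 8 *\<^sub>R (\<integral>\<zeta>. (\<epsilon>\<^sup>2 * ?N \<zeta> ^ 3) *\<^sub>R \<phi> \<zeta> \<partial>lborel)"
    by (rule integral_scaleR_right)
  also have "(\<integral>\<zeta>. (\<epsilon>\<^sup>2 * ?N \<zeta> ^ 3) *\<^sub>R \<phi> \<zeta> \<partial>lborel)
      = \<epsilon> ^ 4 *\<^sub>R (\<integral>\<zeta>. (\<epsilon>\<^sup>2 * ?N (\<epsilon> *\<^sub>R \<zeta>) ^ 3) *\<^sub>R \<phi> (\<epsilon> *\<^sub>R \<zeta>) \<partial>lborel)"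
  proof -
    have "(\<lambda>\<zeta>. (\<epsilon>\<^sup>2 * ?N \<zeta> ^ 3) *\<^sub>R \<phi> \<zeta>) \<in> borel_measurable borel"
      by (intro borel_measurable_continuous_onI continuous_intros c)
    then show ?thesis by (subst lborel_integral_affine[where c = \<epsilon> and t = 0]) (use e D in simp_all)
  qed
  also have "\<dots> = (\<integral>\<zeta>. \<epsilon> ^ 4 *\<^sub>R ((\<epsilon>\<^sup>2 * ?N (\<epsilon> *\<^sub>R \<zeta>) ^ 3) *\<^sub>R \<phi> (\<epsilon> *\<^sub>R \<zeta>)) \<partial>lborel)"
    by (rule integral_scaleR_right[symmetric])
  \<comment> \<open>The powers cancel: \<epsilon>^4 from the Jacobian, \<epsilon>^2 from the
    Laplacian and \<epsilon>^(-6) from the cubed kernel.\<close>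
  also have "\<dots> = (\<integral>\<zeta>. regularized_kernel 1 \<zeta> ^ 3 *\<^sub>R \<phi> (\<epsilon> *\<^sub>R \<zeta>) \<partial>lborel)"
  proof -
    have "\<epsilon> ^ 4 * (\<epsilon>\<^sup>2 * ?N (\<epsilon> *\<^sub>R \<zeta>) ^ 3) = regularized_kernel 1 \<zeta> ^ 3" for \<zeta> :: 'c
    proof -
      have "(\<epsilon> *\<^sub>R \<zeta>) \<bullet> (\<epsilon> *\<^sub>R \<zeta>) + \<epsilon>\<^sup>2 = \<epsilon>\<^sup>2 * (\<zeta> \<bullet> \<zeta> + 1)" by (simp add: power2_eq_square algebra_simps)
      then have "?N (\<epsilon> *\<^sub>R \<zeta>) = inverse (\<epsilon>\<^sup>2) * regularized_kernel 1 \<zeta>"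
        by (simp add: regularized_kernel_def)
      then have "\<epsilon> ^ 4 * (\<epsilon>\<^sup>2 * ?N (\<epsilon> *\<^sub>R \<zeta>) ^ 3) = (\<epsilon>\<^sup>2 * inverse (\<epsilon>\<^sup>2)) ^ 3 * regularized_kernel 1 \<zeta> ^ 3"
        by (simp add: power_mult_distrib power_mult[symmetric] power_add[symmetric])
      then show ?thesis using e by simp
    qed
    then show ?thesis by simp
  qed
  finally show ?thesis .
qed

text \<open>Let \<epsilon> tend to 0 in the regularised identity. On the left
  \<open>newton_kernel\<close> dominates, on the right the integrable cube times a bound for
  \<phi>.\<close>

lemma integral_newton_kernel_laplacian:
  fixes \<phi> :: "'c::euclidean_space \<Rightarrow> 'b::euclidean_space"
  assumes D: "DIM('c) = 4" and \<phi>: "Ck_on 2 UNIV \<phi>" "vanishes_outside r \<phi>"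
  shows "(\<integral>\<zeta>. newton_kernel \<zeta> *\<^sub>R (\<Sum>b\<in>Basis. dir_deriv b (dir_deriv b \<phi>) \<zeta>) \<partial>lborel)
    = - newton_mass TYPE('c) *\<^sub>R \<phi> 0"
proof -
  interpret convolution_kernel newton_kernel "\<lambda>\<zeta>::'c. \<zeta>"
    by (rule convolution_kernel_newton) (use D in \<open>auto simp: linear_ident\<close>)
  define L where "L = (\<lambda>\<zeta>. \<Sum>b\<in>Basis. dir_deriv b (dir_deriv b \<phi>) \<zeta>)"
  define e where "e n = inverse (real (Suc n))" for n
  have e: "0 < e n" for n by (simp add: e_def)
  have e0: "e \<longlonglongrightarrow> 0" unfolding e_def by (rule LIMSEQ_inverse_real_of_nat)
  have cont: "continuous_on UNIV (dir_deriv b (dir_deriv b \<phi>))" "continuous_on UNIV \<phi>" for b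
    using \<phi>(1) by (auto simp: numeral_2_eq_2 intro: differentiable_imp_continuous_on)
  have contL: "continuous_on UNIV L" unfolding L_def by (intro continuous_intros cont)
  have suppL: "vanishes_outside r L"
    using vanishes_outside_dir_deriv[OF vanishes_outside_dir_deriv[OF \<phi>(2)]]
    by (simp add: vanishes_outside_def L_def)
  have [measurable]: "L \<in> borel_measurable borel" "\<phi> \<in> borel_measurable borel"
    using contL cont by (auto intro: borel_measurable_continuous_onI)
  have intL: "integrable lborel (\<lambda>\<zeta>. newton_kernel \<zeta> *\<^sub>R L \<zeta>)"
  proof -
    have "integrable lborel (\<lambda>\<zeta>. newton_kernel \<zeta> *\<^sub>R (\<lambda>x. L (- x)) (0 - \<zeta>))"
      by (rule conv_integrable[where r = r])
         (use suppL continuous_on_compose2[OF contL continuous_on_minus[OF continuous_on_id], of UNIV]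
           in \<open>auto simp: vanishes_outside_def\<close>)
    then show ?thesis by simp
  qed
  have "(\<lambda>n. \<integral>\<zeta>. regularized_kernel (e n) \<zeta> *\<^sub>R L \<zeta> \<partial>lborel) \<longlonglongrightarrow> (\<integral>\<zeta>. newton_kernel \<zeta> *\<^sub>R L \<zeta> \<partial>lborel)"
  proof (rule integral_dominated_convergence[where w = "\<lambda>\<zeta>. norm (newton_kernel \<zeta> *\<^sub>R L \<zeta>)"])
    have ne: "AE \<zeta> in lborel. \<zeta> \<noteq> (0::'c)" by (rule AE_lborel_singleton)
    show "AE \<zeta> in lborel. (\<lambda>n. regularized_kernel (e n) \<zeta> *\<^sub>R L \<zeta>) \<longlonglongrightarrow> newton_kernel \<zeta> *\<^sub>R L \<zeta>"
      using ne
    proof eventually_elim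
      case (elim \<zeta>)
      have "(\<lambda>n. inverse (\<zeta> \<bullet> \<zeta> + (e n)\<^sup>2)) \<longlonglongrightarrow> inverse (\<zeta> \<bullet> \<zeta> + 0\<^sup>2)"
        by (intro tendsto_intros e0) (use elim in simp)
      then show ?case by (intro tendsto_intros) (simp add: regularized_kernel_def newton_kernel_def)
    qed
    show "AE \<zeta> in lborel. norm (regularized_kernel (e n) \<zeta> *\<^sub>R L \<zeta>) \<le> norm (newton_kernel \<zeta> *\<^sub>R L \<zeta>)" for n
      using ne
    proof eventually_elim
      case (elim \<zeta>)
      have "\<bar>regularized_kernel (e n) \<zeta>\<bar> \<le> \<bar>newton_kernel \<zeta>\<bar>"
        using elim by (auto simp: regularized_kernel_def newton_kernel_def intro!: le_imp_inverse_le)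
      then show ?case by (simp add: mult_right_mono)
    qed
  qed (use integrable_norm[OF intL] in simp_all)
  moreover have "(\<lambda>n. \<integral>\<zeta>. regularized_kernel (e n) \<zeta> *\<^sub>R L \<zeta> \<partial>lborel) \<longlonglongrightarrow> - newton_mass TYPE('c) *\<^sub>R \<phi> 0"
  proof -
    obtain M where M: "M > 0" "\<And>x. norm (\<phi> x) \<le> M" using compact_support_bounded[OF cont(2) \<phi>(2)] by blast
    have "(\<lambda>n. \<integral>\<zeta>. regularized_kernel 1 \<zeta> ^ 3 *\<^sub>R \<phi> (e n *\<^sub>R \<zeta>) \<partial>lborel)
      \<longlonglongrightarrow> (\<integral>\<zeta>. regularized_kernel 1 (\<zeta>::'c) ^ 3 *\<^sub>R \<phi> 0 \<partial>lborel)"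
    proof (rule integral_dominated_convergence[where w = "\<lambda>\<zeta>. regularized_kernel 1 \<zeta> ^ 3 * M"])
      show "AE \<zeta> in lborel. (\<lambda>n. regularized_kernel 1 \<zeta> ^ 3 *\<^sub>R \<phi> (e n *\<^sub>R \<zeta>)) \<longlonglongrightarrow> regularized_kernel 1 \<zeta> ^ 3 *\<^sub>R \<phi> 0"
      proof (rule AE_I2)
        fix \<zeta> :: 'c
        have "isCont \<phi> 0" using cont(2) by (simp add: continuous_on_eq_continuous_at)
        moreover have "(\<lambda>n. e n *\<^sub>R \<zeta>) \<longlonglongrightarrow> 0" using tendsto_scaleR[OF e0 tendsto_const[of \<zeta>]] by simp
        ultimately have "(\<lambda>n. \<phi> (e n *\<^sub>R \<zeta>)) \<longlonglongrightarrow> \<phi> 0" by (rule isCont_tendsto_compose)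
        then show "(\<lambda>n. regularized_kernel 1 \<zeta> ^ 3 *\<^sub>R \<phi> (e n *\<^sub>R \<zeta>)) \<longlonglongrightarrow> regularized_kernel 1 \<zeta> ^ 3 *\<^sub>R \<phi> 0"
          by (intro tendsto_intros)
      qed
      show "AE \<zeta> in lborel. norm (regularized_kernel 1 \<zeta> ^ 3 *\<^sub>R \<phi> (e n *\<^sub>R \<zeta>)) \<le> regularized_kernel 1 (\<zeta>::'c) ^ 3 * M" for n
        using M(2) less_imp_le[OF regularized_kernel_pos[of 1 "_ :: 'c"]]
        by (intro AE_I2) (simp add: mult_left_mono abs_of_nonneg)
    qed (use regularized_kernel_cubed_integrable[OF D] in simp_all)
    then have "(\<lambda>n. - 8 *\<^sub>R (\<integral>\<zeta>. regularized_kernel 1 \<zeta> ^ 3 *\<^sub>R \<phi> (e n *\<^sub>R \<zeta>) \<partial>lborel))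
      \<longlonglongrightarrow> - 8 *\<^sub>R (\<integral>\<zeta>. regularized_kernel 1 (\<zeta>::'c) ^ 3 *\<^sub>R \<phi> 0 \<partial>lborel)"
      by (intro tendsto_intros)
    then show ?thesis
      using regularized_kernel_cubed_integrable[OF D]
      by (simp add: integral_regularized_kernel_laplacian[OF D e \<phi>] L_def newton_mass_def)
  qed
  ultimately show ?thesis unfolding L_def by (rule LIMSEQ_unique)
qed

lemma dir_deriv_uminus_vec: "F differentiable (at x) \<Longrightarrow> dir_deriv (- v) F x = - dir_deriv v F x"
  using linear_neg[OF has_derivative_linear[OF has_derivative_dir_deriv]] .

text \<open>For fixed p the previous identity applies to \<phi>(\<zeta>) = G(p - \<iota> \<zeta>);
  the reflection changes the sign of first derivatives, hence not of second ones.\<close>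

lemma newton_potential_laplacian:
  fixes G :: "'a::euclidean_space \<Rightarrow> 'b::euclidean_space" and \<iota> :: "'c::euclidean_space \<Rightarrow> 'a"
  assumes D: "DIM('c) = 4" and \<iota>: "linear \<iota>" "\<And>\<zeta>. norm (\<iota> \<zeta>) = norm \<zeta>"
    and G: "Ck_on 2 UNIV G" "vanishes_outside r G"
  shows "convolution_kernel.conv newton_kernel \<iota> (\<lambda>x. \<Sum>b\<in>Basis. dir_deriv (\<iota> b) (dir_deriv (\<iota> b) G) x) p
    = - newton_mass TYPE('c) *\<^sub>R G p"
proof -
  interpret convolution_kernel newton_kernel \<iota> by (rule convolution_kernel_newton[OF D \<iota>])
  define \<phi> where "\<phi> \<zeta> = G (p + (- \<iota> \<zeta>))" for \<zeta>
  have L: "bounded_linear (\<lambda>\<zeta>. - \<iota> \<zeta>)" using \<iota>(1) by (simp add: linear_conv_bounded_linear bounded_linear_minus)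
  have \<phi>: "Ck_on 2 UNIV \<phi>" unfolding \<phi>_def by (rule Ck_on_affine[OF L _ _ _ G(1)]) auto
  have v: "vanishes_outside (r + norm p) \<phi>"
    unfolding vanishes_outside_def \<phi>_def
  proof (intro allI impI vanishes_outsideD[OF G(2)])
    fix \<zeta> :: 'c assume "r + norm p < norm \<zeta>"
    then show "r < norm (p + - \<iota> \<zeta>)"
      using norm_triangle_ineq2[of "\<iota> \<zeta>" p] by (simp add: \<iota>(2) norm_minus_commute)
  qed
  have dG: "G differentiable (at x)" "dir_deriv u G differentiable (at x)" for x u
    using G(1) by (auto simp: numeral_2_eq_2 intro: differentiable_on_openD)
  have 1: "dir_deriv b \<phi> = (\<lambda>\<zeta>. - dir_deriv (\<iota> b) G (p + (- \<iota> \<zeta>)))" for b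
  proof
    show "dir_deriv b \<phi> \<zeta> = - dir_deriv (\<iota> b) G (p + (- \<iota> \<zeta>))" for \<zeta>
      using dir_deriv_affine[OF L dG(1), of b p \<zeta>] unfolding \<phi>_def dir_deriv_uminus_vec[OF dG(1)] .
  qed
  have 2: "dir_deriv b (dir_deriv b \<phi>) \<zeta> = dir_deriv (\<iota> b) (dir_deriv (\<iota> b) G) (p - \<iota> \<zeta>)" for b \<zeta>
  proof -
    have "(\<lambda>\<zeta>. dir_deriv (\<iota> b) G (p + (- \<iota> \<zeta>))) differentiable (at \<zeta>)"
      using differentiable_chain_at[of "\<lambda>\<zeta>. p + (- \<iota> \<zeta>)" \<zeta> "dir_deriv (\<iota> b) G"] dG(2)
        differentiable_add[OF differentiable_const bounded_linear_imp_differentiable[OF L]] by (simp add: o_def)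
    then show ?thesis
      using dir_deriv_affine[where v = b and c = p and x = \<zeta>, OF L dG(2)]
      unfolding 1 dir_deriv_uminus_vec[OF dG(2)] by (subst dir_deriv_minus) simp_all
  qed
  show ?thesis
    using integral_newton_kernel_laplacian[OF D \<phi> v] unfolding conv_def 2
    by (simp add: \<phi>_def linear_0[OF \<iota>(1)])
qed

subsection \<open>Cutoff functions, maximum principle and unique continuation\<close>

lemma bounded_subset_cball_0:
  fixes S :: "'a::real_normed_vector set"
  shows "bounded S \<Longrightarrow> \<exists>r>0. S \<subseteq> cball 0 r"
  by (auto simp: bounded_pos subset_iff)

lemma ball_subset_ball_dist:
  assumes "dist z a + s \<le> r"
  shows "ball z s \<subseteq> ball a r"
proof
  fix x assume "x \<in> ball z s"
  then show "x \<in> ball a r" using assms dist_triangle3[of a x z] by simp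
qed

lemma has_real_derivative_pos_part_power:
  "((\<lambda>t. max 0 t ^ Suc (Suc n)) has_real_derivative real (Suc (Suc n)) * max 0 t ^ Suc n) (at t)"
proof -
  consider "t > 0" | "t < 0" | "t = 0" by linarith
  then show ?thesis
  proof cases
    case 1
    have "((\<lambda>t. t ^ Suc (Suc n)) has_real_derivative real (Suc (Suc n)) * max 0 t ^ Suc n) (at t)"
      using DERIV_pow[of "Suc (Suc n)" t] 1 by simp
    then show ?thesis
      by (rule has_field_derivative_transform_within_open[where S = "{0<..}"]) (use 1 in auto)
  next
    case 2
    have "((\<lambda>t. 0) has_real_derivative real (Suc (Suc n)) * max 0 t ^ Suc n) (at t)"
      using 2 by (auto intro!: derivative_eq_intros)
    then show ?thesis
      by (rule has_field_derivative_transform_within_open[where S = "{..<0}"]) (use 2 in auto)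
  next
    case 3
    have "((\<lambda>h. max 0 h ^ Suc (Suc n) / h) \<longlongrightarrow> 0) (at (0::real))"
    proof (rule Lim_null_comparison)
      show "\<forall>\<^sub>F h in at 0. norm (max 0 h ^ Suc (Suc n) / h) \<le> \<bar>h\<bar> ^ Suc n"
      proof (intro always_eventually allI)
        fix h :: real
        show "norm (max 0 h ^ Suc (Suc n) / h) \<le> \<bar>h\<bar> ^ Suc n" by (cases "0 < h") (simp_all add: zero_le_power_abs del: power_Suc, simp)
      qed
      show "((\<lambda>h::real. \<bar>h\<bar> ^ Suc n) \<longlongrightarrow> 0) (at 0)"
        by (auto intro!: tendsto_eq_intros)
    qed
    then show ?thesis using 3 by (simp add: has_field_derivative_iff)
  qed
qed

text \<open>The source of the cut-offs: the power m + 1 of a positive part is of class C^m even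
  across the zeros of s.\<close>

lemma Ck_on_pos_part_power:
  fixes s :: "'a::real_normed_vector \<Rightarrow> real"
  assumes U: "open U"
  shows "Ck_on m U s \<Longrightarrow> Ck_on m U (\<lambda>x. max 0 (s x) ^ Suc m)"
proof (induction m)
  case 0 then show ?case by (auto intro!: continuous_intros)
next
  case (Suc m)
  have d: "s differentiable (at x)" if "x \<in> U" for x using Ck_on_differentiable[OF Suc.prems _ U that] by simp
  have der: "((\<lambda>x. max 0 (s x) ^ Suc (Suc m)) has_derivative
      (\<lambda>h. real (Suc (Suc m)) * max 0 (s x) ^ Suc m * dir_deriv h s x)) (at x)" if "x \<in> U" for x
    by (rule has_derivative_compose[OF has_derivative_dir_deriv[OF d[OF that]]
          has_real_derivative_pos_part_power[unfolded has_field_derivative_def]])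
  have "Ck_on m U (dir_deriv v (\<lambda>x. max 0 (s x) ^ Suc (Suc m)))" for v
  proof (subst Ck_on_cong[OF U])
    show "dir_deriv v (\<lambda>x. max 0 (s x) ^ Suc (Suc m)) x
        = real (Suc (Suc m)) * max 0 (s x) ^ Suc m * dir_deriv v s x" if "x \<in> U" for x
      by (rule dir_deriv_eqI[OF der[OF that]])
    show "Ck_on m U (\<lambda>x. real (Suc (Suc m)) * max 0 (s x) ^ Suc m * dir_deriv v s x)"
      by (intro Ck_on_mult U Ck_on_const Suc.IH Ck_on_SucD[OF Suc.prems] Ck_on_dir_deriv[OF Suc.prems])
  qed
  moreover have "(\<lambda>x. max 0 (s x) ^ Suc (Suc m)) differentiable_on U"
    using der by (auto simp: differentiable_on_def differentiable_def intro: has_derivative_at_withinI)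
  ultimately show ?case by simp
qed

lemma Ck_on_sqdist: "Ck_on k UNIV (\<lambda>x::'a::euclidean_space. (x - p) \<bullet> (x - p))"
  by (intro Ck_on_inner Ck_on_diff Ck_on_linear[OF bounded_linear_ident] Ck_on_const open_UNIV)

lemma cutoff_exists:
  fixes K :: "'a::euclidean_space set"
  assumes K: "compact K" and U: "open U" "K \<subseteq> U"
  shows "\<exists>\<psi> V C. Ck_on m UNIV \<psi> \<and> open V \<and> K \<subseteq> V \<and> compact C \<and> V \<subseteq> C \<and> C \<subseteq> U \<and>
    (\<forall>x\<in>V. \<psi> x = (1::real)) \<and> (\<forall>x. x \<notin> C \<longrightarrow> \<psi> x = 0)"
proof -
  have "\<exists>r>0. cball p (2 * r) \<subseteq> U" if p: "p \<in> K" for p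
  proof -
    obtain e where "e > 0" "cball p e \<subseteq> U" using p U by (meson open_contains_cball subsetD)
    then show ?thesis by (intro exI[of _ "e / 2"]) simp
  qed
  then obtain r where r: "\<And>p. p \<in> K \<Longrightarrow> 0 < r p" "\<And>p. p \<in> K \<Longrightarrow> cball p (2 * r p) \<subseteq> U" by metis
  have "K \<subseteq> (\<Union>p\<in>K. ball p (r p))" using r(1) by force
  then obtain T where T: "T \<subseteq> K" "finite T" "K \<subseteq> (\<Union>p\<in>T. ball p (r p))"
    using compactE_image[OF K, of K "\<lambda>p. ball p (r p)"] by auto
  define V where "V = (\<Union>p\<in>T. ball p (r p))"
  define C where "C = (\<Union>p\<in>T. cball p (2 * r p))"
  \<comment> \<open>At least 1 on the ball of radius \<open>r p\<close> about p, and negative beyond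
    twice that radius.\<close>
  define q where "q p x = 2 + (- (1 / (r p)\<^sup>2)) *\<^sub>R ((x - p) \<bullet> (x - p))" for p x :: 'a
  define s where "s x = (\<Sum>p\<in>T. max 0 (q p x) ^ Suc m)" for x
  \<comment> \<open>Clips s at 1 from above without losing smoothness: s \<ge> 1 gives 1, and s = 0
    gives 0.\<close>
  define \<psi> where "\<psi> x = 1 - max 0 (1 - s x) ^ Suc m" for x
  have "Ck_on m UNIV (q p)" for p
    unfolding q_def[abs_def] by (intro Ck_on_add Ck_on_scaleR Ck_on_const Ck_on_sqdist open_UNIV)
  then have "Ck_on m UNIV s"
    unfolding s_def[abs_def] by (intro Ck_on_sum Ck_on_pos_part_power open_UNIV)
  then have "Ck_on m UNIV \<psi>"
    unfolding \<psi>_def[abs_def] by (intro Ck_on_diff Ck_on_pos_part_power Ck_on_const open_UNIV)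
  moreover have "\<psi> x = 1" if x: "x \<in> V" for x
  proof -
    obtain p where p: "p \<in> T" "x \<in> ball p (r p)" using x by (auto simp: V_def)
    have "(x - p) \<bullet> (x - p) < (r p)\<^sup>2"
      using p r(1) T(1) by (auto simp: dist_norm norm_minus_commute power2_norm_eq_inner[symmetric] intro!: power_strict_mono)
    then have "1 \<le> q p x" by (auto simp: q_def divide_simps)
    then have "1 \<le> max 0 (q p x) ^ Suc m" by (intro one_le_power) simp
    also have "\<dots> \<le> s x" unfolding s_def by (rule member_le_sum) (use p T in auto)
    finally show ?thesis by (simp add: \<psi>_def)
  qed
  moreover have "\<psi> x = 0" if x: "x \<notin> C" for x
  proof -
    have "max 0 (q p x) = 0" if p: "p \<in> T" for p
    proof -
      have rp: "r p > 0" using p T r by blast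
      have "2 * r p \<le> norm (x - p)" using x p by (auto simp: C_def dist_norm norm_minus_commute)
      then have "(2 * r p)\<^sup>2 \<le> (x - p) \<bullet> (x - p)"
        unfolding power2_norm_eq_inner[symmetric] by (rule power_mono) (use rp in auto)
      then have "4 \<le> ((x - p) \<bullet> (x - p)) / (r p)\<^sup>2"
        using rp by (simp add: pos_le_divide_eq power_mult_distrib)
      then show ?thesis by (simp add: q_def)
    qed
    then show ?thesis by (simp add: \<psi>_def s_def)
  qed
  moreover have "open V" "K \<subseteq> V" using T(3) by (auto simp: V_def)
  moreover have "compact C" unfolding C_def by (intro compact_UN T(2) compact_cball)
  moreover have "C \<subseteq> U" using T(1) r(2) unfolding C_def by blast
  moreover have "V \<subseteq> C"
  proof -
    have "ball p (r p) \<subseteq> cball p (2 * r p)" if "p \<in> T" for p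
      using r(1)[OF subsetD[OF T(1) that]] by (intro order_trans[OF ball_subset_cball subset_cball]) simp
    then show ?thesis unfolding V_def C_def by (rule UN_mono[OF order_refl])
  qed
  ultimately show ?thesis by blast
qed

text \<open>Adding a multiple of |x|^2 makes the Laplacian strictly positive, which excludes an
  interior maximum.\<close>

lemma maximum_principle:
  fixes u :: "'a::euclidean_space \<Rightarrow> real"
  assumes \<Omega>: "open \<Omega>" "bounded \<Omega>" and cont: "continuous_on (closure \<Omega>) u" and C2: "Ck_on 2 \<Omega> u"
    and harm: "\<And>x. x \<in> \<Omega> \<Longrightarrow> (\<Sum>b\<in>Basis. dir_deriv b (dir_deriv b u) x) = 0"
    and bd: "\<And>x. x \<in> frontier \<Omega> \<Longrightarrow> u x \<le> 0" and x0: "x0 \<in> \<Omega>"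
  shows "u x0 \<le> 0"
proof (rule ccontr)
  assume "\<not> u x0 \<le> 0"
  then have pos: "u x0 > 0" by simp
  have cpt: "compact (closure \<Omega>)" using \<Omega>(2) by (simp add: compact_closure)
  obtain R where R: "R > 0" "\<forall>x\<in>closure \<Omega>. norm x \<le> R"
    using compact_imp_bounded[OF cpt] unfolding bounded_pos by blast
  \<comment> \<open>Then \<delta> |x|^2 is at most half of \<open>u x0\<close> on the closure, so
    that u is still positive at a maximum point of w, which therefore lies in \<Omega>.\<close>
  define \<delta> where "\<delta> = u x0 / (2 * R\<^sup>2)"
  have \<delta>: "\<delta> > 0" "\<delta> * R\<^sup>2 < u x0" using pos R(1) by (auto simp: \<delta>_def)
  define w where "w x = u x + \<delta> * (x \<bullet> x)" for x
  have contw: "continuous_on (closure \<Omega>) w" unfolding w_def by (intro continuous_intros cont)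
  have x0c: "x0 \<in> closure \<Omega>" using x0 closure_subset by blast
  have "\<exists>x1\<in>closure \<Omega>. \<forall>y\<in>closure \<Omega>. w y \<le> w x1"
    by (rule continuous_attains_sup[OF cpt _ contw]) (use x0c in auto)
  then obtain x1 where x1: "x1 \<in> closure \<Omega>" "\<forall>y\<in>closure \<Omega>. w y \<le> w x1" by blast
  have "w x0 \<le> w x1" using x1(2) x0c by blast
  moreover have "u x0 \<le> w x0" using \<delta>(1) by (simp add: w_def)
  ultimately have "u x0 \<le> w x1" by simp
  moreover have "\<delta> * (x1 \<bullet> x1) \<le> \<delta> * R\<^sup>2"
    using bspec[OF R(2) x1(1)] \<delta>(1) by (simp add: power2_norm_eq_inner[symmetric] power_mono)
  ultimately have "u x1 > 0" using \<delta>(2) by (simp add: w_def)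
  then have x1\<Omega>: "x1 \<in> \<Omega>" using bd[of x1] x1(1) \<Omega>(1) by (auto simp: frontier_def interior_open)
  have q: "Ck_on k UNIV (\<lambda>x::'a. \<delta> * (x \<bullet> x))" for k
    by (intro Ck_on_mult Ck_on_inner Ck_on_linear[OF bounded_linear_ident] Ck_on_const open_UNIV)
  have wC2: "Ck_on 2 \<Omega> w"
    unfolding w_def[abs_def] by (intro Ck_on_add \<Omega>(1) C2 Ck_on_subset[OF q subset_UNIV])
  have dq: "(\<lambda>x::'a. \<delta> * (x \<bullet> x)) differentiable (at x)" for x
    by (rule Ck_on_differentiable[OF q[of 1]]) auto
  have du: "u differentiable (at x)" "dir_deriv v u differentiable (at x)"
    "w differentiable (at x)" "dir_deriv v w differentiable (at x)" if "x \<in> \<Omega>" for x v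
    using C2 wC2 \<Omega>(1) that by (auto simp: numeral_2_eq_2 intro: differentiable_on_openD)
  have D1: "dir_deriv v w x = dir_deriv v u x + 2 * \<delta> * (x \<bullet> v)" if "x \<in> \<Omega>" for x v
  proof -
    have "dir_deriv v (\<lambda>x. \<delta> * (x \<bullet> x)) x = 2 * \<delta> * (x \<bullet> v)"
      by (rule dir_deriv_eqI) (auto intro!: derivative_eq_intros simp: inner_commute algebra_simps)
    then show ?thesis unfolding w_def[abs_def] by (simp add: dir_deriv_add[OF du(1)[OF that] dq])
  qed
  have D2: "dir_deriv b (dir_deriv b w) x1 = dir_deriv b (dir_deriv b u) x1 + 2 * \<delta>" if "b \<in> Basis" for b
  proof -
    have "dir_deriv b (dir_deriv b w) x1 = dir_deriv b (\<lambda>x. dir_deriv b u x + 2 * \<delta> * (x \<bullet> b)) x1"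
      by (rule dir_deriv_cong[OF \<Omega>(1) x1\<Omega> D1])
    also have "\<dots> = dir_deriv b (dir_deriv b u) x1 + dir_deriv b (\<lambda>x. 2 * \<delta> * (x \<bullet> b)) x1"
      by (rule dir_deriv_add[OF du(2)[OF x1\<Omega>]])
         (intro bounded_linear_imp_differentiable bounded_linear_const_mult bounded_linear_inner_left)
    also have "dir_deriv b (\<lambda>x. 2 * \<delta> * (x \<bullet> b)) x1 = 2 * \<delta>"
    proof -
      have "((\<lambda>x. 2 * \<delta> * (x \<bullet> b)) has_derivative (\<lambda>h. 2 * \<delta> * (h \<bullet> b))) (at x1)"
        by (intro bounded_linear_imp_has_derivative bounded_linear_const_mult bounded_linear_inner_left)
      from dir_deriv_eqI[OF this, of b] show ?thesis using that by simp
    qed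
    finally show ?thesis .
  qed
  \<comment> \<open>The first derivative vanishes at the interior maximum; a positive second
    derivative would make it positive just beyond x1, and w would exceed its maximum.\<close>
  have "dir_deriv b (dir_deriv b w) x1 \<le> 0" if "b \<in> Basis" for b
  proof (rule ccontr)
    assume "\<not> dir_deriv b (dir_deriv b w) x1 \<le> 0"
    then have pos2: "dir_deriv b (dir_deriv b w) x1 > 0" by simp
    obtain e where e: "e > 0" "ball x1 e \<subseteq> \<Omega>" using \<Omega>(1) x1\<Omega> by (meson open_contains_ball)
    have line: "x1 + t *\<^sub>R b \<in> \<Omega>" if "\<bar>t\<bar> < e" for t
      using e(2) that \<open>b \<in> Basis\<close> by (auto simp: dist_norm)
    have d1: "((\<lambda>t. w (x1 + t *\<^sub>R b)) has_real_derivative dir_deriv b w (x1 + t *\<^sub>R b)) (at t)" if "\<bar>t\<bar> < e" for t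
      using has_real_derivative_along_line[OF du(3)[OF line[OF that]]] .
    have d2: "((\<lambda>t. dir_deriv b w (x1 + t *\<^sub>R b)) has_real_derivative dir_deriv b (dir_deriv b w) x1) (at 0)"
      using has_real_derivative_along_line[of "dir_deriv b w" x1 0 b] du(4)[OF x1\<Omega>] by simp
    have le: "w (x1 + t *\<^sub>R b) \<le> w x1" if "\<bar>t\<bar> < e" for t
      using x1(2) subsetD[OF closure_subset line[OF that]] by blast
    have "dir_deriv b w x1 = 0"
      by (rule DERIV_local_max[of "\<lambda>t. w (x1 + t *\<^sub>R b)" _ 0 e]) (use d1[of 0] e(1) le in auto)
    moreover obtain d where d: "d > 0" "\<And>h. \<lbrakk>0 < h; h < d\<rbrakk> \<Longrightarrow> dir_deriv b w (x1 + 0 *\<^sub>R b) < dir_deriv b w (x1 + (0 + h) *\<^sub>R b)"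
      using DERIV_pos_inc_right[OF d2 pos2] by blast
    ultimately have inc: "dir_deriv b w (x1 + h *\<^sub>R b) > 0" if "0 < h" "h < d" for h using d(2)[OF that] by simp
    define t where "t = min d e / 2"
    have t: "0 < t" "t < d" "t < e" using d(1) e(1) by (auto simp: t_def)
    have "\<exists>z>0. z < t \<and> w (x1 + t *\<^sub>R b) - w (x1 + 0 *\<^sub>R b) = (t - 0) * dir_deriv b w (x1 + z *\<^sub>R b)"
      by (rule MVT2[OF t(1)]) (use d1 t in auto)
    then obtain z where z: "0 < z" "z < t" "w (x1 + t *\<^sub>R b) - w x1 = t * dir_deriv b w (x1 + z *\<^sub>R b)" by auto
    have "0 < t * dir_deriv b w (x1 + z *\<^sub>R b)" using inc[of z] z t by simp
    then show False using z(3) le[of t] t by simp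
  qed
  then have "(\<Sum>b\<in>(Basis :: 'a set). dir_deriv b (dir_deriv b w) x1) \<le> 0" by (simp add: sum_nonpos)
  moreover have "(\<Sum>b\<in>(Basis :: 'a set). dir_deriv b (dir_deriv b w) x1) = 2 * \<delta> * DIM('a)"
    using D2 harm[OF x1\<Omega>] by (simp add: sum.distrib)
  ultimately show False using \<delta>(1) by (simp add: mult_le_0_iff)
qed

section \<open>Unique continuation for separately harmonic functions\<close>

lemma truncated_quadratic_nonzero:
  fixes t :: complex
  assumes "\<bar>\<beta>\<bar> \<le> m" "R \<le> m" "0 < R" "norm t < R / 3"
  shows "of_real (m\<^sup>2) + 2 * t * of_real \<beta> + t\<^sup>2 \<noteq> 0"
proof
  assume eq: "of_real (m\<^sup>2) + 2 * t * of_real \<beta> + t\<^sup>2 = 0"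
  have "m\<^sup>2 = norm (complex_of_real (m\<^sup>2))" by (simp add: norm_power)
  also have "complex_of_real (m\<^sup>2) = - (2 * t * of_real \<beta> + t\<^sup>2)" using eq by (simp only: eq_neg_iff_add_eq_0 add.assoc)
  also have "norm \<dots> \<le> norm (2 * t * of_real \<beta>) + norm (t\<^sup>2)" unfolding norm_minus_cancel by (rule norm_triangle_ineq)
  also have "\<dots> = 2 * norm t * \<bar>\<beta>\<bar> + norm t * norm t" by (simp add: norm_mult norm_power power2_eq_square)
  \<comment> \<open>Since |t| < R/3 \<le> m/3, the last two terms amount to at most 7/9 of
    m^2.\<close>
  also have "\<dots> \<le> 2 * (m / 3) * m + (m / 3) * (m / 3)"
    using assms by (intro add_mono mult_mono) auto
  also have "\<dots> < m\<^sup>2" using assms by (simp add: power2_eq_square)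
  finally show False by simp
qed

text \<open>Along the line through a with direction b the squared distance to \<zeta> is a quadratic
  polynomial in t, whose inverse extends holomorphically to small complex t as long as the sources
  \<zeta> stay away from a. So the potential of such sources is analytic along the line.\<close>

lemma analytic_parameter_integral:
  fixes h :: "'c::euclidean_space \<Rightarrow> real" and a b :: 'c
  assumes h: "continuous_on UNIV h" and h0: "\<And>\<zeta>. norm (a - \<zeta>) < R \<Longrightarrow> h \<zeta> = 0"
    and b: "norm b = 1" and R: "0 < R" and supp: "\<And>\<zeta>. \<zeta> \<notin> cbox c d \<Longrightarrow> h \<zeta> = 0"
  shows "\<exists>F. F holomorphic_on ball 0 (R / 3) \<and>
    (\<forall>t. \<bar>t\<bar> < R / 3 \<longrightarrow>
      F (of_real t) = of_real (\<integral>\<zeta>. newton_kernel (a + t *\<^sub>R b - \<zeta>) * h \<zeta> \<partial>lborel))"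
proof -
  \<comment> \<open>Truncating the distance at R keeps the polynomial free of zeros for every
    \<zeta> and changes it only where h vanishes; so the integrand is jointly continuous over the
    whole box.\<close>
  define m where "m \<zeta> = max (norm (a - \<zeta>)) R" for \<zeta>
  define \<beta> where "\<beta> \<zeta> = b \<bullet> (a - \<zeta>)" for \<zeta>
  define Q where "Q t \<zeta> = complex_of_real ((m \<zeta>)\<^sup>2) + 2 * t * of_real (\<beta> \<zeta>) + t\<^sup>2" for t \<zeta>
  define F where "F t = integral (cbox c d) (\<lambda>\<zeta>. of_real (h \<zeta>) * inverse (Q t \<zeta>))" for t
  have Qnz: "Q t \<zeta> \<noteq> 0" if "t \<in> ball 0 (R / 3)" for t \<zeta>
    unfolding Q_def
  proof (rule truncated_quadratic_nonzero[OF _ _ R])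
    show "\<bar>\<beta> \<zeta>\<bar> \<le> m \<zeta>" using Cauchy_Schwarz_ineq2[of b "a - \<zeta>"] b by (simp add: \<beta>_def m_def)
  qed (use that in \<open>auto simp: m_def\<close>)
  have contQ: "continuous_on X (\<lambda>x. Q (fst x) (snd x))" for X :: "(complex \<times> 'c) set"
    unfolding Q_def m_def \<beta>_def by (intro continuous_intros)
  have inner_expand: "(w + t *\<^sub>R b) \<bullet> (w + t *\<^sub>R b) = w \<bullet> w + 2 * t * (b \<bullet> w) + t * t * (b \<bullet> b)" for w t
    by (simp add: inner_add_left inner_add_right inner_commute[of w b] distrib_left)
  have conth: "continuous_on X (\<lambda>x. h (snd x))" for X :: "(complex \<times> 'c) set"
    by (rule continuous_on_compose2[OF h]) (auto intro!: continuous_intros)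
  have "F holomorphic_on ball 0 (R / 3)"
    unfolding F_def[abs_def]
  proof (rule leibniz_rule_holomorphic[where fx = "\<lambda>t \<zeta>. of_real (h \<zeta>) * - ((2 * of_real (\<beta> \<zeta>) + 2 * t) * (inverse (Q t \<zeta>) * inverse (Q t \<zeta>)))"])
    fix t :: complex and \<zeta> assume t: "t \<in> ball 0 (R / 3)"
    have "((\<lambda>t. Q t \<zeta>) has_field_derivative 2 * of_real (\<beta> \<zeta>) + 2 * t) (at t within ball 0 (R / 3))"
      unfolding Q_def by (auto intro!: derivative_eq_intros)
    from DERIV_inverse'[OF this Qnz[OF t]]
    show "((\<lambda>t. of_real (h \<zeta>) * inverse (Q t \<zeta>)) has_field_derivative
       of_real (h \<zeta>) * - ((2 * of_real (\<beta> \<zeta>) + 2 * t) * (inverse (Q t \<zeta>) * inverse (Q t \<zeta>)))) (at t within ball 0 (R / 3))"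
      by (intro DERIV_cmult) (simp add: mult_ac)
  next
    fix t :: complex assume t: "t \<in> ball 0 (R / 3)"
    have "continuous_on (cbox c d) (\<lambda>\<zeta>. Q t \<zeta>)"
      using continuous_on_compose2[OF contQ[of UNIV], of "cbox c d" "\<lambda>\<zeta>. (t, \<zeta>)"] by (simp add: continuous_on_Pair)
    then show "(\<lambda>\<zeta>. of_real (h \<zeta>) * inverse (Q t \<zeta>)) integrable_on cbox c d"
      using Qnz[OF t] by (intro integrable_continuous continuous_intros continuous_on_subset[OF h]) auto
  next
    show "continuous_on (ball 0 (R / 3) \<times> cbox c d)
      (\<lambda>(t, \<zeta>). of_real (h \<zeta>) * - ((2 * of_real (\<beta> \<zeta>) + 2 * t) * (inverse (Q t \<zeta>) * inverse (Q t \<zeta>))))"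
      unfolding case_prod_beta \<beta>_def
      by (intro continuous_intros conth contQ) (use Qnz in auto)
  qed simp
  moreover have "F (of_real t) = of_real (\<integral>\<zeta>. newton_kernel (a + t *\<^sub>R b - \<zeta>) * h \<zeta> \<partial>lborel)" if t: "\<bar>t\<bar> < R / 3" for t
  proof -
    have eq: "of_real (h \<zeta>) * inverse (Q (of_real t) \<zeta>) = complex_of_real (newton_kernel (a + t *\<^sub>R b - \<zeta>) * h \<zeta>)" for \<zeta>
    proof (cases "norm (a - \<zeta>) < R")
      case False
      have "(a + t *\<^sub>R b - \<zeta>) \<bullet> (a + t *\<^sub>R b - \<zeta>) = (a - \<zeta> + t *\<^sub>R b) \<bullet> (a - \<zeta> + t *\<^sub>R b)" by (simp add: algebra_simps)
      also have "\<dots> = (a - \<zeta>) \<bullet> (a - \<zeta>) + 2 * t * (b \<bullet> (a - \<zeta>)) + t * t * (b \<bullet> b)"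
        by (rule inner_expand)
      also have "b \<bullet> b = 1" using b by (simp add: norm_eq_1)
      finally have "Q (of_real t) \<zeta> = of_real ((a + t *\<^sub>R b - \<zeta>) \<bullet> (a + t *\<^sub>R b - \<zeta>))"
        using False by (simp add: Q_def m_def \<beta>_def flip: power2_norm_eq_inner) (simp add: power2_eq_square)
      then show ?thesis by (simp add: newton_kernel_def mult.commute)
    qed (simp add: h0)
    have nz: "Q (of_real t) \<zeta> \<noteq> 0" for \<zeta> using Qnz[of "of_real t"] t by simp
    have "continuous_on UNIV (\<lambda>\<zeta>. Q (of_real t) \<zeta>)"
      using continuous_on_compose2[OF contQ[of UNIV], of UNIV "\<lambda>\<zeta>. (of_real t, \<zeta>)"] by (simp add: continuous_on_Pair)
    then have "continuous_on UNIV (\<lambda>\<zeta>. Re (of_real (h \<zeta>) * inverse (Q (of_real t) \<zeta>)))"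
      using nz by (intro continuous_intros h) auto
    then have c: "continuous_on UNIV (\<lambda>\<zeta>. newton_kernel (a + t *\<^sub>R b - \<zeta>) * h \<zeta>)" (is "continuous_on UNIV ?g")
      unfolding eq by simp
    obtain r where r: "cbox c d \<subseteq> cball 0 r" using bounded_subset_cball_0[OF bounded_cbox] by blast
    have "?g \<zeta> = 0" if "r < norm \<zeta>" for \<zeta>
    proof -
      have "\<zeta> \<notin> cbox c d" using r that by auto
      then show ?thesis by (simp add: supp)
    qed
    then have "vanishes_outside r ?g" by (simp add: vanishes_outside_def)
    then have "integrable lborel ?g" by (rule integrable_compact_support[OF c])
    then have "(?g has_integral (\<integral>\<zeta>. ?g \<zeta> \<partial>lborel)) UNIV" by (rule has_integral_integral_lborel)
    then have "(?g has_integral (\<integral>\<zeta>. ?g \<zeta> \<partial>lborel)) (cbox c d)"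
    proof -
      have "(\<lambda>\<zeta>. if \<zeta> \<in> cbox c d then ?g \<zeta> else 0) = ?g" using supp by (auto simp: fun_eq_iff)
      then show "(?g has_integral (\<integral>\<zeta>. ?g \<zeta> \<partial>lborel)) (cbox c d)"
        using \<open>(?g has_integral _) UNIV\<close> has_integral_restrict_UNIV[of "cbox c d" ?g] by simp
    qed
    then have "((\<lambda>\<zeta>. complex_of_real (?g \<zeta>)) has_integral of_real (\<integral>\<zeta>. ?g \<zeta> \<partial>lborel)) (cbox c d)"
      by (rule has_integral_of_real)
    then show ?thesis unfolding F_def eq by (rule integral_unique)
  qed
  ultimately show ?thesis by blast
qed

text \<open>After a cut-off, u is up to a constant the Newton potential of a source supported off
  the ball of radius R/2, hence analytic along each ray from a up to length (R/2)/3 = R/6. Vanishing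
  near a propagates along the ray by the identity theorem.\<close>

lemma harmonic_vanishing_spreads:
  fixes u :: "'c::euclidean_space \<Rightarrow> real"
  assumes D: "DIM('c) = 4" and C2: "Ck_on 2 (ball a R) u"
    and harm: "\<And>x. x \<in> ball a R \<Longrightarrow> (\<Sum>b\<in>Basis. dir_deriv b (dir_deriv b u) x) = 0"
    and "0 < \<epsilon>" and z: "\<And>x. x \<in> ball a \<epsilon> \<Longrightarrow> u x = 0" and x: "x \<in> ball a (R / 6)"
  shows "u x = 0"
proof (cases "x = a")
  case True then show ?thesis using z \<open>0 < \<epsilon>\<close> by simp
next
  case False
  have R: "0 < R" using x dist_not_less_zero[of a x] by (cases "0 < R") auto
  obtain \<psi> V C where \<psi>: "Ck_on 2 UNIV \<psi>" "\<forall>x\<in>V. \<psi> x = (1::real)" "\<forall>x. x \<notin> C \<longrightarrow> \<psi> x = 0"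
    and VC: "open V" "cball a (R / 2) \<subseteq> V" "compact C" "V \<subseteq> C" "C \<subseteq> ball a R"
  proof -
    have "cball a (R / 2) \<subseteq> ball a R" using R by (simp add: cball_subset_ball_iff)
    from cutoff_exists[OF compact_cball open_ball this, of 2] show thesis using that by blast
  qed
  define v where "v x = \<psi> x * u x" for x
  have v0: "v x = 0" if "x \<in> - C" for x using \<psi>(3) that by (simp add: v_def)
  have vu: "v x = u x" if "x \<in> V" for x using \<psi>(2) that by (simp add: v_def)
  have oC: "open (- C)" using VC(3) by (simp add: compact_imp_closed open_Compl)
  have vC2: "Ck_on 2 UNIV v"
  proof -
    have "Ck_on 2 (ball a R) v"
      unfolding v_def[abs_def] by (intro Ck_on_mult open_ball C2 Ck_on_subset[OF \<psi>(1)] subset_UNIV)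
    moreover have "Ck_on 2 (- C) v" by (subst Ck_on_cong[OF oC v0]) auto
    moreover have "ball a R \<union> - C = UNIV" using VC(5) by auto
    ultimately show ?thesis using Ck_on_Un[OF open_ball oC] by metis
  qed
  obtain r where r: "C \<subseteq> cball 0 r"
    using bounded_subset_cball_0[OF compact_imp_bounded[OF VC(3)]] by blast
  have vsupp: "vanishes_outside r v" using r v0 by (force simp: vanishes_outside_def)
  define h where "h = (\<lambda>x. \<Sum>b\<in>Basis. dir_deriv b (dir_deriv b v) x)"
  have "continuous_on UNIV (dir_deriv b (dir_deriv b v))" for b using vC2 by (simp add: numeral_2_eq_2)
  then have conth: "continuous_on UNIV h" unfolding h_def by (intro continuous_intros)
  have [measurable]: "h \<in> borel_measurable borel" using conth by (rule borel_measurable_continuous_onI)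
  have cong2: "dir_deriv b (dir_deriv b v) x = dir_deriv b (dir_deriv b w) x"
    if "open X" "x \<in> X" "\<And>y. y \<in> X \<Longrightarrow> v y = w y" for b x X w
    by (rule dir_deriv_cong[OF that(1,2)]) (rule dir_deriv_cong[OF that(1) _ that(3)])
  have hV: "h x = 0" if "x \<in> V" for x
    using harm[of x] cong2[OF VC(1) that vu] that VC by (auto simp: h_def)
  have hC: "h x = 0" if "x \<in> - C" for x
    using cong2[OF oC that, of "\<lambda>_. 0"] v0 by (auto simp: h_def)
  have hsupp: "vanishes_outside r h" using r hC by (force simp: vanishes_outside_def)
  have rep: "(\<integral>\<zeta>. newton_kernel (x - \<zeta>) * h \<zeta> \<partial>lborel) = - newton_mass TYPE('c) * v x" for x
  proof -
    have "(\<integral>\<zeta>. newton_kernel \<zeta> * h (x - \<zeta>) \<partial>lborel) = - newton_mass TYPE('c) * v x"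
      using newton_potential_laplacian[OF D linear_ident refl vC2 vsupp, of x]
        convolution_kernel.conv_def[OF convolution_kernel_newton[OF D linear_ident refl], of h x]
      by (simp add: h_def)
    moreover have "(\<integral>\<zeta>. newton_kernel \<zeta> * h (x - \<zeta>) \<partial>lborel) = (\<integral>\<zeta>. newton_kernel (x - \<zeta>) * h \<zeta> \<partial>lborel)"
      using lborel_integral_reflect[of "\<lambda>\<zeta>. newton_kernel (x - \<zeta>) * h \<zeta>" x] by simp
    ultimately show ?thesis by simp
  qed
  define b where "b = (x - a) /\<^sub>R norm (x - a)"
  have b: "norm b = 1" using False by (simp add: b_def)
  define \<tau> where "\<tau> = norm (x - a)"
  have \<tau>: "0 < \<tau>" "\<tau> < R / 6" "x = a + \<tau> *\<^sub>R b" using False x by (auto simp: \<tau>_def b_def dist_norm norm_minus_commute)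
  obtain c d where cd: "C \<subseteq> cbox c d" by (meson VC(3) bounded_subset_cbox_symmetric compact_imp_bounded)
  have "\<exists>F. F holomorphic_on ball 0 ((R / 2) / 3) \<and>
    (\<forall>t. \<bar>t\<bar> < (R / 2) / 3 \<longrightarrow>
      F (of_real t) = of_real (\<integral>\<zeta>. newton_kernel (a + t *\<^sub>R b - \<zeta>) * h \<zeta> \<partial>lborel))"
  proof (rule analytic_parameter_integral[OF conth _ b])
    show "h \<zeta> = 0" if "norm (a - \<zeta>) < R / 2" for \<zeta>
      using that VC(2) by (intro hV) (auto simp: dist_norm)
    show "h \<zeta> = 0" if "\<zeta> \<notin> cbox c d" for \<zeta> using cd that by (intro hC) auto
  qed (use R in simp)
  then obtain F where F: "F holomorphic_on ball 0 (R / 6)"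
    "\<And>t. \<bar>t\<bar> < R / 6 \<Longrightarrow> F (of_real t) = of_real (- newton_mass TYPE('c) * v (a + t *\<^sub>R b))"
    unfolding rep by auto
  define \<delta> where "\<delta> = min \<epsilon> (R / 6)"
  have \<delta>: "0 < \<delta>" "\<delta> \<le> \<epsilon>" "\<delta> \<le> R / 6" using \<open>0 < \<epsilon>\<close> R by (auto simp: \<delta>_def)
  have seg: "a + t *\<^sub>R b \<in> V" if "\<bar>t\<bar> < R / 6" for t
    using that VC(2) R b by (intro subsetD[OF VC(2)]) (simp add: dist_norm)
  have "F (of_real \<tau>) = 0"
  proof (rule analytic_continuation[OF F(1) open_ball connected_ball, where U = "of_real ` {- \<delta><..<\<delta>}" and \<xi> = 0])
    show "of_real ` {- \<delta><..<\<delta>} \<subseteq> ball (0::complex) (R / 6)" using \<delta> by (auto simp: dist_norm)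
    show "0 \<in> ball (0::complex) (R / 6)" using R by simp
    show "complex_of_real \<tau> \<in> ball 0 (R / 6)" using \<tau> by simp
    show "F w = 0" if w: "w \<in> of_real ` {- \<delta><..<\<delta>}" for w
    proof -
      obtain t where t: "w = of_real t" "\<bar>t\<bar> < \<delta>" using w by (auto simp: abs_if)
      have "u (a + t *\<^sub>R b) = 0" using t \<delta> b by (intro z) (simp add: dist_norm)
      then show ?thesis using F(2)[of t] t \<delta> vu[OF seg[of t]] by simp
    qed
    show "(0::complex) islimpt of_real ` {- \<delta><..<\<delta>}"
      unfolding islimpt_approachable
    proof (intro allI impI)
      fix e :: real assume e: "0 < e"
      have "complex_of_real (min e \<delta> / 2) \<in> of_real ` {- \<delta><..<\<delta>}" using e \<delta> by (intro imageI) auto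
      moreover have "complex_of_real (min e \<delta> / 2) \<noteq> 0 \<and> dist (complex_of_real (min e \<delta> / 2)) 0 < e"
        using e \<delta> unfolding dist_norm diff_zero norm_of_real by auto
      ultimately show "\<exists>x'\<in>of_real ` {- \<delta><..<\<delta>}. x' \<noteq> (0::complex) \<and> dist x' 0 < e" by blast
    qed
  qed
  then have "v x = 0" using F(2)[of \<tau>] \<tau> newton_mass_pos[OF D] by simp
  then show ?thesis using vu[OF seg[of \<tau>]] \<tau> by simp
qed

lemma slice_laplacian:
  fixes u :: "'a::euclidean_space \<Rightarrow> real" and \<iota> :: "'c::euclidean_space \<Rightarrow> 'a"
  assumes \<iota>: "bounded_linear \<iota>" and U: "open U" "Ck_on 2 U u" and V: "open V" "\<And>x. x \<in> V \<Longrightarrow> q + \<iota> x \<in> U" and x: "x \<in> V"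
  shows "dir_deriv b (dir_deriv b (\<lambda>x. u (q + \<iota> x))) x = dir_deriv (\<iota> b) (dir_deriv (\<iota> b) u) (q + \<iota> x)"
proof -
  have d: "u differentiable (at y)" "dir_deriv v u differentiable (at y)" if "y \<in> U" for y v
    using U that by (auto simp: numeral_2_eq_2 intro: differentiable_on_openD)
  have "dir_deriv b (dir_deriv b (\<lambda>x. u (q + \<iota> x))) x = dir_deriv b (\<lambda>x. dir_deriv (\<iota> b) u (q + \<iota> x)) x"
    by (rule dir_deriv_cong[OF V(1) x]) (rule dir_deriv_affine[OF \<iota> d(1)[OF V(2)]])
  also have "\<dots> = dir_deriv (\<iota> b) (dir_deriv (\<iota> b) u) (q + \<iota> x)"
    by (rule dir_deriv_affine[OF \<iota> d(2)[OF V(2)[OF x]]])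
  finally show ?thesis .
qed

text \<open>Here biharmonic means harmonic in each of the two variables. The zeros first spread in
  x, with y in the small ball, and then in y for each fixed x.\<close>

lemma biharmonic_vanishing_spreads:
  fixes u :: "'c::euclidean_space \<times> 'd::euclidean_space \<Rightarrow> real"
  assumes D: "DIM('c) = 4" "DIM('d) = 4" and U: "open U" "Ck_on 2 U u"
    and harm1: "\<And>p. p \<in> U \<Longrightarrow> (\<Sum>b\<in>Basis. dir_deriv (b, 0) (dir_deriv (b, 0) u) p) = 0"
    and harm2: "\<And>p. p \<in> U \<Longrightarrow> (\<Sum>b\<in>Basis. dir_deriv (0, b) (dir_deriv (0, b) u) p) = 0"
    and box: "ball a R \<times> ball c R \<subseteq> U" and "0 < \<epsilon>" "\<epsilon> \<le> R"
    and z: "\<And>x y. x \<in> ball a \<epsilon> \<Longrightarrow> y \<in> ball c \<epsilon> \<Longrightarrow> u (x, y) = 0"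
    and xy: "x \<in> ball a (R / 6)" "y \<in> ball c (R / 6)"
  shows "u (x, y) = 0"
proof -
  have l1: "bounded_linear (\<lambda>x::'c. (x, 0::'d))" and l2: "bounded_linear (\<lambda>y::'d. (0::'c, y))"
    by (intro bounded_linear_Pair bounded_linear_ident bounded_linear_zero)+
  have 1: "u (x, y) = 0" if x: "x \<in> ball a (R / 6)" and y: "y \<in> ball c \<epsilon>" for x y
  proof -
    have in_U: "(0, y) + (x', 0) \<in> U" if "x' \<in> ball a R" for x'
      using that y box \<open>\<epsilon> \<le> R\<close> by auto
    have "u ((0, y) + (x, 0)) = 0"
    proof (rule harmonic_vanishing_spreads[where u = "\<lambda>x. u ((0, y) + (x, 0))", OF D(1) _ _ \<open>0 < \<epsilon>\<close> _ x])
      show "Ck_on 2 (ball a R) (\<lambda>x. u ((0, y) + (x, 0)))" by (rule Ck_on_affine[OF l1 U(1) open_ball in_U U(2)])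
      show "(\<Sum>b\<in>Basis. dir_deriv b (dir_deriv b (\<lambda>x. u ((0, y) + (x, 0)))) x') = 0" if "x' \<in> ball a R" for x'
        by (rule trans[OF sum.cong[OF refl slice_laplacian[OF l1 U open_ball in_U that]] harm1[OF in_U[OF that]]])
    qed (use z y in simp)
    then show ?thesis by simp
  qed
  have in_U: "(x, 0) + (0, y') \<in> U" if "y' \<in> ball c R" for y'
    using that xy(1) box \<open>0 < \<epsilon>\<close> \<open>\<epsilon> \<le> R\<close> by auto
  have "u ((x, 0) + (0, y)) = 0"
  proof (rule harmonic_vanishing_spreads[where u = "\<lambda>y. u ((x, 0) + (0, y))", OF D(2) _ _ \<open>0 < \<epsilon>\<close> _ xy(2)])
    show "Ck_on 2 (ball c R) (\<lambda>y. u ((x, 0) + (0, y)))" by (rule Ck_on_affine[OF l2 U(1) open_ball in_U U(2)])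
    show "(\<Sum>b\<in>Basis. dir_deriv b (dir_deriv b (\<lambda>y. u ((x, 0) + (0, y)))) y') = 0" if "y' \<in> ball c R" for y'
      by (rule trans[OF sum.cong[OF refl slice_laplacian[OF l2 U open_ball in_U that]] harm2[OF in_U[OF that]]])
  qed (use 1 xy(1) in simp)
  then show ?thesis by simp
qed

text \<open>The interior Z of the zero set is relatively closed in U, because zeros near a limit
  point p spread over a ball whose size depends on p only; connectedness does the rest.\<close>

lemma biharmonic_unique_continuation:
  fixes u :: "'c::euclidean_space \<times> 'd::euclidean_space \<Rightarrow> real"
  assumes D: "DIM('c) = 4" "DIM('d) = 4" and U: "open U" "Ck_on 2 U u" and conn: "connected U"
    and harm1: "\<And>p. p \<in> U \<Longrightarrow> (\<Sum>b\<in>Basis. dir_deriv (b, 0) (dir_deriv (b, 0) u) p) = 0"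
    and harm2: "\<And>p. p \<in> U \<Longrightarrow> (\<Sum>b\<in>Basis. dir_deriv (0, b) (dir_deriv (0, b) u) p) = 0"
    and W: "open W" "W \<noteq> {}" "W \<subseteq> U" "\<And>p. p \<in> W \<Longrightarrow> u p = 0" and p: "p \<in> U"
  shows "u p = 0"
proof -
  define Z where "Z = interior {p \<in> U. u p = 0}"
  have WZ: "W \<subseteq> Z" unfolding Z_def using W by (intro interior_maximal) auto
  have ZU: "Z \<subseteq> U" unfolding Z_def using interior_subset by blast
  have "p \<in> Z" if p: "p \<in> U" "p \<in> closure Z" for p
  proof -
    obtain a c where ac: "p = (a, c)" by (cases p)
    obtain A B where AB: "open A" "open B" "p \<in> A \<times> B" "A \<times> B \<subseteq> U" using open_prod_elim[OF U(1) p(1)] by blast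
    obtain r1 r2 where r12: "0 < r1" "ball a r1 \<subseteq> A" "0 < r2" "ball c r2 \<subseteq> B"
      using AB ac by (metis mem_Sigma_iff open_contains_ball)
    define R where "R = min r1 r2"
    have "ball a R \<subseteq> A" "ball c R \<subseteq> B"
      using r12 by (auto simp: R_def)
    then have R: "0 < R" "ball a R \<times> ball c R \<subseteq> U" using AB(4) r12 by (auto simp: R_def)
    \<comment> \<open>With z this close to p, the box of radius R/2 around z stays in U, and the
      zeros spread to radius R/12 > R/20, far enough to cover p.\<close>
    obtain z where z: "z \<in> Z" "dist z p < R / 20"
      using p(2) R(1) unfolding closure_approachable by (metis divide_pos_pos zero_less_numeral)
    obtain z1 z2 where z12: "z = (z1, z2)" by (cases z)
    have dz: "dist z1 a < R / 20" "dist z2 c < R / 20"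
      using z(2) dist_fst_le[of z p] dist_snd_le[of z p] unfolding ac z12 by auto
    have "open Z" by (simp add: Z_def)
    then obtain A' B' where AB': "open A'" "open B'" "z \<in> A' \<times> B'" "A' \<times> B' \<subseteq> Z" using z(1) open_prod_elim by blast
    obtain s1 s2 where s: "0 < s1" "ball z1 s1 \<subseteq> A'" "0 < s2" "ball z2 s2 \<subseteq> B'"
      using AB' z12 by (metis mem_Sigma_iff open_contains_ball)
    define \<epsilon> where "\<epsilon> = min (min s1 s2) (R / 2)"
    have \<epsilon>: "0 < \<epsilon>" "\<epsilon> \<le> R / 2" using s R by (auto simp: \<epsilon>_def)
    have zero: "u (x, y) = 0" if "x \<in> ball z1 \<epsilon>" "y \<in> ball z2 \<epsilon>" for x y
    proof -
      have "x \<in> A'" "y \<in> B'" using that s(2,4) by (auto simp: \<epsilon>_def)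
      then have "(x, y) \<in> Z" using AB'(4) by blast
      then show ?thesis unfolding Z_def using interior_subset by blast
    qed
    have sub: "ball z1 (R / 2) \<subseteq> ball a R" "ball z2 (R / 2) \<subseteq> ball c R"
      using dz R(1) by (auto intro!: ball_subset_ball_dist)
    have box: "ball z1 (R / 2) \<times> ball z2 (R / 2) \<subseteq> U" using sub R(2) by blast
    let ?B = "ball z1 (R / 2 / 6) \<times> ball z2 (R / 2 / 6)"
    have "u q = 0" if "q \<in> ?B" for q
      using that biharmonic_vanishing_spreads[OF D U harm1 harm2 box \<epsilon> zero] by (cases q) auto
    moreover have "?B \<subseteq> U"
    proof -
      have "ball z1 (R / 2 / 6) \<subseteq> ball z1 (R / 2)" "ball z2 (R / 2 / 6) \<subseteq> ball z2 (R / 2)"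
        using R(1) by (auto intro: subset_ball)
      then show ?thesis using box by blast
    qed
    ultimately have "?B \<subseteq> Z" unfolding Z_def by (intro interior_maximal open_Times open_ball) auto
    moreover have "p \<in> ?B" using dz R(1) by (auto simp: ac)
    ultimately show ?thesis by blast
  qed
  then have "Z = U \<inter> closure Z" using ZU closure_subset[of Z] by blast
  then have "closedin (top_of_set U) Z" unfolding closedin_closed by (intro exI[of _ "closure Z"]) simp
  moreover have "openin (top_of_set U) Z" using ZU by (simp add: Z_def openin_open_eq[OF U(1)])
  ultimately have "Z = U" using conn WZ W(2) unfolding connected_clopen by blast
  then show ?thesis using p unfolding Z_def using interior_subset by blast
qed

subsection \<open>Jets along a hypersurface\<close>

text \<open>Order k means that the derivatives of order less than k vanish, so
  \<open>flat_on 1\<close> is plain vanishing on S. The derivatives are ambient ones, hence the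
  values of F off S matter.\<close>

primrec flat_on :: "nat \<Rightarrow> 'a::real_normed_vector set \<Rightarrow> ('a \<Rightarrow> 'b::real_normed_vector) \<Rightarrow> bool" where
  "flat_on 0 S F \<longleftrightarrow> True"
| "flat_on (Suc k) S F \<longleftrightarrow> (\<forall>p\<in>S. F p = 0) \<and> (\<forall>v. flat_on k S (dir_deriv v F))"

lemma flat_on_dir_deriv: "flat_on k S F \<Longrightarrow> flat_on (k - 1) S (dir_deriv v F)"
  by (cases k) auto

lemma flat_on_zeroD: "flat_on k S F \<Longrightarrow> 0 < k \<Longrightarrow> p \<in> S \<Longrightarrow> F p = 0"
  by (cases k) auto

lemma flat_on_cong:
  assumes "open U" "S \<subseteq> U" "\<And>y. y \<in> U \<Longrightarrow> F y = G y"
  shows "flat_on k S F \<longleftrightarrow> flat_on k S G"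
  using assms(3)
proof (induction k arbitrary: F G)
  case (Suc k)
  have "flat_on k S (dir_deriv v F) \<longleftrightarrow> flat_on k S (dir_deriv v G)" for v
    by (rule Suc.IH) (rule dir_deriv_cong[OF assms(1) _ Suc.prems])
  moreover have "F p = G p" if "p \<in> S" for p using assms(2) Suc.prems that by blast
  ultimately show ?case by simp
qed simp

context
  fixes S U :: "'a::euclidean_space set"
  assumes U: "open U" and SU: "S \<subseteq> U"
begin

lemma flat_on_compose_linear:
  assumes L: "bounded_linear L"
  shows "Cinf_on U F \<Longrightarrow> flat_on k S F \<Longrightarrow> flat_on k S (\<lambda>x. L (F x))"
proof (induction k arbitrary: F)
  case (Suc k)
  have "flat_on k S (dir_deriv v (\<lambda>x. L (F x)))" for v
    using Suc.IH[OF Cinf_on_dir_deriv[OF Suc.prems(1)], of v] Suc.prems(2)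
    by (subst flat_on_cong[OF U SU dir_deriv_compose_linear[OF L Cinf_on_differentiable[OF Suc.prems(1) U]]]) auto
  then show ?case using Suc.prems(2) L by (simp add: linear_0[OF bounded_linear.linear])
qed simp

lemma flat_on_add:
  "Cinf_on U F \<Longrightarrow> Cinf_on U G \<Longrightarrow> flat_on k S F \<Longrightarrow> flat_on k S G \<Longrightarrow> flat_on k S (\<lambda>x. F x + G x)"
proof (induction k arbitrary: F G)
  case (Suc k)
  have "flat_on k S (dir_deriv v (\<lambda>x. F x + G x))" for v
    using Suc.IH[OF Cinf_on_dir_deriv[OF Suc.prems(1)] Cinf_on_dir_deriv[OF Suc.prems(2)], of v v] Suc.prems(3,4)
    by (subst flat_on_cong[OF U SU dir_deriv_add[OF Cinf_on_differentiable[OF Suc.prems(1) U]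
          Cinf_on_differentiable[OF Suc.prems(2) U]]]) auto
  then show ?case using Suc.prems(3,4) by simp
qed simp

lemma flat_on_minus: "Cinf_on U F \<Longrightarrow> flat_on k S F \<Longrightarrow> flat_on k S (\<lambda>x. - F x)"
  using flat_on_compose_linear[OF bounded_linear_minus[OF bounded_linear_ident]] .

lemma flat_on_diff:
  "Cinf_on U F \<Longrightarrow> Cinf_on U G \<Longrightarrow> flat_on k S F \<Longrightarrow> flat_on k S G \<Longrightarrow> flat_on k S (\<lambda>x. F x - G x)"
  using flat_on_add[of F "\<lambda>x. - G x"] flat_on_minus[of G] Cinf_on_minus[OF U, of G] by simp

lemma flat_on_const_zero: "flat_on k S (\<lambda>x. 0)"
  by (induction k) auto

lemma flat_on_sum:
  "(\<And>i. i \<in> I \<Longrightarrow> Cinf_on U (F i)) \<Longrightarrow> (\<And>i. i \<in> I \<Longrightarrow> flat_on k S (F i)) \<Longrightarrow> flat_on k S (\<lambda>x. \<Sum>i\<in>I. F i x)"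
  by (induction I rule: infinite_finite_induct) (auto intro!: flat_on_add Cinf_on_sum U flat_on_const_zero)

text \<open>Orders of vanishing add under products. The inequality absorbs the truncated
  \<open>j - 1\<close> in the Leibniz step: if j = 0, the order k of the other factor alone exceeds
  n, and symmetrically.\<close>

lemma flat_on_bilinear:
  assumes B: "bounded_bilinear B"
  shows "Cinf_on U F \<Longrightarrow> Cinf_on U G \<Longrightarrow> flat_on j S F \<Longrightarrow> flat_on k S G \<Longrightarrow> n \<le> j + k
    \<Longrightarrow> flat_on n S (\<lambda>x. B (F x) (G x))"
proof (induction n arbitrary: j k F G)
  case (Suc n)
  interpret bounded_bilinear B by (rule B)
  have "flat_on n S (dir_deriv v (\<lambda>x. B (F x) (G x)))" for v
  proof (subst flat_on_cong[OF U SU dir_deriv[OF Cinf_on_differentiable[OF Suc.prems(1) U]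
          Cinf_on_differentiable[OF Suc.prems(2) U]]], assumption+)
    show "flat_on n S (\<lambda>x. B (dir_deriv v F x) (G x) + B (F x) (dir_deriv v G x))"
    proof (rule flat_on_add)
      show "flat_on n S (\<lambda>x. B (dir_deriv v F x) (G x))"
        by (rule Suc.IH[OF _ _ flat_on_dir_deriv[OF Suc.prems(3)] Suc.prems(4)])
           (use Suc.prems in \<open>auto intro: Cinf_on_dir_deriv\<close>)
      show "flat_on n S (\<lambda>x. B (F x) (dir_deriv v G x))"
        by (rule Suc.IH[OF _ _ Suc.prems(3) flat_on_dir_deriv[OF Suc.prems(4)]])
           (use Suc.prems in \<open>auto intro: Cinf_on_dir_deriv\<close>)
    qed (auto intro!: Cinf_on U Suc.prems Cinf_on_dir_deriv)
  qed
  moreover have "B (F p) (G p) = 0" if "p \<in> S" for p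
  proof (cases "0 < j")
    case True then show ?thesis using flat_on_zeroD[OF Suc.prems(3) _ that] by (simp add: zero_left)
  next
    case False then show ?thesis using flat_on_zeroD[OF Suc.prems(4) _ that] Suc.prems(5) by (simp add: zero_right)
  qed
  ultimately show ?case by simp
qed simp

lemmas flat_on_scaleR = flat_on_bilinear[OF bounded_bilinear_scaleR]

lemma flat_on_power:
  fixes r :: "'a \<Rightarrow> real"
  assumes "Cinf_on U r" "\<And>p. p \<in> S \<Longrightarrow> r p = 0"
  shows "flat_on k S (\<lambda>x. r x ^ k)"
proof (induction k)
  case (Suc k)
  show ?case unfolding power_Suc
    by (rule flat_on_bilinear[where j = 1, OF bounded_bilinear_mult assms(1) Cinf_on_power[OF U assms(1)] _ Suc.IH])
       (use assms(2) in auto)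
qed simp

end

section \<open>Hypersurfaces as level sets and their normal derivative\<close>

definition grad_sq :: "('a::euclidean_space \<Rightarrow> real) \<Rightarrow> 'a \<Rightarrow> real" where
  "grad_sq \<rho> x = (\<Sum>b\<in>Basis. dir_deriv b \<rho> x * dir_deriv b \<rho> x)"

text \<open>Normalised so that it maps \<open>\<rho>\<close> to \<open>1\<close>.\<close>

definition normal_deriv :: "('a::euclidean_space \<Rightarrow> real) \<Rightarrow> ('a \<Rightarrow> 'b::real_normed_vector) \<Rightarrow> 'a \<Rightarrow> 'b" where
  "normal_deriv \<rho> h x = (\<Sum>b\<in>Basis. (dir_deriv b \<rho> x * inverse (grad_sq \<rho> x)) *\<^sub>R dir_deriv b h x)"

text \<open>The gradient is nonzero on all of U, not merely on S, so that the operator N has smooth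
  coefficients on U and can be iterated.\<close>

locale level_set =
  fixes S U :: "'a::euclidean_space set" and \<rho> :: "'a \<Rightarrow> real"
  assumes open_U: "open U" and S_eq: "S = {x \<in> U. \<rho> x = 0}" and smooth_\<rho>: "Cinf_on U \<rho>"
    and grad_nonzero: "\<And>x. x \<in> U \<Longrightarrow> grad_sq \<rho> x \<noteq> 0"
begin

abbreviation "N \<equiv> normal_deriv \<rho>"

lemma S_subset: "S \<subseteq> U" using S_eq by blast

lemma \<rho>_zero: "p \<in> S \<Longrightarrow> \<rho> p = 0" using S_eq by blast

lemma \<rho>_diff: "x \<in> U \<Longrightarrow> \<rho> differentiable (at x)"
  using Cinf_on_differentiable[OF smooth_\<rho> open_U] .

lemmas U_intros = open_U smooth_\<rho> Cinf_on_dir_deriv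

lemma Cinf_coeff: "Cinf_on U (\<lambda>x. dir_deriv b \<rho> x * inverse (grad_sq \<rho> x))"
  unfolding grad_sq_def
  by (intro Cinf_on_mult Cinf_on_inverse Cinf_on_sum open_U Cinf_on_dir_deriv smooth_\<rho>)
     (use grad_nonzero in \<open>simp add: grad_sq_def\<close>)

lemma Cinf_normal_deriv: "Cinf_on U h \<Longrightarrow> Cinf_on U (N h)"
  unfolding normal_deriv_def[abs_def]
  by (intro Cinf_on_sum Cinf_on_scaleR Cinf_coeff open_U Cinf_on_dir_deriv)

lemma Cinf_normal_deriv_funpow: "Cinf_on U h \<Longrightarrow> Cinf_on U ((N ^^ k) h)"
  by (induction k) (auto intro: Cinf_normal_deriv)

definition normal :: "'a \<Rightarrow> 'a" where
  "normal p = (\<Sum>b\<in>Basis. (dir_deriv b \<rho> p * inverse (grad_sq \<rho> p)) *\<^sub>R b)"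

lemma normal_deriv_eq:
  assumes "linear L"
  shows "L (normal p) = (\<Sum>b\<in>Basis. (dir_deriv b \<rho> p * inverse (grad_sq \<rho> p)) *\<^sub>R L b)"
  unfolding normal_def by (simp add: linear_sum[OF assms] linear_cmul[OF assms])

lemma dir_deriv_normal:
  assumes "h differentiable (at p)"
  shows "dir_deriv (normal p) h p = N h p"
  using normal_deriv_eq[OF has_derivative_linear[OF has_derivative_dir_deriv[OF assms]]]
  by (simp add: normal_deriv_def)

lemma normal_deriv_\<rho>: "p \<in> U \<Longrightarrow> N \<rho> p = 1"
proof -
  assume "p \<in> U"
  have "N \<rho> p = (\<Sum>b\<in>Basis. dir_deriv b \<rho> p * dir_deriv b \<rho> p) * inverse (grad_sq \<rho> p)"
    unfolding normal_deriv_def sum_distrib_right by (intro sum.cong refl) simp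
  then show ?thesis using grad_nonzero[OF \<open>p \<in> U\<close>] by (simp flip: grad_sq_def)
qed

text \<open>Replaces the implicit function theorem: for a tangent vector w, the intermediate value
  theorem in the normal direction yields points of S that leave p along w up to an error of size
  \<epsilon> t.\<close>

lemma curve_in_level_set:
  assumes p: "p \<in> S" and w: "dir_deriv w \<rho> p = 0" and \<epsilon>: "0 < \<epsilon>" "\<epsilon> \<le> 1" and d: "0 < d"
  shows "\<exists>t s. 0 < t \<and> \<bar>s\<bar> \<le> \<epsilon> * t \<and> t * (norm w + norm (normal p)) < d \<and> p + t *\<^sub>R w + s *\<^sub>R normal p \<in> S"
proof -
  have pU: "p \<in> U" using p S_subset by blast
  let ?e = "normal p" and ?D = "\<lambda>v. dir_deriv v \<rho> p"
  define M where "M = norm w + norm ?e + 1"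
  have M: "M > 0" by (simp add: M_def add_nonneg_pos)
  have der: "(\<rho> has_derivative ?D) (at p)" by (rule has_derivative_dir_deriv[OF \<rho>_diff[OF pU]])
  have lin: "linear ?D" using has_derivative_linear[OF der] .
  \<comment> \<open>On displacements of length at most t M this error bound gives \<epsilon> t / 2,
    half of the range allowed for s; so \<rho> changes sign on that range.\<close>
  have "0 < \<epsilon> / (2 * M)" using \<epsilon> M by simp
  then obtain d1 where d1: "d1 > 0" "\<And>y. norm (y - p) < d1 \<Longrightarrow> norm (\<rho> y - \<rho> p - ?D (y - p)) \<le> \<epsilon> / (2 * M) * norm (y - p)"
    using der unfolding has_derivative_at_alt by blast
  obtain d2 where d2: "d2 > 0" "ball p d2 \<subseteq> U" using open_U pU by (meson open_contains_ball)
  define t where "t = min d (min d1 d2) / (2 * M)"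
  have t: "t > 0" using d d1 d2 M by (simp add: t_def)
  have "0 < min d (min d1 d2)" using d d1(1) d2(1) by simp
  moreover have "t * M = min d (min d1 d2) / 2" using M by (simp add: t_def)
  ultimately have tM: "t * M < min d (min d1 d2)" by linarith
  have close: "norm (t *\<^sub>R w + s *\<^sub>R ?e) \<le> t * M" if "\<bar>s\<bar> \<le> \<epsilon> * t" for s
  proof -
    have "\<bar>s\<bar> \<le> t" using that \<epsilon> t mult_left_le_one_le[of t \<epsilon>] by linarith
    then have "norm (t *\<^sub>R w + s *\<^sub>R ?e) \<le> t * norm w + t * norm ?e"
      using t by (intro norm_triangle_le add_mono) (auto intro!: mult_right_mono)
    also have "\<dots> \<le> t * M" using t by (simp add: M_def algebra_simps)
    finally show ?thesis .
  qed
  have est: "\<bar>\<rho> (p + t *\<^sub>R w + s *\<^sub>R ?e) - s\<bar> \<le> \<epsilon> * t / 2" if s: "\<bar>s\<bar> \<le> \<epsilon> * t" for s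
  proof -
    have "?D (t *\<^sub>R w + s *\<^sub>R ?e) = s"
      using w normal_deriv_\<rho>[OF pU] dir_deriv_normal[OF \<rho>_diff[OF pU]]
      by (simp add: linear_add[OF lin] linear_cmul[OF lin])
    then have "\<bar>\<rho> (p + t *\<^sub>R w + s *\<^sub>R ?e) - s\<bar> \<le> \<epsilon> / (2 * M) * norm (t *\<^sub>R w + s *\<^sub>R ?e)"
      using d1(2)[of "p + t *\<^sub>R w + s *\<^sub>R ?e"] close[OF s] tM \<rho>_zero[OF p] by (simp add: algebra_simps)
    also have "\<dots> \<le> \<epsilon> / (2 * M) * (t * M)" using close[OF s] \<epsilon> M by (intro mult_left_mono) auto
    also have "\<dots> = \<epsilon> * t / 2" using M by simp
    finally show ?thesis .
  qed
  have in_U: "p + t *\<^sub>R w + s *\<^sub>R ?e \<in> U" if "\<bar>s\<bar> \<le> \<epsilon> * t" for s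
    using d2(2) close[OF that] tM by (intro subsetD[OF d2(2)]) (simp add: dist_norm algebra_simps flip: norm_minus_cancel[of "t *\<^sub>R w + s *\<^sub>R ?e"])
  have et: "0 < \<epsilon> * t" using \<epsilon> t by simp
  have "\<exists>s. - (\<epsilon> * t) \<le> s \<and> s \<le> \<epsilon> * t \<and> \<rho> (p + t *\<^sub>R w + s *\<^sub>R ?e) = 0"
  proof (rule IVT')
    show "\<rho> (p + t *\<^sub>R w + (- (\<epsilon> * t)) *\<^sub>R ?e) \<le> 0" 
    proof -
      have "\<bar>- (\<epsilon> * t)\<bar> \<le> \<epsilon> * t" using et by simp
      from abs_le_D1[OF est[OF this]] show ?thesis using et by linarith
    qed
    show "0 \<le> \<rho> (p + t *\<^sub>R w + (\<epsilon> * t) *\<^sub>R ?e)" 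
    proof -
      have "\<bar>\<epsilon> * t\<bar> \<le> \<epsilon> * t" using et by simp
      from abs_le_D2[OF est[OF this]] show ?thesis using et by linarith
    qed
    have "continuous_on U \<rho>" using smooth_\<rho> Ck_on_imp_continuous_on by (auto simp: Cinf_on_def)
    then show "continuous_on {- (\<epsilon> * t)..\<epsilon> * t} (\<lambda>s. \<rho> (p + t *\<^sub>R w + s *\<^sub>R ?e))"
      by (rule continuous_on_compose2) (auto intro!: continuous_intros in_U)
  qed (use et in simp)
  then obtain s where s': "- (\<epsilon> * t) \<le> s" "s \<le> \<epsilon> * t" and s: "\<rho> (p + t *\<^sub>R w + s *\<^sub>R ?e) = 0" by blast
  have st: "\<bar>s\<bar> \<le> \<epsilon> * t" using s' by (intro abs_leI) linarith+
  have "p + t *\<^sub>R w + s *\<^sub>R ?e \<in> S" using in_U[OF st] s S_eq by blast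
  moreover have "t * (norm w + norm ?e) < d" using tM t by (simp add: M_def algebra_simps)
  ultimately show ?thesis using t st by blast
qed

text \<open>Makes derivatives within S unique on tangent vectors. At the points of
  \<open>curve_in_level_set\<close> the value of L on the displacement is o(t), and the displacement
  differs from t w by a small multiple of t times the normal.\<close>

lemma derivative_within_level_set_tangent:
  fixes K :: "'a \<Rightarrow> 'b::real_normed_vector"
  assumes p: "p \<in> S" and w: "dir_deriv w \<rho> p = 0"
    and L: "(K has_derivative L) (at p within S)" and K: "\<And>x. x \<in> S \<Longrightarrow> K x = 0"
  shows "L w = 0"
proof (rule ccontr)
  assume "L w \<noteq> 0"
  then have pos: "norm (L w) > 0" by simp
  let ?e = "normal p"
  have lin: "linear L" using has_derivative_linear[OF L] .
  \<comment> \<open>The factors 3 leave one third of \<open>norm (L w)\<close> for the error in the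
    normal direction and one third for the remainder, together less than the whole.\<close>
  define \<epsilon> where "\<epsilon> = min 1 (norm (L w) / (3 * (norm (L ?e) + 1)))"
  define \<eta> where "\<eta> = norm (L w) / (3 * (norm w + norm ?e + 1))"
  have e1: "0 < norm (L ?e) + 1" "0 < norm w + norm ?e + 1" by (simp_all add: add_nonneg_pos)
  have \<epsilon>: "0 < \<epsilon>" "\<epsilon> \<le> 1" "\<epsilon> * norm (L ?e) \<le> norm (L w) / 3"
  proof -
    show "0 < \<epsilon>" "\<epsilon> \<le> 1" using pos e1 by (simp_all add: \<epsilon>_def)
    then have "\<epsilon> * norm (L ?e) \<le> \<epsilon> * (norm (L ?e) + 1)" by simp
    also have "\<dots> \<le> norm (L w) / (3 * (norm (L ?e) + 1)) * (norm (L ?e) + 1)"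
      using e1 by (intro mult_right_mono) (auto simp: \<epsilon>_def)
    also have "\<dots> = norm (L w) / 3" using e1(1) by (simp add: divide_simps)
    finally show "\<epsilon> * norm (L ?e) \<le> norm (L w) / 3" .
  qed
  have \<eta>: "0 < \<eta>" "\<eta> * (norm w + norm ?e) \<le> norm (L w) / 3"
  proof -
    show "0 < \<eta>" using pos e1 by (simp add: \<eta>_def)
    then have "\<eta> * (norm w + norm ?e) \<le> \<eta> * (norm w + norm ?e + 1)" by simp
    also have "\<dots> = norm (L w) / 3" using e1(2) by (simp add: \<eta>_def divide_simps)
    finally show "\<eta> * (norm w + norm ?e) \<le> norm (L w) / 3" .
  qed
  obtain d where d: "d > 0" "\<And>y. y \<in> S \<Longrightarrow> norm (y - p) < d \<Longrightarrow> norm (K y - K p - L (y - p)) \<le> \<eta> * norm (y - p)"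
    using L \<eta>(1) unfolding has_derivative_within_alt by blast
  obtain t s where ts: "0 < t" "\<bar>s\<bar> \<le> \<epsilon> * t" "t * (norm w + norm ?e) < d" "p + t *\<^sub>R w + s *\<^sub>R ?e \<in> S"
    using curve_in_level_set[OF p w \<epsilon>(1,2) d(1)] by blast
  let ?h = "t *\<^sub>R w + s *\<^sub>R ?e"
  have st: "\<bar>s\<bar> \<le> t" using ts(1,2) \<epsilon> mult_left_le_one_le[of t \<epsilon>] by linarith
  have h: "norm ?h \<le> t * (norm w + norm ?e)"
    using st ts(1) unfolding distrib_left by (intro norm_triangle_le add_mono) (auto intro!: mult_right_mono)
  have "norm (L ?h) \<le> \<eta> * norm ?h"
    using d(2)[OF ts(4)] h ts(3) K[OF ts(4)] K[OF p] by (simp add: add.assoc)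
  also have "\<dots> \<le> t * (norm (L w) / 3)"
  proof -
    have "\<eta> * norm ?h \<le> \<eta> * (t * (norm w + norm ?e))" using h \<eta>(1) by (intro mult_left_mono) auto
    also have "\<dots> = t * (\<eta> * (norm w + norm ?e))" by (rule mult.left_commute)
    also have "\<dots> \<le> t * (norm (L w) / 3)" using \<eta>(2) ts(1) by (intro mult_left_mono) auto
    finally show ?thesis .
  qed
  finally have 1: "norm (L ?h) \<le> t * (norm (L w) / 3)" .
  have "t *\<^sub>R L w = L ?h - s *\<^sub>R L ?e" by (simp add: linear_add[OF lin] linear_cmul[OF lin])
  then have "t * norm (L w) = norm (L ?h - s *\<^sub>R L ?e)" using ts(1) by (metis abs_of_pos norm_scaleR)
  also have "\<dots> \<le> norm (L ?h) + \<bar>s\<bar> * norm (L ?e)" using norm_triangle_ineq4[of "L ?h" "s *\<^sub>R L ?e"] by simp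
  also have "\<bar>s\<bar> * norm (L ?e) \<le> \<epsilon> * t * norm (L ?e)" using ts(2) by (rule mult_right_mono) simp
  also have "\<epsilon> * t * norm (L ?e) \<le> t * (norm (L w) / 3)"
    using mult_left_mono[OF \<epsilon>(3), of t] ts(1) by (simp add: mult_ac)
  finally have "t * norm (L w) \<le> t * (norm (L w) / 3) + t * (norm (L w) / 3)" using 1 by linarith
  then show False using ts(1) pos by simp
qed

text \<open>A function that is zero on S has no derivative along S, so only the normal component of
  v counts; N is normalised by N \<rho> = 1.\<close>

lemma dir_deriv_on_level_set:
  fixes h :: "'a \<Rightarrow> 'b::real_normed_vector"
  assumes h: "h differentiable (at p)" "\<And>x. x \<in> S \<Longrightarrow> h x = 0" and p: "p \<in> S"
  shows "dir_deriv v h p = dir_deriv v \<rho> p *\<^sub>R N h p"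
proof -
  have pU: "p \<in> U" using p S_subset by blast
  let ?w = "v - dir_deriv v \<rho> p *\<^sub>R normal p"
  note lin\<rho> = has_derivative_linear[OF has_derivative_dir_deriv[OF \<rho>_diff[OF pU]]]
  note linh = has_derivative_linear[OF has_derivative_dir_deriv[OF h(1)]]
  have "dir_deriv ?w \<rho> p = 0"
    using dir_deriv_normal[OF \<rho>_diff[OF pU]] normal_deriv_\<rho>[OF pU]
    by (simp add: linear_diff[OF lin\<rho>] linear_cmul[OF lin\<rho>])
  then have "dir_deriv ?w h p = 0"
    by (rule derivative_within_level_set_tangent[OF p _ has_derivative_at_withinI[OF has_derivative_dir_deriv[OF h(1)]] h(2)])
  then show ?thesis
    using dir_deriv_normal[OF h(1)] by (simp add: linear_diff[OF linh] linear_cmul[OF linh])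
qed

lemma flat_on_normal_deriv:
  fixes h :: "'a \<Rightarrow> 'b::real_normed_vector"
  assumes "Cinf_on U h" "flat_on k S h"
  shows "flat_on (k - 1) S (N h)"
  unfolding normal_deriv_def[abs_def]
proof (rule flat_on_sum[OF open_U S_subset])
  fix b :: 'a
  show "Cinf_on U (\<lambda>x. (dir_deriv b \<rho> x * inverse (grad_sq \<rho> x)) *\<^sub>R dir_deriv b h x)"
    by (intro Cinf_on_scaleR Cinf_coeff open_U Cinf_on_dir_deriv assms(1))
  show "flat_on (k - 1) S (\<lambda>x. (dir_deriv b \<rho> x * inverse (grad_sq \<rho> x)) *\<^sub>R dir_deriv b h x)"
    by (rule flat_on_scaleR[where j = 0 and k = "k - 1", OF open_U S_subset Cinf_coeff Cinf_on_dir_deriv[OF assms(1)]])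
       (use flat_on_dir_deriv[OF assms(2)] in auto)
qed

lemma flat_on_normal_deriv_funpow:
  fixes h :: "'a \<Rightarrow> 'b::real_normed_vector"
  assumes "Cinf_on U h" "flat_on k S h"
  shows "flat_on (k - j) S ((N ^^ j) h)"
proof (induction j)
  case (Suc j)
  then show ?case using flat_on_normal_deriv[OF Cinf_normal_deriv_funpow[OF assms(1)] Suc.IH] by simp
qed (use assms in simp)

text \<open>A derivative costs one order, and subtracting its normal part restores it. In the
  induction, the derivative along w of the tangential expression is the same expression for the
  derivative of h, up to terms that are flat enough by themselves.\<close>

lemma flat_on_tangential:
  fixes h :: "'a \<Rightarrow> 'b::euclidean_space"
  shows "Cinf_on U h \<Longrightarrow> flat_on (Suc k) S h \<Longrightarrow>
    flat_on (Suc k) S (\<lambda>x. dir_deriv v h x - dir_deriv v \<rho> x *\<^sub>R N h x)"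
proof (induction k arbitrary: h)
  case 0
  then show ?case
    using dir_deriv_on_level_set[OF Cinf_on_differentiable[OF 0(1) open_U]] S_subset by auto
next
  case (Suc k)
  note h = Suc.prems(1) and F = open_U S_subset
  let ?T = "\<lambda>h x. dir_deriv v h x - dir_deriv v \<rho> x *\<^sub>R N h x"
  let ?c = "\<lambda>b x. dir_deriv b \<rho> x * inverse (grad_sq \<rho> x)"
  have dd: "G differentiable (at x)" if "Cinf_on U G" "x \<in> U" for G :: "'a \<Rightarrow> 'b" and x
    using Cinf_on_differentiable[OF that(1) open_U that(2)] .
  have flatT: "flat_on (Suc k) S (dir_deriv w (?T h))" for w
  proof -
    have hw: "Cinf_on U (dir_deriv w h)" "flat_on (Suc k) S (dir_deriv w h)"
      using Suc.prems by (auto intro: Cinf_on_dir_deriv)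
    \<comment> \<open>The commutator of differentiation along w with N; it contains only first
      derivatives of h.\<close>
    define E where "E = (\<lambda>x. \<Sum>b\<in>Basis. dir_deriv w (?c b) x *\<^sub>R dir_deriv b h x)"
    have EC: "Cinf_on U E"
      unfolding E_def by (intro Cinf_on_sum Cinf_on_scaleR Cinf_coeff open_U Cinf_on_dir_deriv h)
    have EF: "flat_on (Suc k) S E"
      unfolding E_def
    proof (rule flat_on_sum[OF F])
      fix b :: 'a
      show "Cinf_on U (\<lambda>x. dir_deriv w (?c b) x *\<^sub>R dir_deriv b h x)"
        by (intro Cinf_on_scaleR Cinf_coeff open_U Cinf_on_dir_deriv h)
      show "flat_on (Suc k) S (\<lambda>x. dir_deriv w (?c b) x *\<^sub>R dir_deriv b h x)"
        by (rule flat_on_scaleR[where j = 0 and k = "Suc k", OF F Cinf_on_dir_deriv[OF Cinf_coeff] Cinf_on_dir_deriv[OF h]])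
           (use Suc.prems(2) in auto)
    qed
    have comm: "dir_deriv w (dir_deriv u h) x = dir_deriv u (dir_deriv w h) x" if "x \<in> U" for u x
      using dir_deriv_commute[OF open_U _ that, of h w u] h by (simp add: Cinf_on_def)
    have DN: "dir_deriv w (N h) x = E x + N (dir_deriv w h) x" if x: "x \<in> U" for x
    proof -
      have "dir_deriv w (N h) x = (\<Sum>b\<in>Basis. dir_deriv w (\<lambda>x. ?c b x *\<^sub>R dir_deriv b h x) x)"
        unfolding normal_deriv_def[abs_def]
        by (rule dir_deriv_sum) (rule dd[OF Cinf_on_scaleR[OF open_U Cinf_coeff Cinf_on_dir_deriv[OF h]] x])
      also have "\<dots> = (\<Sum>b\<in>Basis. dir_deriv w (?c b) x *\<^sub>R dir_deriv b h x + ?c b x *\<^sub>R dir_deriv w (dir_deriv b h) x)"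
        by (intro sum.cong refl dir_deriv_scaleR dd[OF Cinf_on_dir_deriv[OF h] x]
              Cinf_on_differentiable[OF Cinf_coeff open_U x])
      also have "\<dots> = E x + N (dir_deriv w h) x"
        by (simp add: E_def normal_deriv_def sum.distrib comm[OF x])
      finally show ?thesis .
    qed
    have DT: "dir_deriv w (?T h) x
        = ?T (dir_deriv w h) x - dir_deriv w (dir_deriv v \<rho>) x *\<^sub>R N h x - dir_deriv v \<rho> x *\<^sub>R E x" if x: "x \<in> U" for x
    proof -
      have "dir_deriv w (?T h) x = dir_deriv w (dir_deriv v h) x - dir_deriv w (\<lambda>x. dir_deriv v \<rho> x *\<^sub>R N h x) x"
        by (intro dir_deriv_diff dd[OF _ x] Cinf_on_scaleR U_intros Cinf_normal_deriv h)
      also have "dir_deriv w (\<lambda>x. dir_deriv v \<rho> x *\<^sub>R N h x) x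
          = dir_deriv w (dir_deriv v \<rho>) x *\<^sub>R N h x + dir_deriv v \<rho> x *\<^sub>R dir_deriv w (N h) x"
        by (intro dir_deriv_scaleR dd[OF Cinf_normal_deriv[OF h] x] Cinf_on_differentiable[OF _ open_U x] U_intros)
      finally show ?thesis by (simp add: DN[OF x] comm[OF x] algebra_simps)
    qed
    show ?thesis
    proof (subst flat_on_cong[OF F DT], assumption)
      show "flat_on (Suc k) S (\<lambda>x. ?T (dir_deriv w h) x - dir_deriv w (dir_deriv v \<rho>) x *\<^sub>R N h x - dir_deriv v \<rho> x *\<^sub>R E x)"
      proof (rule flat_on_diff[OF F _ _ flat_on_diff[OF F]])
        show "flat_on (Suc k) S (?T (dir_deriv w h))" by (rule Suc.IH[OF hw])
        show "flat_on (Suc k) S (\<lambda>x. dir_deriv w (dir_deriv v \<rho>) x *\<^sub>R N h x)"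
          by (rule flat_on_scaleR[where j = 0 and k = "Suc k", OF F _ Cinf_normal_deriv[OF h]])
             (use flat_on_normal_deriv[OF h Suc.prems(2)] in \<open>auto intro: U_intros\<close>)
        show "flat_on (Suc k) S (\<lambda>x. dir_deriv v \<rho> x *\<^sub>R E x)"
          by (rule flat_on_scaleR[where j = 0 and k = "Suc k", OF F _ EC]) (use EF in \<open>auto intro: U_intros\<close>)
      qed (intro Cinf_on_diff Cinf_on_scaleR U_intros Cinf_normal_deriv h EC)+
    qed
  qed
  have "?T h p = 0" if "p \<in> S" for p
    using dir_deriv_on_level_set[OF dd[OF h] _ that] S_subset that Suc.prems(2) by auto
  with flatT show ?case by (subst flat_on.simps(2)) blast
qed

section \<open>Leading terms in powers of the defining function\<close>

lemma dir_deriv_power_fact: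
  assumes "x \<in> U"
  shows "dir_deriv v (\<lambda>x. \<rho> x ^ Suc k / fact (Suc k)) x = \<rho> x ^ k / fact k * dir_deriv v \<rho> x"
proof -
  have "((\<lambda>x. \<rho> x ^ Suc k) has_derivative (\<lambda>h. of_nat (Suc k) * dir_deriv h \<rho> x * \<rho> x ^ (Suc k - 1))) (at x)"
    using has_derivative_power[OF has_derivative_dir_deriv[OF \<rho>_diff[OF assms]], of "Suc k"] .
  then have "((\<lambda>x. \<rho> x ^ Suc k / fact (Suc k)) has_derivative
      (\<lambda>h. of_nat (Suc k) * dir_deriv h \<rho> x * \<rho> x ^ (Suc k - 1) / fact (Suc k))) (at x)"
    unfolding divide_inverse by (rule has_derivative_mult_left)
  from dir_deriv_eqI[OF this, of v] show ?thesis by (simp add: fact_Suc[of k] del: of_nat_Suc power_Suc)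
qed

lemma Cinf_on_power_fact: "Cinf_on U (\<lambda>x. \<rho> x ^ k / fact k)"
  unfolding divide_inverse by (intro Cinf_on_mult Cinf_on_power Cinf_on_const open_U smooth_\<rho>)

lemma flat_on_power_fact: "flat_on k S (\<lambda>x. \<rho> x ^ k / fact k)"
  unfolding divide_inverse
  by (rule flat_on_bilinear[where j = k and k = 0, OF open_U S_subset bounded_bilinear_mult])
     (auto intro: Cinf_on_power open_U smooth_\<rho> \<rho>_zero flat_on_power[OF open_U S_subset])

text \<open>The leading Taylor term in the normal direction. The derivative of the remainder
  consists of the tangential part of dh, the same remainder for N h with k lowered by one, and a
  term that still carries the full power of \<rho>.\<close>

lemma flat_on_taylor:
  fixes h :: "'a \<Rightarrow> 'b::euclidean_space"
  shows "Cinf_on U h \<Longrightarrow> flat_on k S h \<Longrightarrow> flat_on (Suc k) S (\<lambda>x. h x - (\<rho> x ^ k / fact k) *\<^sub>R (N ^^ k) h x)"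
proof (induction k arbitrary: h)
  case (Suc k)
  note h = Suc.prems(1) and F = open_U S_subset
  define M where "M = (N ^^ Suc k) h"
  have MN: "M = (N ^^ k) (N h)" by (simp add: M_def funpow_swap1)
  have MC: "Cinf_on U M" unfolding M_def by (rule Cinf_normal_deriv_funpow[OF h])
  note NC = Cinf_normal_deriv[OF h]
  have NF: "flat_on k S (N h)" using flat_on_normal_deriv[OF h Suc.prems(2)] by simp
  let ?r = "\<lambda>k x. \<rho> x ^ k / fact k"
  have "flat_on (Suc k) S (dir_deriv v (\<lambda>x. h x - ?r (Suc k) x *\<^sub>R M x))" for v
  proof (subst flat_on_cong[OF F])
    fix x assume x: "x \<in> U"
    have "dir_deriv v (\<lambda>x. h x - ?r (Suc k) x *\<^sub>R M x) x = dir_deriv v h x - dir_deriv v (\<lambda>x. ?r (Suc k) x *\<^sub>R M x) x"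
      by (intro dir_deriv_diff Cinf_on_differentiable[OF _ open_U x] h Cinf_on_scaleR open_U Cinf_on_power_fact MC)
    also have "dir_deriv v (\<lambda>x. ?r (Suc k) x *\<^sub>R M x) x = (?r k x * dir_deriv v \<rho> x) *\<^sub>R M x + ?r (Suc k) x *\<^sub>R dir_deriv v M x"
      unfolding dir_deriv_power_fact[OF x, symmetric]
      by (intro dir_deriv_scaleR Cinf_on_differentiable[OF _ open_U x] Cinf_on_power_fact MC)
    finally show "dir_deriv v (\<lambda>x. h x - ?r (Suc k) x *\<^sub>R M x) x
      = (dir_deriv v h x - dir_deriv v \<rho> x *\<^sub>R N h x) + dir_deriv v \<rho> x *\<^sub>R (N h x - ?r k x *\<^sub>R M x)
        - ?r (Suc k) x *\<^sub>R dir_deriv v M x"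
      by (simp add: algebra_simps)
  next
    have C2: "Cinf_on U (\<lambda>x. N h x - ?r k x *\<^sub>R M x)"
      by (intro Cinf_on_diff Cinf_on_scaleR Cinf_on_power_fact open_U NC MC)
    show "flat_on (Suc k) S (\<lambda>x. (dir_deriv v h x - dir_deriv v \<rho> x *\<^sub>R N h x) + dir_deriv v \<rho> x *\<^sub>R (N h x - ?r k x *\<^sub>R M x)
        - ?r (Suc k) x *\<^sub>R dir_deriv v M x)"
    proof (rule flat_on_diff[OF F _ _ flat_on_add[OF F]])
      show "flat_on (Suc k) S (\<lambda>x. dir_deriv v h x - dir_deriv v \<rho> x *\<^sub>R N h x)"
        by (rule flat_on_tangential[OF h Suc.prems(2)])
      show "flat_on (Suc k) S (\<lambda>x. dir_deriv v \<rho> x *\<^sub>R (N h x - ?r k x *\<^sub>R M x))"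
        by (rule flat_on_scaleR[where j = 0 and k = "Suc k", OF F _ C2]) (use Suc.IH[OF NC NF] in \<open>auto simp: MN intro: U_intros\<close>)
      show "flat_on (Suc k) S (\<lambda>x. ?r (Suc k) x *\<^sub>R dir_deriv v M x)"
        by (rule flat_on_scaleR[where j = "Suc k" and k = 0, OF F Cinf_on_power_fact Cinf_on_dir_deriv[OF MC] flat_on_power_fact]) auto
    qed (intro Cinf_on_diff Cinf_on_add Cinf_on_scaleR U_intros Cinf_on_power_fact h NC MC)+
  qed
  moreover have "h p - ?r (Suc k) p *\<^sub>R M p = 0" if "p \<in> S" for p
    using that Suc.prems(2) \<rho>_zero[OF that] by simp
  ultimately show ?case unfolding M_def[symmetric] by (subst flat_on.simps(2)) blast
qed simp

text \<open>The second derivatives themselves are flat only to order k; their leading part is the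
  symbol d\<rho>(w) d\<rho>(v) times N (N h).\<close>

lemma flat_on_second_symbol:
  fixes h :: "'a \<Rightarrow> 'b::euclidean_space"
  assumes h: "Cinf_on U h" and flat: "flat_on (Suc (Suc k)) S h"
  shows "flat_on (Suc k) S (\<lambda>x. dir_deriv w (dir_deriv v h) x - (dir_deriv w \<rho> x * dir_deriv v \<rho> x) *\<^sub>R N (N h) x)"
proof -
  note F = open_U S_subset
  note NC = Cinf_normal_deriv[OF h] and NNC = Cinf_normal_deriv[OF Cinf_normal_deriv[OF h]]
  have NF: "flat_on (Suc k) S (N h)" using flat_on_normal_deriv[OF h flat] by simp
  let ?T = "\<lambda>x. dir_deriv v h x - dir_deriv v \<rho> x *\<^sub>R N h x"
  let ?T' = "\<lambda>x. dir_deriv w (N h) x - dir_deriv w \<rho> x *\<^sub>R N (N h) x"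
  have TC: "Cinf_on U ?T" by (intro Cinf_on_diff Cinf_on_scaleR U_intros h NC)
  have TC': "Cinf_on U ?T'" by (intro Cinf_on_diff Cinf_on_scaleR U_intros NC NNC)
  have "dir_deriv w (dir_deriv v h) x - (dir_deriv w \<rho> x * dir_deriv v \<rho> x) *\<^sub>R N (N h) x
     = dir_deriv w ?T x + dir_deriv w (dir_deriv v \<rho>) x *\<^sub>R N h x + dir_deriv v \<rho> x *\<^sub>R ?T' x" if x: "x \<in> U" for x
  proof -
    have "dir_deriv w ?T x = dir_deriv w (dir_deriv v h) x - dir_deriv w (\<lambda>x. dir_deriv v \<rho> x *\<^sub>R N h x) x"
      by (intro dir_deriv_diff Cinf_on_differentiable[OF _ open_U x] Cinf_on_scaleR U_intros h NC)
    also have "dir_deriv w (\<lambda>x. dir_deriv v \<rho> x *\<^sub>R N h x) x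
        = dir_deriv w (dir_deriv v \<rho>) x *\<^sub>R N h x + dir_deriv v \<rho> x *\<^sub>R dir_deriv w (N h) x"
      by (intro dir_deriv_scaleR Cinf_on_differentiable[OF _ open_U x] U_intros NC)
    finally show ?thesis by (simp add: algebra_simps)
  qed
  from flat_on_cong[OF F this] show ?thesis
  proof (rule iffD2)
    show "flat_on (Suc k) S (\<lambda>x. dir_deriv w ?T x + dir_deriv w (dir_deriv v \<rho>) x *\<^sub>R N h x + dir_deriv v \<rho> x *\<^sub>R ?T' x)"
    proof (intro flat_on_add[OF F])
      show "flat_on (Suc k) S (dir_deriv w ?T)"
        using flat_on_dir_deriv[OF flat_on_tangential[OF h flat]] by simp
      show "flat_on (Suc k) S (\<lambda>x. dir_deriv w (dir_deriv v \<rho>) x *\<^sub>R N h x)"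
        by (rule flat_on_scaleR[where j = 0 and k = "Suc k", OF F _ NC]) (use NF in \<open>auto intro: U_intros\<close>)
      show "flat_on (Suc k) S (\<lambda>x. dir_deriv v \<rho> x *\<^sub>R ?T' x)"
        by (rule flat_on_scaleR[where j = 0 and k = "Suc k", OF F _ TC'])
           (use flat_on_tangential[OF NC NF] in \<open>auto intro: U_intros\<close>)
    qed (intro Cinf_on_diff Cinf_on_add Cinf_on_scaleR U_intros TC TC' h NC NNC)+
  qed
qed

end

subsection \<open>Quaternionic Cauchy-Riemann operators\<close>

lemma UNIV_quat: "(UNIV :: 4 set) = {0, 1, 2, 3}"
  using UNIV_4 by auto

lemma forall_quat: "(\<forall>i::4. P i) \<longleftrightarrow> P 0 \<and> P 1 \<and> P 2 \<and> P 3"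
  using UNIV_quat by (metis UNIV_I empty_iff insert_iff)

lemma sum_quat: "sum f (UNIV :: 4 set) = f 0 + f 1 + f 2 + f 3"
  unfolding UNIV_quat by (simp add: add.assoc)

lemma qmult_nth [simp]:
  "(p \<bullet>\<^sub>H q) $ 0 = p $ 0 * q $ 0 - p $ 1 * q $ 1 - p $ 2 * q $ 2 - p $ 3 * q $ 3"
  "(p \<bullet>\<^sub>H q) $ 1 = p $ 0 * q $ 1 + p $ 1 * q $ 0 + p $ 2 * q $ 3 - p $ 3 * q $ 2"
  "(p \<bullet>\<^sub>H q) $ 2 = p $ 0 * q $ 2 - p $ 1 * q $ 3 + p $ 2 * q $ 0 + p $ 3 * q $ 1"
  "(p \<bullet>\<^sub>H q) $ 3 = p $ 0 * q $ 3 + p $ 1 * q $ 2 - p $ 2 * q $ 1 + p $ 3 * q $ 0"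
  by (simp_all add: qmult_def axis_def)

lemma qcnj_nth [simp]:
  "qcnj q $ 0 = q $ 0" "qcnj q $ 1 = - q $ 1" "qcnj q $ 2 = - q $ 2" "qcnj q $ 3 = - q $ 3"
  by (simp_all add: qcnj_def)

lemmas quat_eq_iff = vec_eq_iff[where 'b = 4, unfolded forall_quat]

interpretation qmult: bounded_bilinear "(\<bullet>\<^sub>H)"
proof -
  have "bilinear (\<bullet>\<^sub>H)"
    unfolding bilinear_def by (auto intro!: linearI simp: quat_eq_iff algebra_simps)
  then show "bounded_bilinear (\<bullet>\<^sub>H)" by (simp add: bilinear_conv_bounded_bilinear)
qed

lemma qmult_assoc: "(p \<bullet>\<^sub>H q) \<bullet>\<^sub>H r = p \<bullet>\<^sub>H (q \<bullet>\<^sub>H r)"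
  by (simp add: quat_eq_iff algebra_simps)

definition qnorm_sq :: "quat \<Rightarrow> real" where
  "qnorm_sq q = (\<Sum>\<alpha>\<in>UNIV. q $ \<alpha> * q $ \<alpha>)"

lemma qcnj_qmult_self: "qcnj s \<bullet>\<^sub>H (s \<bullet>\<^sub>H c) = qnorm_sq s *\<^sub>R c"
  by (simp add: quat_eq_iff qnorm_sq_def sum_quat algebra_simps)

lemma qmult_qcnj_self: "s \<bullet>\<^sub>H (qcnj s \<bullet>\<^sub>H c) = qnorm_sq s *\<^sub>R c"
  by (simp add: quat_eq_iff qnorm_sq_def sum_quat algebra_simps)

text \<open>conj(i_\<alpha>) i_\<gamma> is antisymmetric for \<alpha> \<noteq> \<gamma>, so only the
  diagonal survives. This is why the conjugate operator composed with dbar is the Laplacian.\<close>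

lemma quat_sum_symmetric:
  fixes M :: "4 \<Rightarrow> 4 \<Rightarrow> quat"
  assumes M: "\<And>\<alpha> \<gamma>. M \<alpha> \<gamma> = M \<gamma> \<alpha>"
  shows "(\<Sum>\<alpha>\<in>UNIV. \<Sum>\<gamma>\<in>UNIV. qcnj (axis \<alpha> 1) \<bullet>\<^sub>H (axis \<gamma> 1 \<bullet>\<^sub>H M \<alpha> \<gamma>)) = (\<Sum>\<alpha>\<in>UNIV. M \<alpha> \<alpha>)"
  using M[of 1 0] M[of 2 0] M[of 3 0] M[of 2 1] M[of 3 1] M[of 3 2]
  by (simp add: quat_eq_iff sum_quat axis_def)

lemma sum_axis_scaleR:
  "(\<Sum>\<alpha>\<in>UNIV. axis \<alpha> 1 \<bullet>\<^sub>H (s $ \<alpha> *\<^sub>R c)) = s \<bullet>\<^sub>H c"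
  "(\<Sum>\<alpha>\<in>UNIV. qcnj (axis \<alpha> 1) \<bullet>\<^sub>H (s $ \<alpha> *\<^sub>R c)) = qcnj s \<bullet>\<^sub>H c"
  by (simp_all add: quat_eq_iff sum_quat axis_def algebra_simps)

text \<open>The frame e selects the quaternionic variable: \<open>ddx\<close> for q1 and
  \<open>ddy\<close> for q2.\<close>

definition qdbar :: "(4 \<Rightarrow> 'a::real_normed_vector) \<Rightarrow> ('a \<Rightarrow> quat) \<Rightarrow> 'a \<Rightarrow> quat" where
  "qdbar e F x = (\<Sum>\<alpha>\<in>UNIV. axis \<alpha> 1 \<bullet>\<^sub>H dir_deriv (e \<alpha>) F x)"

text \<open>The principal symbol of \<open>qdbar e\<close> at dr; equivalently,
  \<open>qdbar e\<close> of r regarded as a quaternion-valued function.\<close>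

definition qsymbol :: "(4 \<Rightarrow> 'a::real_normed_vector) \<Rightarrow> ('a \<Rightarrow> real) \<Rightarrow> 'a \<Rightarrow> quat" where
  "qsymbol e r x = (\<chi> \<alpha>. dir_deriv (e \<alpha>) r x)"

lemma Cinf_on_vec_lambda:
  fixes f :: "'i::finite \<Rightarrow> 'a::real_normed_vector \<Rightarrow> real"
  assumes U: "open U" and f: "\<And>i. Cinf_on U (f i)"
  shows "Cinf_on U (\<lambda>x. \<chi> i. f i x)"
proof -
  have "(\<lambda>x. \<chi> i. f i x) = (\<lambda>x. \<Sum>i\<in>UNIV. f i x *\<^sub>R axis i 1)"
    by (auto simp: fun_eq_iff vec_eq_iff axis_def if_distrib sum.delta cong: if_cong)
  then show ?thesis by (simp add: Cinf_on_sum Cinf_on_scaleR f U)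
qed

lemma Cinf_on_qcnj: "open U \<Longrightarrow> Cinf_on U F \<Longrightarrow> Cinf_on U (\<lambda>x. qcnj (F x))"
proof -
  have "linear qcnj" by (rule linearI) (simp_all add: quat_eq_iff)
  then have "bounded_linear qcnj" by (simp add: linear_conv_bounded_linear)
  then show "open U \<Longrightarrow> Cinf_on U F \<Longrightarrow> Cinf_on U (\<lambda>x. qcnj (F x))" by (rule Cinf_on_compose_linear)
qed

lemma Cinf_on_qsymbol: "open U \<Longrightarrow> Cinf_on U r \<Longrightarrow> Cinf_on U (qsymbol e r)"
  unfolding qsymbol_def[abs_def] by (intro Cinf_on_vec_lambda Cinf_on_dir_deriv)

lemma Ck_on_qdbar: "open U \<Longrightarrow> Ck_on (Suc k) U F \<Longrightarrow> Ck_on k U (qdbar e F)"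
  unfolding qdbar_def[abs_def]
  by (intro Ck_on_sum Ck_on_compose_linear[OF qmult.bounded_linear_right] Ck_on_dir_deriv)

lemma Cinf_on_qdbar: "open U \<Longrightarrow> Cinf_on U F \<Longrightarrow> Cinf_on U (qdbar e F)"
  using Ck_on_qdbar unfolding Cinf_on_def by blast

lemma qdbar_cong:
  "open U \<Longrightarrow> x \<in> U \<Longrightarrow> (\<And>y. y \<in> U \<Longrightarrow> F y = G y) \<Longrightarrow> qdbar e F x = qdbar e G x"
  unfolding qdbar_def using dir_deriv_cong by (intro sum.cong refl arg_cong2[where f = qmult]) blast

lemma qdbar_diff:
  assumes "F differentiable (at x)" "G differentiable (at x)"
  shows "qdbar e (\<lambda>x. F x - G x) x = qdbar e F x - qdbar e G x"
  by (simp add: qdbar_def dir_deriv_diff[OF assms] qmult.diff_right sum_subtractf)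

lemma qdbar_scaleR:
  assumes "r differentiable (at x)" "F differentiable (at x)"
  shows "qdbar e (\<lambda>x. r x *\<^sub>R F x) x = qsymbol e r x \<bullet>\<^sub>H F x + r x *\<^sub>R qdbar e F x"
  using sum_axis_scaleR(1)[of "qsymbol e r x" "F x"]
  by (simp add: qdbar_def dir_deriv_scaleR[OF assms] qmult.add_right sum.distrib qmult.scaleR_right
      scaleR_sum_right qsymbol_def)

lemma dir_deriv_qdbar:
  assumes U: "open U" "Ck_on 2 U F" "x \<in> U"
  shows "dir_deriv v (qdbar e F) x = (\<Sum>\<alpha>\<in>UNIV. axis \<alpha> 1 \<bullet>\<^sub>H dir_deriv v (dir_deriv (e \<alpha>) F) x)"
proof -
  have d: "dir_deriv u F differentiable (at x)" for u
    using U by (auto simp: numeral_2_eq_2 intro: differentiable_on_openD)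
  have "dir_deriv v (qdbar e F) x = (\<Sum>\<alpha>\<in>UNIV. dir_deriv v (\<lambda>x. axis \<alpha> 1 \<bullet>\<^sub>H dir_deriv (e \<alpha>) F x) x)"
    unfolding qdbar_def[abs_def]
    by (rule dir_deriv_sum)
       (intro differentiable_compose[OF bounded_linear_imp_differentiable[OF qmult.bounded_linear_right]] d)
  also have "\<dots> = (\<Sum>\<alpha>\<in>UNIV. axis \<alpha> 1 \<bullet>\<^sub>H dir_deriv v (dir_deriv (e \<alpha>) F) x)"
    by (intro sum.cong refl dir_deriv_compose_linear qmult.bounded_linear_right d)
  finally show ?thesis .
qed

lemma dir_deriv_qdbar_eq:
  assumes U: "open U" "Ck_on 2 U F" "x \<in> U"
  shows "dir_deriv v (qdbar e F) x = qdbar e (dir_deriv v F) x"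
  unfolding dir_deriv_qdbar[OF U] qdbar_def by (intro sum.cong refl arg_cong2[where f = qmult] dir_deriv_commute[OF U])

lemma dir_deriv2_qdbar:
  assumes U: "open U" "Ck_on 3 U F" "x \<in> U"
  shows "dir_deriv w (dir_deriv v (qdbar e F)) x
    = (\<Sum>\<alpha>\<in>UNIV. axis \<alpha> 1 \<bullet>\<^sub>H dir_deriv w (dir_deriv v (dir_deriv (e \<alpha>) F)) x)"
proof -
  have F2: "Ck_on 2 U F" by (rule Ck_on_le[OF U(2)]) simp
  have F2': "Ck_on 2 U (dir_deriv u F)" for u using U(2) Ck_on_dir_deriv[of 2] by (simp add: numeral_3_eq_3 numeral_2_eq_2)
  have F1: "Ck_on 1 U (dir_deriv u F)" for u by (rule Ck_on_le[OF F2']) simp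
  have "dir_deriv w (dir_deriv v (qdbar e F)) x = dir_deriv w (qdbar e (dir_deriv v F)) x"
    by (rule dir_deriv_cong[OF U(1,3)]) (rule dir_deriv_qdbar_eq[OF U(1) F2])
  also have "\<dots> = (\<Sum>\<alpha>\<in>UNIV. axis \<alpha> 1 \<bullet>\<^sub>H dir_deriv w (dir_deriv (e \<alpha>) (dir_deriv v F)) x)"
    by (rule dir_deriv_qdbar[OF U(1) F2' U(3)])
  also have "\<dots> = (\<Sum>\<alpha>\<in>UNIV. axis \<alpha> 1 \<bullet>\<^sub>H dir_deriv w (dir_deriv v (dir_deriv (e \<alpha>) F)) x)"
    by (intro sum.cong refl arg_cong2[where f = qmult] dir_deriv_cong[OF U(1,3)] dir_deriv_commute[OF U(1) F2])
  finally show ?thesis .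
qed

text \<open>
  The second-order compatibility condition \<open>\<Delta>\<^sub>1 g\<^sub>2 = \<partial>\<bar>\<^sub>2 \<partial>\<^sub>1 g\<^sub>1\<close>
  for the inhomogeneous system \<open>\<partial>\<bar>\<^sub>1 F = g\<^sub>1, \<partial>\<bar>\<^sub>2 F = g\<^sub>2\<close>.
\<close>

lemma qdbar_compatibility:
  assumes U: "open U" "Ck_on 3 U F" "x \<in> U"
  shows "(\<Sum>\<alpha>\<in>UNIV. dir_deriv (e \<alpha>) (dir_deriv (e \<alpha>) (qdbar e' F)) x)
    = (\<Sum>\<beta>\<in>UNIV. axis \<beta> 1 \<bullet>\<^sub>H (\<Sum>\<alpha>\<in>UNIV. qcnj (axis \<alpha> 1) \<bullet>\<^sub>H dir_deriv (e' \<beta>) (dir_deriv (e \<alpha>) (qdbar e F)) x))"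
proof -
  have F2: "Ck_on 2 U F" by (rule Ck_on_le[OF U(2)]) simp
  have F2': "Ck_on 2 U (dir_deriv u F)" for u using U(2) Ck_on_dir_deriv[of 2] by (simp add: numeral_3_eq_3 numeral_2_eq_2)
  \<comment> \<open>For each \<beta> the conjugate operator turns \<open>qdbar e\<close> into the
    Laplacian of the frame e, which commutes with differentiation along
    \<open>e' \<beta>\<close>.\<close>
  have inner: "(\<Sum>\<alpha>\<in>UNIV. qcnj (axis \<alpha> 1) \<bullet>\<^sub>H dir_deriv (e' \<beta>) (dir_deriv (e \<alpha>) (qdbar e F)) x)
     = (\<Sum>\<alpha>\<in>UNIV. dir_deriv (e \<alpha>) (dir_deriv (e \<alpha>) (dir_deriv (e' \<beta>) F)) x)" for \<beta>
  proof -
    have "(\<Sum>\<alpha>\<in>UNIV. qcnj (axis \<alpha> 1) \<bullet>\<^sub>H dir_deriv (e' \<beta>) (dir_deriv (e \<alpha>) (qdbar e F)) x)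
      = (\<Sum>\<alpha>\<in>UNIV. \<Sum>\<gamma>\<in>UNIV. qcnj (axis \<alpha> 1) \<bullet>\<^sub>H (axis \<gamma> 1 \<bullet>\<^sub>H dir_deriv (e' \<beta>) (dir_deriv (e \<alpha>) (dir_deriv (e \<gamma>) F)) x))"
      unfolding dir_deriv2_qdbar[OF U] qmult.sum_right ..
    also have "\<dots> = (\<Sum>\<alpha>\<in>UNIV. dir_deriv (e' \<beta>) (dir_deriv (e \<alpha>) (dir_deriv (e \<alpha>) F)) x)"
      by (rule quat_sum_symmetric) (rule dir_deriv_cong[OF U(1,3)], rule dir_deriv_commute[OF U(1) F2])
    also have "\<dots> = (\<Sum>\<alpha>\<in>UNIV. dir_deriv (e \<alpha>) (dir_deriv (e \<alpha>) (dir_deriv (e' \<beta>) F)) x)"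
    proof (rule sum.cong[OF refl])
      fix \<alpha>
      have "dir_deriv (e' \<beta>) (dir_deriv (e \<alpha>) (dir_deriv (e \<alpha>) F)) x = dir_deriv (e \<alpha>) (dir_deriv (e' \<beta>) (dir_deriv (e \<alpha>) F)) x"
        by (rule dir_deriv_commute[OF U(1) F2' U(3)])
      also have "\<dots> = dir_deriv (e \<alpha>) (dir_deriv (e \<alpha>) (dir_deriv (e' \<beta>) F)) x"
        by (rule dir_deriv_cong[OF U(1,3)]) (rule dir_deriv_commute[OF U(1) F2])
      finally show "dir_deriv (e' \<beta>) (dir_deriv (e \<alpha>) (dir_deriv (e \<alpha>) F)) x
        = dir_deriv (e \<alpha>) (dir_deriv (e \<alpha>) (dir_deriv (e' \<beta>) F)) x" .
    qed
    finally show ?thesis .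
  qed
  show ?thesis
    unfolding inner unfolding dir_deriv2_qdbar[OF U] qmult.sum_right by (rule sum.swap)
qed

lemma qdbar_laplacian:
  assumes U: "open U" "Ck_on 2 U F" "x \<in> U"
  shows "(\<Sum>\<alpha>\<in>UNIV. qcnj (axis \<alpha> 1) \<bullet>\<^sub>H dir_deriv (e \<alpha>) (qdbar e F) x)
    = (\<Sum>\<alpha>\<in>UNIV. dir_deriv (e \<alpha>) (dir_deriv (e \<alpha>) F) x)"
  unfolding dir_deriv_qdbar[OF U] qmult.sum_right
  by (rule quat_sum_symmetric) (rule dir_deriv_commute[OF U])

section \<open>Raising the order to which dbar of an extension vanishes\<close>

context level_set
begin

lemma Cinf_intros_level: "Cinf_on U F \<Longrightarrow> Cinf_on U G \<Longrightarrow> Cinf_on U (\<lambda>x. F x \<bullet>\<^sub>H G x)"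
  using qmult.Cinf_on[OF open_U] .

lemma normal_deriv_cong: "(\<And>y. y \<in> U \<Longrightarrow> F y = G y) \<Longrightarrow> x \<in> U \<Longrightarrow> N F x = N G x"
  unfolding normal_deriv_def using dir_deriv_cong[OF open_U] by (intro sum.cong refl arg_cong2[where f = scaleR]) blast

lemma normal_deriv_funpow_cong:
  "(\<And>y. y \<in> U \<Longrightarrow> F y = G y) \<Longrightarrow> x \<in> U \<Longrightarrow> (N ^^ m) F x = (N ^^ m) G x"
proof (induction m arbitrary: x)
  case (Suc m)
  then show ?case using normal_deriv_cong[of "(N ^^ m) F" "(N ^^ m) G" x] by simp
qed simp

lemma normal_deriv_diff:
  assumes "Cinf_on U F" "Cinf_on U G" "x \<in> U"
  shows "N (\<lambda>x. F x - G x) x = N F x - N G x"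
  unfolding normal_deriv_def
  by (simp add: dir_deriv_diff[OF Cinf_on_differentiable[OF assms(1) open_U assms(3)]
        Cinf_on_differentiable[OF assms(2) open_U assms(3)]] scaleR_diff_right sum_subtractf)

lemma normal_deriv_funpow_diff:
  assumes F: "Cinf_on U F" and G: "Cinf_on U G"
  shows "x \<in> U \<Longrightarrow> (N ^^ m) (\<lambda>x. F x - G x) x = (N ^^ m) F x - (N ^^ m) G x"
proof (induction m arbitrary: x)
  case (Suc m)
  have "(N ^^ Suc m) (\<lambda>x. F x - G x) x = N (\<lambda>x. (N ^^ m) F x - (N ^^ m) G x) x"
    using normal_deriv_cong[OF Suc.IH Suc.prems] by simp
  also have "\<dots> = (N ^^ Suc m) F x - (N ^^ Suc m) G x"
    using normal_deriv_diff[OF Cinf_normal_deriv_funpow[OF F] Cinf_normal_deriv_funpow[OF G] Suc.prems] by simp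
  finally show ?case .
qed simp

lemma normal_deriv_bilinear:
  assumes B: "bounded_bilinear B" and F: "Cinf_on U F" and G: "Cinf_on U G" and x: "x \<in> U"
  shows "N (\<lambda>x. B (F x) (G x)) x = B (N F x) (G x) + B (F x) (N G x)"
proof -
  interpret bounded_bilinear B by (rule B)
  show ?thesis
    unfolding normal_deriv_def
    by (simp add: dir_deriv[OF Cinf_on_differentiable[OF F open_U x] Cinf_on_differentiable[OF G open_U x]]
        scaleR_add_right sum.distrib sum_left sum_right scaleR_left scaleR_right)
qed

text \<open>In the Leibniz expansion every term with a derivative on \<phi> leaves fewer than m of
  them on h, and so vanishes on S.\<close>

lemma normal_deriv_funpow_bilinear:
  assumes B: "bounded_bilinear B" and \<phi>: "Cinf_on U \<phi>" and p: "p \<in> S"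
  shows "Cinf_on U h \<Longrightarrow> flat_on m S h \<Longrightarrow> (N ^^ m) (\<lambda>x. B (\<phi> x) (h x)) p = B (\<phi> p) ((N ^^ m) h p)"
proof (induction m arbitrary: h)
  case (Suc m)
  interpret bounded_bilinear B by (rule B)
  have pU: "p \<in> U" using p S_subset by blast
  let ?A = "\<lambda>x. B (N \<phi> x) (h x)" and ?B = "\<lambda>x. B (\<phi> x) (N h x)"
  have C: "Cinf_on U ?A" "Cinf_on U ?B" using \<phi> Suc.prems(1) by (auto intro!: Cinf_on open_U Cinf_normal_deriv)
  have "(N ^^ Suc m) (\<lambda>x. B (\<phi> x) (h x)) p = (N ^^ m) (N (\<lambda>x. B (\<phi> x) (h x))) p" by (simp add: funpow_swap1)
  also have "\<dots> = (N ^^ m) (\<lambda>x. ?B x - (- ?A x)) p"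
    by (rule normal_deriv_funpow_cong[OF _ pU]) (simp add: normal_deriv_bilinear[OF B \<phi> Suc.prems(1)])
  also have "\<dots> = (N ^^ m) ?B p - (N ^^ m) (\<lambda>x. - ?A x) p"
    by (rule normal_deriv_funpow_diff[OF C(2) Cinf_on_minus[OF open_U C(1)] pU])
  also have "(N ^^ m) (\<lambda>x. - ?A x) p = 0"
  proof -
    have "flat_on (Suc m) S (\<lambda>x. - ?A x)"
      by (intro flat_on_minus[OF open_U S_subset] C
            flat_on_bilinear[where j = 0, OF open_U S_subset B Cinf_normal_deriv[OF \<phi>] Suc.prems(1) _ Suc.prems(2)]) auto
    from flat_on_normal_deriv_funpow[OF Cinf_on_minus[OF open_U C(1)] this, of m]
    show ?thesis by (rule flat_on_zeroD[OF _ _ p]) simp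
  qed
  also have "(N ^^ m) ?B p = B (\<phi> p) ((N ^^ m) (N h) p)"
    by (rule Suc.IH[OF Cinf_normal_deriv[OF Suc.prems(1)]]) (use flat_on_normal_deriv[OF Suc.prems] in simp)
  finally show ?case by (simp add: funpow_swap1)
qed simp

text \<open>In the compatibility condition, applied to data flat to order m + 2, second derivatives
  are replaced by their symbols; the coefficients on S are then read off with \<open>N ^^ m\<close>.
  The order has to be at least 2, as two derivatives are spent.\<close>

lemma symbol_relation:
  assumes F: "Cinf_on U F" and flat: "flat_on (Suc (Suc m)) S (qdbar e F)" "flat_on (Suc (Suc m)) S (qdbar e' F)"
    and p: "p \<in> S"
  shows "qnorm_sq (qsymbol e \<rho> p) *\<^sub>R (N ^^ Suc (Suc m)) (qdbar e' F) p
    = qsymbol e' \<rho> p \<bullet>\<^sub>H (qcnj (qsymbol e \<rho> p) \<bullet>\<^sub>H (N ^^ Suc (Suc m)) (qdbar e F) p)"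
proof -
  note fl = open_U S_subset
  have pU: "p \<in> U" using p S_subset by blast
  let ?g = "qdbar e F" and ?g' = "qdbar e' F"
  have gC: "Cinf_on U ?g" "Cinf_on U ?g'" using Cinf_on_qdbar[OF open_U F] by auto
  let ?D = "\<lambda>v. dir_deriv v \<rho>"
  let ?R = "\<lambda>g w v x. dir_deriv w (dir_deriv v g) x - (?D w x * ?D v x) *\<^sub>R N (N g) x"
  \<comment> \<open>The compatibility condition minus its symbol part. It is flat to order m + 1 by
    \<open>flat_on_second_symbol\<close>, so \<open>N ^^ m\<close> of it vanishes on S.\<close>
  define T where "T x = (\<Sum>\<alpha>\<in>UNIV. ?R ?g' (e \<alpha>) (e \<alpha>) x)
     - (\<Sum>\<beta>\<in>UNIV. axis \<beta> 1 \<bullet>\<^sub>H (\<Sum>\<alpha>\<in>UNIV. qcnj (axis \<alpha> 1) \<bullet>\<^sub>H ?R ?g (e' \<beta>) (e \<alpha>) x))" for x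
  define \<phi> where "\<phi> x = qnorm_sq (qsymbol e \<rho> x)" for x
  define \<psi> where "\<psi> x = qsymbol e' \<rho> x \<bullet>\<^sub>H qcnj (qsymbol e \<rho> x)" for x
  have \<phi>C: "Cinf_on U \<phi>"
    unfolding \<phi>_def[abs_def] qnorm_sq_def qsymbol_def vec_lambda_beta
    by (intro Cinf_on_sum Cinf_on_mult U_intros)
  have \<psi>C: "Cinf_on U \<psi>"
    unfolding \<psi>_def[abs_def] by (intro Cinf_intros_level Cinf_on_qcnj Cinf_on_qsymbol U_intros)
  note NN = Cinf_normal_deriv[OF Cinf_normal_deriv[OF gC(1)]] Cinf_normal_deriv[OF Cinf_normal_deriv[OF gC(2)]]
  have R: "Cinf_on U (?R g w v)" if "Cinf_on U g" for g :: "'a \<Rightarrow> quat" and w v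
    by (intro Cinf_on_diff Cinf_on_scaleR Cinf_on_mult U_intros Cinf_normal_deriv that)
  have L: "bounded_linear (\<lambda>x. c \<bullet>\<^sub>H x)" for c by (rule qmult.bounded_linear_right)
  have LC: "Cinf_on U (\<lambda>x. c \<bullet>\<^sub>H G x)" if "Cinf_on U G" for c G
    by (rule Cinf_on_compose_linear[OF L open_U that])
  have T_flat: "flat_on (Suc m) S T"
    unfolding T_def
    by (intro flat_on_diff[OF fl] flat_on_sum[OF fl] flat_on_second_symbol flat_on_compose_linear[OF fl L]
          Cinf_on_sum LC R open_U gC flat)
  have TC: "Cinf_on U T" unfolding T_def[abs_def] by (intro Cinf_on_diff Cinf_on_sum LC R open_U gC)
  have TW: "T x = \<psi> x \<bullet>\<^sub>H N (N ?g) x - \<phi> x *\<^sub>R N (N ?g') x" if x: "x \<in> U" for x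
  proof -
    have F3: "Ck_on 3 U F" using F by (simp add: Cinf_on_def)
    have 1: "(\<Sum>\<alpha>\<in>UNIV. (?D (e \<alpha>) x * ?D (e \<alpha>) x) *\<^sub>R N (N ?g') x) = \<phi> x *\<^sub>R N (N ?g') x"
      by (simp add: \<phi>_def qnorm_sq_def qsymbol_def scaleR_sum_left)
    have 2: "(\<Sum>\<beta>\<in>UNIV. axis \<beta> 1 \<bullet>\<^sub>H (\<Sum>\<alpha>\<in>UNIV. qcnj (axis \<alpha> 1) \<bullet>\<^sub>H ((?D (e' \<beta>) x * ?D (e \<alpha>) x) *\<^sub>R N (N ?g) x)))
       = \<psi> x \<bullet>\<^sub>H N (N ?g) x"
    proof -
      have "(\<Sum>\<alpha>\<in>UNIV. qcnj (axis \<alpha> 1) \<bullet>\<^sub>H ((?D (e' \<beta>) x * ?D (e \<alpha>) x) *\<^sub>R N (N ?g) x))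
          = qsymbol e' \<rho> x $ \<beta> *\<^sub>R (qcnj (qsymbol e \<rho> x) \<bullet>\<^sub>H N (N ?g) x)" for \<beta>
        unfolding sum_axis_scaleR(2)[of "qsymbol e \<rho> x" "N (N ?g) x", symmetric] scaleR_sum_right
        by (simp add: qsymbol_def qmult.scaleR_right)
      then show ?thesis by (simp add: sum_axis_scaleR(1) \<psi>_def qmult_assoc)
    qed
    show ?thesis
      using qdbar_compatibility[OF open_U F3 x, of e e']
      unfolding T_def sum_subtractf qmult.diff_right 1 2 by simp
  qed
  have "(N ^^ m) T p = 0"
    by (rule flat_on_zeroD[OF flat_on_normal_deriv_funpow[OF TC T_flat, of m] _ p]) simp
  also have "(N ^^ m) T p = (N ^^ m) (\<lambda>x. \<psi> x \<bullet>\<^sub>H N (N ?g) x - \<phi> x *\<^sub>R N (N ?g') x) p"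
    by (rule normal_deriv_funpow_cong[OF TW pU])
  also have "\<dots> = (N ^^ m) (\<lambda>x. \<psi> x \<bullet>\<^sub>H N (N ?g) x) p - (N ^^ m) (\<lambda>x. \<phi> x *\<^sub>R N (N ?g') x) p"
    by (rule normal_deriv_funpow_diff[OF Cinf_intros_level[OF \<psi>C NN(1)] Cinf_on_scaleR[OF open_U \<phi>C NN(2)] pU])
  also have "(N ^^ m) (\<lambda>x. \<psi> x \<bullet>\<^sub>H N (N ?g) x) p = \<psi> p \<bullet>\<^sub>H (N ^^ m) (N (N ?g)) p"
    using flat_on_normal_deriv[OF Cinf_normal_deriv[OF gC(1)] flat_on_normal_deriv[OF gC(1) flat(1)]]
    by (intro normal_deriv_funpow_bilinear[OF qmult.bounded_bilinear_axioms \<psi>C p NN(1)]) simp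
  also have "(N ^^ m) (\<lambda>x. \<phi> x *\<^sub>R N (N ?g') x) p = \<phi> p *\<^sub>R (N ^^ m) (N (N ?g')) p"
    using flat_on_normal_deriv[OF Cinf_normal_deriv[OF gC(2)] flat_on_normal_deriv[OF gC(2) flat(2)]]
    by (intro normal_deriv_funpow_bilinear[OF bounded_bilinear_scaleR \<phi>C p NN(2)]) simp
  finally show ?thesis
    by (simp add: \<phi>_def \<psi>_def qmult_assoc funpow_swap1)
qed

text \<open>
  The hypothesis \<open>sol\<close> says that the leading coefficient of \<open>\<partial>\<bar>F\<close> along \<open>S\<close> can be
  removed by subtracting a multiple of \<open>\<rho>\<^sup>k\<^sup>+\<^sup>1\<close> from \<open>F\<close>.
\<close>

lemma improve_extension:
  assumes frame: "\<And>x. x \<in> U \<Longrightarrow> qnorm_sq (qsymbol e \<rho> x) + qnorm_sq (qsymbol e' \<rho> x) = grad_sq \<rho> x"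
    and F: "Cinf_on U F" and flat: "flat_on k S (qdbar e F)" "flat_on k S (qdbar e' F)"
    and sol: "\<And>p. p \<in> S \<Longrightarrow> \<exists>c. (N ^^ k) (qdbar e F) p = qsymbol e \<rho> p \<bullet>\<^sub>H c \<and> (N ^^ k) (qdbar e' F) p = qsymbol e' \<rho> p \<bullet>\<^sub>H c"
  shows "\<exists>F'. Cinf_on U F' \<and> (\<forall>p\<in>S. F' p = F p) \<and> flat_on (Suc k) S (qdbar e F') \<and> flat_on (Suc k) S (qdbar e' F')"
proof -
  note fl = open_U S_subset
  \<comment> \<open>If a is s c and a' is s' c, then conj(s) a + conj(s') a' is |grad \<rho>|^2 c.
    The formula thus recovers the pointwise solution c as a function that is smooth on all of
    U.\<close>
  define C where "C x = inverse (grad_sq \<rho> x) *\<^sub>R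
    (qcnj (qsymbol e \<rho> x) \<bullet>\<^sub>H (N ^^ k) (qdbar e F) x + qcnj (qsymbol e' \<rho> x) \<bullet>\<^sub>H (N ^^ k) (qdbar e' F) x)" for x
  have gradC: "Cinf_on U (\<lambda>x. inverse (grad_sq \<rho> x))"
    unfolding grad_sq_def by (intro Cinf_on_inverse Cinf_on_sum Cinf_on_mult U_intros)
      (use grad_nonzero in \<open>simp add: grad_sq_def\<close>)
  have CC: "Cinf_on U C"
    unfolding C_def[abs_def]
    by (intro Cinf_on_scaleR gradC Cinf_on_add Cinf_intros_level Cinf_on_qcnj Cinf_on_qsymbol
          Cinf_normal_deriv_funpow Cinf_on_qdbar F open_U smooth_\<rho>)
  have C_eq: "C p = c" if "p \<in> S" "(N ^^ k) (qdbar e F) p = qsymbol e \<rho> p \<bullet>\<^sub>H c" "(N ^^ k) (qdbar e' F) p = qsymbol e' \<rho> p \<bullet>\<^sub>H c" for p c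
  proof -
    have pU: "p \<in> U" using that(1) S_subset by blast
    show ?thesis
      unfolding C_def that(2,3) qcnj_qmult_self scaleR_add_left[symmetric] frame[OF pU]
      using grad_nonzero[OF pU] by simp
  qed
  let ?r = "\<lambda>k x. \<rho> x ^ k / fact k"
  \<comment> \<open>To leading order, dbar of the correction is \<open>\<rho> ^ k / fact k\<close>
    times the symbol times C, which is the Taylor term of dbar F.\<close>
  define F' where "F' x = F x - ?r (Suc k) x *\<^sub>R C x" for x
  have F'C: "Cinf_on U F'"
    unfolding F'_def[abs_def] by (intro Cinf_on_diff Cinf_on_scaleR Cinf_on_power_fact CC F open_U)
  have main: "flat_on (Suc k) S (qdbar d F')"
    if fd: "flat_on k S (qdbar d F)" and sd: "\<And>p. p \<in> S \<Longrightarrow> (N ^^ k) (qdbar d F) p = qsymbol d \<rho> p \<bullet>\<^sub>H C p" for d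
  proof -
    let ?g = "qdbar d F"
    have gC: "Cinf_on U ?g" by (rule Cinf_on_qdbar[OF open_U F])
    have sC: "Cinf_on U (\<lambda>x. qsymbol d \<rho> x \<bullet>\<^sub>H C x)"
      by (intro Cinf_intros_level Cinf_on_qsymbol open_U smooth_\<rho> CC)
    have MC: "Cinf_on U ((N ^^ k) ?g)" by (rule Cinf_normal_deriv_funpow[OF gC])
    have eq: "qdbar d F' x = (?g x - ?r k x *\<^sub>R (N ^^ k) ?g x) + ?r k x *\<^sub>R ((N ^^ k) ?g x - qsymbol d \<rho> x \<bullet>\<^sub>H C x)
        - ?r (Suc k) x *\<^sub>R qdbar d C x" if x: "x \<in> U" for x
    proof -
      have "qdbar d F' x = ?g x - qdbar d (\<lambda>x. ?r (Suc k) x *\<^sub>R C x) x"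
        unfolding F'_def[abs_def]
        by (intro qdbar_diff Cinf_on_differentiable[OF _ open_U x] F Cinf_on_scaleR Cinf_on_power_fact CC open_U)
      also have "qdbar d (\<lambda>x. ?r (Suc k) x *\<^sub>R C x) x = qsymbol d (?r (Suc k)) x \<bullet>\<^sub>H C x + ?r (Suc k) x *\<^sub>R qdbar d C x"
        by (intro qdbar_scaleR Cinf_on_differentiable[OF _ open_U x] Cinf_on_power_fact CC)
      also have "qsymbol d (?r (Suc k)) x = ?r k x *\<^sub>R qsymbol d \<rho> x"
        unfolding qsymbol_def dir_deriv_power_fact[OF x] by (simp add: vec_eq_iff)
      finally show ?thesis by (simp add: qmult.scaleR_left algebra_simps)
    qed
    from flat_on_cong[OF fl eq] show ?thesis
    proof (rule iffD2)
      show "flat_on (Suc k) S (\<lambda>x. (?g x - ?r k x *\<^sub>R (N ^^ k) ?g x) + ?r k x *\<^sub>R ((N ^^ k) ?g x - qsymbol d \<rho> x \<bullet>\<^sub>H C x)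
        - ?r (Suc k) x *\<^sub>R qdbar d C x)"
      proof (rule flat_on_diff[OF fl _ _ flat_on_add[OF fl]])
        show "flat_on (Suc k) S (\<lambda>x. ?g x - ?r k x *\<^sub>R (N ^^ k) ?g x)" by (rule flat_on_taylor[OF gC fd])
        show "flat_on (Suc k) S (\<lambda>x. ?r k x *\<^sub>R ((N ^^ k) ?g x - qsymbol d \<rho> x \<bullet>\<^sub>H C x))"
          by (rule flat_on_scaleR[where j = k and k = 1, OF fl Cinf_on_power_fact Cinf_on_diff[OF open_U MC sC] flat_on_power_fact])
             (use sd in auto)
        show "flat_on (Suc k) S (\<lambda>x. ?r (Suc k) x *\<^sub>R qdbar d C x)"
          by (rule flat_on_scaleR[where j = "Suc k" and k = 0, OF fl Cinf_on_power_fact Cinf_on_qdbar[OF open_U CC] flat_on_power_fact]) auto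
      qed (intro Cinf_on_diff Cinf_on_add Cinf_on_scaleR open_U Cinf_on_power_fact gC MC sC Cinf_on_qdbar CC)+
    qed
  qed
  have "F' p = F p" if "p \<in> S" for p using \<rho>_zero[OF that] by (simp add: F'_def)
  moreover have "(N ^^ k) (qdbar e F) p = qsymbol e \<rho> p \<bullet>\<^sub>H C p \<and> (N ^^ k) (qdbar e' F) p = qsymbol e' \<rho> p \<bullet>\<^sub>H C p" if "p \<in> S" for p
    using sol[OF that] C_eq[OF that] by blast
  ultimately show ?thesis using main[OF flat(1)] main[OF flat(2)] F'C by blast
qed

text \<open>Orders 0 and 1 are settled by the hypotheses; from order 2 on the solvability condition
  of \<open>improve_extension\<close> follows from \<open>symbol_relation\<close>, used in both
  directions.\<close>

lemma extension_to_infinite_order: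
  assumes frame: "\<And>x. x \<in> U \<Longrightarrow> qnorm_sq (qsymbol e \<rho> x) + qnorm_sq (qsymbol e' \<rho> x) = grad_sq \<rho> x"
    and F: "Cinf_on U F" and flat: "flat_on 1 S (qdbar e F)" "flat_on 1 S (qdbar e' F)"
    and sol: "\<And>p. p \<in> S \<Longrightarrow> \<exists>c. N (qdbar e F) p = qsymbol e \<rho> p \<bullet>\<^sub>H c \<and> N (qdbar e' F) p = qsymbol e' \<rho> p \<bullet>\<^sub>H c"
  shows "\<exists>F'. Cinf_on U F' \<and> (\<forall>p\<in>S. F' p = F p) \<and> flat_on k S (qdbar e F') \<and> flat_on k S (qdbar e' F')"
proof (cases k)
  case 0 then show ?thesis using F by auto
next
  case (Suc k')
  have "\<exists>F'. Cinf_on U F' \<and> (\<forall>p\<in>S. F' p = F p) \<and> flat_on (Suc k') S (qdbar e F') \<and> flat_on (Suc k') S (qdbar e' F')" for k'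
  proof (induction k')
    case 0 then show ?case using F flat by auto
  next
    case (Suc k')
    then obtain F1 where F1: "Cinf_on U F1" "\<forall>p\<in>S. F1 p = F p" "flat_on (Suc k') S (qdbar e F1)" "flat_on (Suc k') S (qdbar e' F1)"
      by blast
    show ?case
    proof (cases k')
      case 0
      show ?thesis
        using improve_extension[OF frame F, of 1] flat sol 0 by simp
    next
      case (Suc m)
      have "\<exists>c. (N ^^ Suc k') (qdbar e F1) p = qsymbol e \<rho> p \<bullet>\<^sub>H c \<and> (N ^^ Suc k') (qdbar e' F1) p = qsymbol e' \<rho> p \<bullet>\<^sub>H c"
        if p: "p \<in> S" for p
      proof -
        let ?s = "qsymbol e \<rho> p" and ?s' = "qsymbol e' \<rho> p"
        let ?a = "(N ^^ Suc k') (qdbar e F1) p" and ?a' = "(N ^^ Suc k') (qdbar e' F1) p"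
        have pU: "p \<in> U" using p S_subset by blast
        have 1: "qnorm_sq ?s *\<^sub>R ?a' = ?s' \<bullet>\<^sub>H (qcnj ?s \<bullet>\<^sub>H ?a)"
          using symbol_relation[OF F1(1) F1(3,4)[unfolded Suc] p] unfolding Suc .
        have 2: "qnorm_sq ?s' *\<^sub>R ?a = ?s \<bullet>\<^sub>H (qcnj ?s' \<bullet>\<^sub>H ?a')"
          using symbol_relation[OF F1(1) F1(4,3)[unfolded Suc] p] unfolding Suc .
        \<comment> \<open>The two relations give s c = (|s|^2 a + |s'|^2 a) / |grad \<rho>|^2 = a,
          and likewise for a'; neither symbol has to be invertible.\<close>
        let ?c = "inverse (grad_sq \<rho> p) *\<^sub>R (qcnj ?s \<bullet>\<^sub>H ?a + qcnj ?s' \<bullet>\<^sub>H ?a')"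
        have g: "inverse (grad_sq \<rho> p) *\<^sub>R (qnorm_sq ?s *\<^sub>R z + qnorm_sq ?s' *\<^sub>R z) = z" for z :: quat
          using grad_nonzero[OF pU] by (simp add: frame[OF pU] flip: scaleR_add_left)
        have "?s \<bullet>\<^sub>H ?c = ?a"
          unfolding qmult.scaleR_right qmult.add_right qmult_qcnj_self 2[symmetric] by (rule g)
        moreover have "?s' \<bullet>\<^sub>H ?c = ?a'"
          unfolding qmult.scaleR_right qmult.add_right qmult_qcnj_self 1[symmetric] by (rule g)
        ultimately show ?thesis by metis
      qed
      then show ?thesis using improve_extension[OF frame F1(1,3,4)] F1(2) by metis
    qed
  qed
  with Suc show ?thesis by blast
qed

end

subsection \<open>Exterior forms and the normal derivative\<close>

text \<open>The value at \<open>v\<close> of the wedge product of the linear forms dual to the vectors in \<open>es\<close>.\<close>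

definition alt_form :: "'a::real_inner list \<Rightarrow> (nat \<Rightarrow> 'a) \<Rightarrow> real" where
  "alt_form es v = (\<Sum>\<sigma> | \<sigma> permutes {..<length es}.
     of_int (sign \<sigma>) * (\<Prod>i<length es. v (\<sigma> i) \<bullet> es ! i))"

lemma of_int_sign_sq [simp]: "of_int (sign p) * (of_int (sign p) :: real) = 1"
  by (metis of_int_1 of_int_mult sign_idempotent)

lemma alt_form_permute:
  assumes \<pi>: "\<pi> permutes {..<length es}" and len: "length fs = length es"
    and fs: "\<And>i. i < length es \<Longrightarrow> fs ! i = es ! \<pi> i"
  shows "alt_form fs v = of_int (sign \<pi>) * alt_form es v"
proof -
  let ?n = "length es" and ?P = "{\<sigma>. \<sigma> permutes {..<length es}}"
  have inv: "inv \<pi> permutes {..<?n}" by (rule permutes_inv[OF \<pi>])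
  have sinv: "sign (inv \<pi>) = sign \<pi>" using \<pi> by (intro sign_inverse) (auto simp: permutation_permutes)
  have "(\<Prod>i<?n. v (\<sigma> i) \<bullet> fs ! i) = (\<Prod>i<?n. v ((\<sigma> \<circ> inv \<pi>) i) \<bullet> es ! i)" for \<sigma>
  proof -
    have "(\<Prod>i<?n. v ((\<sigma> \<circ> inv \<pi>) i) \<bullet> es ! i) = (\<Prod>i<?n. v ((\<sigma> \<circ> inv \<pi>) (\<pi> i)) \<bullet> es ! \<pi> i)"
      by (rule prod.reindex_bij_betw[OF permutes_imp_bij[OF \<pi>], symmetric])
    also have "\<dots> = (\<Prod>i<?n. v (\<sigma> i) \<bullet> fs ! i)"
      by (intro prod.cong refl) (use fs permutes_inverses[OF \<pi>] in auto)
    finally show ?thesis ..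
  qed
  then have "alt_form fs v = (\<Sum>\<sigma>\<in>?P. of_int (sign \<sigma>) * (\<Prod>i<?n. v ((\<sigma> \<circ> inv \<pi>) i) \<bullet> es ! i))"
    by (simp add: alt_form_def len)
  also have "\<dots> = (\<Sum>\<sigma>\<in>?P. of_int (sign \<pi>) * (of_int (sign (\<sigma> \<circ> inv \<pi>)) * (\<Prod>i<?n. v ((\<sigma> \<circ> inv \<pi>) i) \<bullet> es ! i)))"
  proof (rule sum.cong[OF refl])
    fix \<sigma> assume "\<sigma> \<in> ?P"
    then have "sign (\<sigma> \<circ> inv \<pi>) = sign \<sigma> * sign \<pi>"
      using inv sinv by (subst sign_compose) (auto simp: permutation_permutes)
    then have "of_int (sign \<sigma>) = (of_int (sign \<pi>) * of_int (sign (\<sigma> \<circ> inv \<pi>)) :: real)"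
      by (simp add: mult.left_commute[of "of_int (sign \<pi>)"])
    then show "of_int (sign \<sigma>) * (\<Prod>i<?n. v ((\<sigma> \<circ> inv \<pi>) i) \<bullet> es ! i)
      = of_int (sign \<pi>) * (of_int (sign (\<sigma> \<circ> inv \<pi>)) * (\<Prod>i<?n. v ((\<sigma> \<circ> inv \<pi>) i) \<bullet> es ! i))" by simp
  qed
  also have "\<dots> = of_int (sign \<pi>) * (\<Sum>\<sigma>\<in>?P. of_int (sign (\<sigma> \<circ> inv \<pi>)) * (\<Prod>i<?n. v ((\<sigma> \<circ> inv \<pi>) i) \<bullet> es ! i))"
    by (rule sum_distrib_left[symmetric])
  also have "(\<Sum>\<sigma>\<in>?P. of_int (sign (\<sigma> \<circ> inv \<pi>)) * (\<Prod>i<?n. v ((\<sigma> \<circ> inv \<pi>) i) \<bullet> es ! i)) = alt_form es v"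
    unfolding alt_form_def using sum_permutations_compose_right[OF inv,
        of "\<lambda>\<sigma>. of_int (sign \<sigma>) * (\<Prod>i<?n. v (\<sigma> i) \<bullet> es ! i)"] by simp
  finally show ?thesis .
qed

lemma alt_form_not_distinct:
  assumes "\<not> distinct es"
  shows "alt_form es v = 0"
proof -
  obtain i j where ij: "i < length es" "j < length es" "i \<noteq> j" "es ! i = es ! j"
    using assms by (auto simp: distinct_conv_nth)
  have "alt_form es v = of_int (sign (Transposition.transpose i j)) * alt_form es v"
    by (rule alt_form_permute) (use ij in \<open>auto intro!: permutes_swap_id simp: Transposition.transpose_def\<close>)
  then show ?thesis using ij(3) by (simp add: sign_swap_id)
qed

lemma alt_form_swap: "alt_form (as @ b # c # cs) v = - alt_form (as @ c # b # cs) v"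
proof -
  let ?n = "length as"
  have "alt_form (as @ b # c # cs) v = of_int (sign (Transposition.transpose ?n (Suc ?n))) * alt_form (as @ c # b # cs) v"
  proof (rule alt_form_permute)
    show "(as @ b # c # cs) ! i = (as @ c # b # cs) ! Transposition.transpose ?n (Suc ?n) i" for i
      by (auto simp: nth_append Transposition.transpose_def nth_Cons')
  qed (auto intro!: permutes_swap_id)
  then show ?thesis by (simp add: sign_swap_id)
qed

lemma alt_form_move: "alt_form (as @ b # cs @ ds) v = (- 1) ^ length cs * alt_form (as @ cs @ b # ds) v"
proof (induction cs arbitrary: as)
  case (Cons c cs)
  show ?case using alt_form_swap[of as b c "cs @ ds" v] Cons.IH[of "as @ [c]"] by simp
qed simp

lemma permutes_lessThan_mono: "\<tau> permutes {..<k} \<Longrightarrow> \<tau> permutes {..<k + l}" for k l :: nat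
  by (rule permutes_subset) auto

text \<open>For each pair of inner permutations, absorbing them into \<sigma> gives the full
  alternating sum of the joined list. There are k! l! pairs, the factor that \<open>wedge\<close>
  divides by.\<close>

lemma alt_form_append:
  "(\<Sum>\<sigma> | \<sigma> permutes {..<length xs + length ys}.
      of_int (sign \<sigma>) * (alt_form xs (\<lambda>i. v (\<sigma> i)) * alt_form ys (\<lambda>i. v (\<sigma> (length xs + i)))))
   = fact (length xs) * fact (length ys) * alt_form (xs @ ys) v"
proof -
  define k l where "k = length xs" and "l = length ys"
  let ?P = "\<lambda>n. {\<sigma>. \<sigma> permutes {..<n::nat}}"
  let ?f = "\<lambda>\<sigma>. of_int (sign \<sigma>) * (\<Prod>i<k + l. v (\<sigma> i) \<bullet> (xs @ ys) ! i)"
  \<comment> \<open>\<open>sh \<tau>\<close> is \<tau> acting on the last l places.\<close>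
  define sh where "sh \<tau> = map_permutation {..<l} ((+) k) \<tau>" for \<tau> :: "nat \<Rightarrow> nat"
  have sh: "sh \<tau> permutes {k..<k + l}" "sign (sh \<tau>) = sign \<tau>" "\<And>i. i < l \<Longrightarrow> sh \<tau> (k + i) = k + \<tau> i"
    "\<And>i. i < k \<Longrightarrow> sh \<tau> i = i" "sh \<tau> permutes {..<k + l}" if \<tau>: "\<tau> permutes {..<l}" for \<tau>
  proof -
    have "bij_betw ((+) k) {..<l} {k..<k + l}"
      by (rule bij_betwI[where g = "\<lambda>i. i - k"]) auto
    then show 1: "sh \<tau> permutes {k..<k + l}" unfolding sh_def by (rule map_permutation_permutes) (rule \<tau>)
    show "sign (sh \<tau>) = sign \<tau>" unfolding sh_def by (rule sign_map_permutation) (auto intro: \<tau>)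
    show "sh \<tau> (k + i) = k + \<tau> i" if "i < l" for i
      unfolding sh_def by (rule map_permutation_apply) (use that in auto)
    show "sh \<tau> i = i" if "i < k" for i using permutes_not_in[OF 1] that by simp
    show "sh \<tau> permutes {..<k + l}" by (rule permutes_subset[OF 1]) auto
  qed
  have split: "(\<Prod>j<k + l. g j) = (\<Prod>i<k. g i) * (\<Prod>i<l. g (k + i))" for g :: "nat \<Rightarrow> real"
    by (induction l) (simp_all add: mult.assoc)
  have summand: "of_int (sign \<sigma>) * (alt_form xs (\<lambda>i. v (\<sigma> i)) * alt_form ys (\<lambda>i. v (\<sigma> (k + i))))
     = (\<Sum>\<tau>\<in>?P k. \<Sum>\<tau>'\<in>?P l. ?f (\<sigma> \<circ> (\<tau> \<circ> sh \<tau>')))" if \<sigma>: "\<sigma> permutes {..<k + l}" for \<sigma>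
  proof -
    have 1: "of_int (sign \<sigma>) * ((of_int (sign \<tau>) * (\<Prod>i<k. v (\<sigma> (\<tau> i)) \<bullet> xs ! i)) *
        (of_int (sign \<tau>') * (\<Prod>i<l. v (\<sigma> (k + \<tau>' i)) \<bullet> ys ! i))) = ?f (\<sigma> \<circ> (\<tau> \<circ> sh \<tau>'))"
      if \<tau>: "\<tau> \<in> ?P k" and \<tau>': "\<tau>' \<in> ?P l" for \<tau> \<tau>'
    proof -
      have t: "\<tau> permutes {..<k}" "\<tau> permutes {..<k + l}" using \<tau> permutes_lessThan_mono by auto
      note s = sh[of \<tau>', OF \<tau>'[simplified]]
      have comp: "\<tau> \<circ> sh \<tau>' permutes {..<k + l}" using t s by (auto intro: permutes_compose)
      have perm: "permutation \<sigma>" "permutation \<tau>" "permutation (sh \<tau>')" "permutation (\<tau> \<circ> sh \<tau>')"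
        using \<sigma> t(2) s(5) comp by (auto simp: permutation_permutes)
      have sgn: "of_int (sign (\<sigma> \<circ> (\<tau> \<circ> sh \<tau>'))) = (of_int (sign \<sigma>) * of_int (sign \<tau>) * of_int (sign \<tau>') :: real)"
        by (simp add: sign_compose perm s(2))
      have "(\<Prod>j<k + l. v ((\<sigma> \<circ> (\<tau> \<circ> sh \<tau>')) j) \<bullet> (xs @ ys) ! j)
        = (\<Prod>i<k. v (\<sigma> (\<tau> i)) \<bullet> xs ! i) * (\<Prod>i<l. v (\<sigma> (k + \<tau>' i)) \<bullet> ys ! i)"
        unfolding split
      proof (intro arg_cong2[where f = "(*)"] prod.cong refl)
        fix i assume "i \<in> {..<k}"
        then show "v ((\<sigma> \<circ> (\<tau> \<circ> sh \<tau>')) i) \<bullet> (xs @ ys) ! i = v (\<sigma> (\<tau> i)) \<bullet> xs ! i"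
          using s(4) by (simp add: nth_append k_def)
      next
        fix i assume i: "i \<in> {..<l}"
        have "\<tau> (k + \<tau>' i) = k + \<tau>' i" by (rule permutes_not_in[OF t(1)]) simp
        then show "v ((\<sigma> \<circ> (\<tau> \<circ> sh \<tau>')) (k + i)) \<bullet> (xs @ ys) ! (k + i) = v (\<sigma> (k + \<tau>' i)) \<bullet> ys ! i"
          using s(3) i by (simp add: nth_append k_def)
      qed
      then show ?thesis unfolding sgn by (simp add: mult_ac)
    qed
    have "of_int (sign \<sigma>) * (alt_form xs (\<lambda>i. v (\<sigma> i)) * alt_form ys (\<lambda>i. v (\<sigma> (k + i))))
      = (\<Sum>\<tau>\<in>?P k. \<Sum>\<tau>'\<in>?P l. of_int (sign \<sigma>) * ((of_int (sign \<tau>) * (\<Prod>i<k. v (\<sigma> (\<tau> i)) \<bullet> xs ! i)) *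
        (of_int (sign \<tau>') * (\<Prod>i<l. v (\<sigma> (k + \<tau>' i)) \<bullet> ys ! i))))"
      unfolding alt_form_def k_def[symmetric] l_def[symmetric] unfolding sum_product unfolding sum_distrib_left ..
    also have "\<dots> = (\<Sum>\<tau>\<in>?P k. \<Sum>\<tau>'\<in>?P l. ?f (\<sigma> \<circ> (\<tau> \<circ> sh \<tau>')))"
      by (intro sum.cong refl 1)
    finally show ?thesis .
  qed
  have "(\<Sum>\<sigma>\<in>?P (k + l). of_int (sign \<sigma>) * (alt_form xs (\<lambda>i. v (\<sigma> i)) * alt_form ys (\<lambda>i. v (\<sigma> (k + i)))))
     = (\<Sum>\<sigma>\<in>?P (k + l). \<Sum>\<tau>\<in>?P k. \<Sum>\<tau>'\<in>?P l. ?f (\<sigma> \<circ> (\<tau> \<circ> sh \<tau>')))"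
    by (intro sum.cong refl summand) simp
  also have "\<dots> = (\<Sum>\<tau>\<in>?P k. \<Sum>\<sigma>\<in>?P (k + l). \<Sum>\<tau>'\<in>?P l. ?f (\<sigma> \<circ> (\<tau> \<circ> sh \<tau>')))"
    by (rule sum.swap)
  also have "\<dots> = (\<Sum>\<tau>\<in>?P k. \<Sum>\<tau>'\<in>?P l. \<Sum>\<sigma>\<in>?P (k + l). ?f (\<sigma> \<circ> (\<tau> \<circ> sh \<tau>')))"
    by (rule sum.cong[OF refl], rule sum.swap)
  also have "\<dots> = (\<Sum>\<tau>\<in>?P k. \<Sum>\<tau>'\<in>?P l. alt_form (xs @ ys) v)"
  proof (intro sum.cong refl)
    fix \<tau> \<tau>' assume "\<tau> \<in> ?P k" "\<tau>' \<in> ?P l"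
    then have "\<tau> \<circ> sh \<tau>' permutes {..<k + l}"
      using sh(5) permutes_lessThan_mono by (auto intro: permutes_compose)
    from sum_permutations_compose_right[OF this, of ?f]
    show "(\<Sum>\<sigma>\<in>?P (k + l). ?f (\<sigma> \<circ> (\<tau> \<circ> sh \<tau>'))) = alt_form (xs @ ys) v"
      by (simp add: alt_form_def k_def l_def)
  qed
  also have "\<dots> = fact k * fact l * alt_form (xs @ ys) v"
    by (simp add: card_permutations)
  finally show ?thesis unfolding k_def l_def .
qed

lemma wedge_alt_form:
  assumes "length xs = k" "length ys = l"
  shows "wedge k l (\<lambda>w. alt_form xs w *\<^sub>R a) (\<lambda>w. alt_form ys w *\<^sub>R b) = (\<lambda>v. alt_form (xs @ ys) v *\<^sub>R (a \<bullet>\<^sub>H b))"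
proof
  fix v
  have "wedge k l (\<lambda>w. alt_form xs w *\<^sub>R a) (\<lambda>w. alt_form ys w *\<^sub>R b) v
    = (1 / (fact k * fact l)) *\<^sub>R ((\<Sum>\<sigma> | \<sigma> permutes {..<length xs + length ys}.
      of_int (sign \<sigma>) * (alt_form xs (\<lambda>i. v (\<sigma> i)) * alt_form ys (\<lambda>i. v (\<sigma> (length xs + i))))) *\<^sub>R (a \<bullet>\<^sub>H b))"
    unfolding wedge_def assms qmult.scaleR_left qmult.scaleR_right scaleR_scaleR scaleR_sum_left by (simp add: mult_ac)
  also have "\<dots> = alt_form (xs @ ys) v *\<^sub>R (a \<bullet>\<^sub>H b)"
    unfolding alt_form_append by (simp add: assms)
  finally show "wedge k l (\<lambda>w. alt_form xs w *\<^sub>R a) (\<lambda>w. alt_form ys w *\<^sub>R b) v = alt_form (xs @ ys) v *\<^sub>R (a \<bullet>\<^sub>H b)" .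
qed

lemma wedge_sum_left: "wedge k l (\<lambda>w. \<Sum>i\<in>I. A i w) b = (\<lambda>v. \<Sum>i\<in>I. wedge k l (A i) b v)"
  unfolding wedge_def qmult.sum_left scaleR_sum_right by (rule ext) (rule sum.swap)

lemma wedge_sum_right: "wedge k l a (\<lambda>w. \<Sum>i\<in>I. B i w) = (\<lambda>v. \<Sum>i\<in>I. wedge k l a (B i) v)"
  unfolding wedge_def qmult.sum_right scaleR_sum_right by (rule ext) (rule sum.swap)

lemma wedge_add_left: "wedge k l (\<lambda>w. A w + B w) c = (\<lambda>v. wedge k l A c v + wedge k l B c v)"
  by (simp add: wedge_def qmult.add_left scaleR_add_right sum.distrib)

lemma wedge_add_right: "wedge k l a (\<lambda>w. B w + C w) = (\<lambda>v. wedge k l a B v + wedge k l a C v)"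
  by (simp add: wedge_def qmult.add_right scaleR_add_right sum.distrib)

lemma wedge_scaleR_left: "wedge k l (\<lambda>w. c *\<^sub>R A w) b = (\<lambda>v. c *\<^sub>R wedge k l A b v)"
  unfolding wedge_def qmult.scaleR_left scaleR_left_commute[of _ c] scaleR_sum_right ..

lemma alt_form_single: "alt_form [e] v = v 0 \<bullet> e"
proof -
  have "{\<sigma>. \<sigma> permutes {..<Suc 0}} = {id}" by (simp add: lessThan_Suc permutes_sing)
  then show ?thesis by (simp add: alt_form_def)
qed

text \<open>Evaluating on \<open>n # v\<close> with \<open>v\<close> orthogonal to \<open>n\<close> turns a 7-form identity into an 8-form identity.\<close>

lemma alt_form_Cons_orthogonal:
  assumes orth: "\<And>i. i < length es \<Longrightarrow> v i \<bullet> n = 0"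
  shows "alt_form (n # es) (case_nat n v) = (n \<bullet> n) * alt_form es v"
proof -
  define m where "m = length es"
  let ?w = "case_nat n v"
  let ?f = "\<lambda>\<sigma>. of_int (sign \<sigma>) * (\<Prod>i<Suc m. ?w (\<sigma> i) \<bullet> (n # es) ! i)"
  have ins: "{..<Suc m} = insert 0 {1..m}" by auto
  let ?up = "map_permutation {..<m} Suc"
  have bijS: "bij_betw Suc {..<m} {1..m}" by (rule bij_betwI[where g = "\<lambda>i. i - 1"]) auto
  have bijP: "bij_betw (\<lambda>i. i - 1) {1..m} {..<m}" by (rule bij_betwI[where g = Suc]) auto
  have bij: "bij_betw ?up {\<tau>. \<tau> permutes {..<m}} {\<tau>. \<tau> permutes {1..m}}"
  proof (rule bij_betwI[where g = "map_permutation {1..m} (\<lambda>i. i - 1)"])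
    show "?up \<in> {\<tau>. \<tau> permutes {..<m}} \<rightarrow> {\<tau>. \<tau> permutes {1..m}}"
      using map_permutation_permutes[OF bijS] by auto
    show "map_permutation {1..m} (\<lambda>i. i - 1) \<in> {\<tau>. \<tau> permutes {1..m}} \<rightarrow> {\<tau>. \<tau> permutes {..<m}}"
      using map_permutation_permutes[OF bijP] by auto
    show "map_permutation {1..m} (\<lambda>i. i - 1) (?up \<tau>) = \<tau>" if "\<tau> \<in> {\<tau>. \<tau> permutes {..<m}}" for \<tau>
      using that by (intro map_permutation_compose_inv[OF bijS]) auto
    show "?up (map_permutation {1..m} (\<lambda>i. i - 1) \<tau>) = \<tau>" if "\<tau> \<in> {\<tau>. \<tau> permutes {1..m}}" for \<tau>
      using that by (intro map_permutation_compose_inv[OF bijP]) auto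
  qed
  \<comment> \<open>These permutations send 0 to b > 0, so the product contains the pairing of some
    v i with n.\<close>
  have zero: "?f (Transposition.transpose 0 b \<circ> q) = 0" if b: "b \<in> {1..m}" and q: "q permutes {1..m}" for b q
  proof -
    have "q 0 = 0" by (rule permutes_not_in[OF q]) simp
    moreover obtain b' where "b = Suc b'" "b' < m" using b by (cases b) auto
    ultimately have "?w ((Transposition.transpose 0 b \<circ> q) 0) \<bullet> (n # es) ! 0 = 0"
      using orth[of b'] by (simp add: m_def)
    then show ?thesis by (metis (no_types, lifting) finite_lessThan lessThan_iff mult_zero_right prod_zero zero_less_Suc)
  qed
  have up: "?f (?up \<tau>) = (n \<bullet> n) * (of_int (sign \<tau>) * (\<Prod>i<m. v (\<tau> i) \<bullet> es ! i))" if \<tau>: "\<tau> permutes {..<m}" for \<tau>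
  proof -
    have s: "sign (?up \<tau>) = sign \<tau>" by (rule sign_map_permutation) (auto intro: \<tau>)
    have "?up \<tau> permutes {1..m}" by (rule map_permutation_permutes[OF bijS \<tau>])
    then have 0: "?up \<tau> 0 = 0" by (rule permutes_not_in) simp
    have a: "?up \<tau> (Suc i) = Suc (\<tau> i)" if "i < m" for i by (rule map_permutation_apply) (use that in auto)
    show ?thesis
      unfolding s prod.lessThan_Suc_shift by (simp add: 0 a)
  qed
  have "alt_form (n # es) ?w = sum ?f {\<sigma>. \<sigma> permutes insert 0 {1..m}}"
    unfolding alt_form_def ins[symmetric] by (simp add: m_def)
  also have "\<dots> = (\<Sum>b\<in>insert 0 {1..m}. \<Sum>q | q permutes {1..m}. ?f (Transposition.transpose 0 b \<circ> q))"
    by (rule sum_over_permutations_insert) auto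
  also have "\<dots> = (\<Sum>q | q permutes {1..m}. ?f q) + (\<Sum>b\<in>{1..m}. \<Sum>q | q permutes {1..m}. ?f (Transposition.transpose 0 b \<circ> q))"
    by (subst sum.insert) simp_all
  also have "(\<Sum>b\<in>{1..m}. \<Sum>q | q permutes {1..m}. ?f (Transposition.transpose 0 b \<circ> q)) = 0"
    by (intro sum.neutral ballI) (use zero in simp)
  also have "(\<Sum>q | q permutes {1..m}. ?f q) = (\<Sum>\<tau> | \<tau> permutes {..<m}. ?f (?up \<tau>))"
    by (rule sum.reindex_bij_betw[OF bij, symmetric])
  also have "\<dots> = (\<Sum>\<tau> | \<tau> permutes {..<m}. (n \<bullet> n) * (of_int (sign \<tau>) * (\<Prod>i<m. v (\<tau> i) \<bullet> es ! i)))"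
    by (intro sum.cong refl up) simp
  also have "\<dots> = (n \<bullet> n) * alt_form es v"
    by (simp add: alt_form_def m_def sum_distrib_left)
  finally show ?thesis by simp
qed

lemma alt_form_head_sum:
  "alt_form ((\<Sum>i\<in>I. c i *\<^sub>R e i) # es) v = (\<Sum>i\<in>I. c i * alt_form (e i # es) v)"
proof -
  have *: "alt_form (x # es) v = (\<Sum>\<sigma> | \<sigma> permutes {..<Suc (length es)}.
      of_int (sign \<sigma>) * ((v (\<sigma> 0) \<bullet> x) * (\<Prod>i<length es. v (\<sigma> (Suc i)) \<bullet> es ! i)))" for x
    unfolding alt_form_def by (simp add: prod.lessThan_Suc_shift del: prod.lessThan_Suc)
  show ?thesis
    unfolding * inner_sum_right inner_scaleR_right sum_distrib_right sum_distrib_left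
    by (subst sum.swap) (intro sum.cong refl, simp add: mult_ac)
qed

lemma alt_form_dual:
  assumes "\<And>i k. i < length es \<Longrightarrow> k < length es \<Longrightarrow> v k \<bullet> es ! i = (if i = k then 1 else 0)"
  shows "alt_form es v = 1"
proof -
  let ?n = "length es"
  have "of_int (sign \<sigma>) * (\<Prod>i<?n. v (\<sigma> i) \<bullet> es ! i) = 0" if \<sigma>: "\<sigma> permutes {..<?n}" "\<sigma> \<noteq> id" for \<sigma>
  proof -
    obtain i where i: "\<sigma> i \<noteq> i" using \<sigma>(2) by (auto simp: fun_eq_iff)
    then have "i < ?n" using permutes_not_in[OF \<sigma>(1)] by (metis lessThan_iff)
    moreover have "\<sigma> i < ?n" using permutes_in_image[OF \<sigma>(1)] \<open>i < ?n\<close> by (metis lessThan_iff)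
    ultimately have "v (\<sigma> i) \<bullet> es ! i = 0" using assms[of i "\<sigma> i"] i by simp
    then have "(\<Prod>i<?n. v (\<sigma> i) \<bullet> es ! i) = 0" using \<open>i < ?n\<close> by (intro prod_zero) auto
    then show ?thesis by simp
  qed
  then have "alt_form es v = (\<Sum>\<sigma>\<in>{id}. of_int (sign \<sigma>) * (\<Prod>i<?n. v (\<sigma> i) \<bullet> es ! i))"
    unfolding alt_form_def by (intro sum.mono_neutral_right) (auto simp: permutes_id finite_permutations)
  also have "\<dots> = 1" using assms by simp
  finally show ?thesis .
qed

section \<open>The forms in the definition of \<open>f_perp\<close> in coordinates\<close>

lemma inner_ddx [simp]: "w \<bullet> ddx \<alpha> = fst w $ \<alpha>"
  by (cases w) (simp add: ddx_def inner_axis)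

lemma inner_ddy [simp]: "w \<bullet> ddy \<alpha> = snd w $ \<alpha>"
  by (cases w) (simp add: ddy_def inner_axis)

lemma Basis_quat2: "(Basis :: quat2 set) = range ddx \<union> range ddy"
  by (auto simp: Basis_prod_def Basis_vec_def ddx_def ddy_def)

lemma inj_ddx: "inj ddx" and inj_ddy: "inj ddy"
  by (auto simp: inj_def ddx_def ddy_def axis_eq_axis)

lemma ddx_neq_ddy [simp]: "ddx \<alpha> \<noteq> ddy \<beta>" "ddy \<beta> \<noteq> ddx \<alpha>"
  by (auto simp: ddx_def ddy_def axis_eq_0_iff)

lemma ddx_eq_iff [simp]: "ddx \<alpha> = ddx \<beta> \<longleftrightarrow> \<alpha> = \<beta>" and ddy_eq_iff [simp]: "ddy \<alpha> = ddy \<beta> \<longleftrightarrow> \<alpha> = \<beta>"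
  using inj_ddx inj_ddy by (auto simp: inj_def)

lemma sum_Basis_quat2: "(\<Sum>b\<in>Basis. g b) = (\<Sum>\<alpha>\<in>UNIV. g (ddx \<alpha>)) + (\<Sum>\<alpha>\<in>UNIV. g (ddy \<alpha>))"
proof -
  have "(\<Sum>b\<in>Basis. g b) = (\<Sum>b\<in>range ddx. g b) + (\<Sum>b\<in>range ddy. g b)"
    unfolding Basis_quat2 by (rule sum.union_disjoint) auto
  then show ?thesis by (simp add: sum.reindex inj_ddx inj_ddy)
qed

lemma quat2_representation: "v = (\<Sum>\<alpha>\<in>UNIV. (fst v $ \<alpha>) *\<^sub>R ddx \<alpha>) + (\<Sum>\<alpha>\<in>UNIV. (snd v $ \<alpha>) *\<^sub>R ddy \<alpha>)"
  using euclidean_representation[of v] by (simp add: sum_Basis_quat2)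

abbreviation "xs_frame \<equiv> [ddx 0, ddx 1, ddx 2, ddx 3]"
abbreviation "ys_frame \<equiv> [ddy 0, ddy 1, ddy 2, ddy 3]"

lemma qmult_one [simp]: "axis 0 1 \<bullet>\<^sub>H q = q" "q \<bullet>\<^sub>H axis 0 1 = q"
  by (simp_all add: quat_eq_iff axis_def)

lemma dx_coord_eq: "dx_coord \<alpha> = (\<lambda>w. alt_form [ddx \<alpha>] w *\<^sub>R axis 0 1)"
  and dy_coord_eq: "dy_coord \<alpha> = (\<lambda>w. alt_form [ddy \<alpha>] w *\<^sub>R axis 0 1)"
  by (auto simp: fun_eq_iff dx_coord_def dy_coord_def one_form_def quat_of_real_def vec_eq_iff axis_def alt_form_single)

lemma dx_eq: "dx = (\<lambda>w. alt_form xs_frame w *\<^sub>R axis 0 1)"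
  by (simp add: dx_def dx_coord_eq wedge_alt_form)

lemma dy_eq: "dy = (\<lambda>w. alt_form ys_frame w *\<^sub>R axis 0 1)"
  by (simp add: dy_def dy_coord_eq wedge_alt_form)

lemma volume_form_eq: "wedge 4 4 dx dy = (\<lambda>w. alt_form (xs_frame @ ys_frame) w *\<^sub>R axis 0 1)"
  unfolding dx_eq dy_eq by (subst wedge_alt_form) simp_all

lemma quat_representation: "q = (\<Sum>\<alpha>\<in>UNIV. (q $ \<alpha>) *\<^sub>R axis \<alpha> 1)" for q :: quat
  by (simp add: quat_eq_iff sum_quat axis_def)

lemma qcnj_representation: "qcnj q = (\<Sum>\<alpha>\<in>UNIV. (q $ \<alpha>) *\<^sub>R qcnj (axis \<alpha> 1))"
  by (simp add: quat_eq_iff sum_quat axis_def)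

lemma dq_eq:
  "dq1 = (\<lambda>w. \<Sum>\<alpha>\<in>UNIV. alt_form [ddx \<alpha>] w *\<^sub>R axis \<alpha> 1)"
  "dq2 = (\<lambda>w. \<Sum>\<alpha>\<in>UNIV. alt_form [ddy \<alpha>] w *\<^sub>R axis \<alpha> 1)"
  "dq1_bar = (\<lambda>w. \<Sum>\<alpha>\<in>UNIV. alt_form [ddx \<alpha>] w *\<^sub>R qcnj (axis \<alpha> 1))"
  "dq2_bar = (\<lambda>w. \<Sum>\<alpha>\<in>UNIV. alt_form [ddy \<alpha>] w *\<^sub>R qcnj (axis \<alpha> 1))"
  unfolding dq1_def dq2_def dq1_bar_def dq2_bar_def one_form_def
  by (simp_all add: alt_form_single flip: quat_representation qcnj_representation)

abbreviation "qcoef \<alpha> \<beta> \<equiv> qcnj (axis \<alpha> 1) \<bullet>\<^sub>H axis \<beta> 1"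

lemma dq_bar_wedge_dq:
  "wedge 1 1 dq1_bar dq1 = (\<lambda>w. \<Sum>\<alpha>\<in>UNIV. \<Sum>\<beta>\<in>UNIV. alt_form [ddx \<alpha>, ddx \<beta>] w *\<^sub>R qcoef \<alpha> \<beta>)"
  "wedge 1 1 dq2_bar dq2 = (\<lambda>w. \<Sum>\<alpha>\<in>UNIV. \<Sum>\<beta>\<in>UNIV. alt_form [ddy \<alpha>, ddy \<beta>] w *\<^sub>R qcoef \<alpha> \<beta>)"
  unfolding dq_eq wedge_sum_left wedge_sum_right by (simp_all add: wedge_alt_form)

lemma one_form_linear:
  assumes "linear L"
  shows "one_form L = (\<lambda>w. (\<Sum>\<gamma>\<in>UNIV. alt_form [ddx \<gamma>] w *\<^sub>R L (ddx \<gamma>)) + (\<Sum>\<gamma>\<in>UNIV. alt_form [ddy \<gamma>] w *\<^sub>R L (ddy \<gamma>)))"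
proof
  fix w :: "nat \<Rightarrow> quat2"
  have "L (w 0) = L ((\<Sum>\<alpha>\<in>UNIV. (fst (w 0) $ \<alpha>) *\<^sub>R ddx \<alpha>) + (\<Sum>\<alpha>\<in>UNIV. (snd (w 0) $ \<alpha>) *\<^sub>R ddy \<alpha>))"
    by (subst quat2_representation) simp
  then show "one_form L w = (\<Sum>\<gamma>\<in>UNIV. alt_form [ddx \<gamma>] w *\<^sub>R L (ddx \<gamma>)) + (\<Sum>\<gamma>\<in>UNIV. alt_form [ddy \<gamma>] w *\<^sub>R L (ddy \<gamma>))"
    unfolding one_form_def by (simp add: alt_form_single linear_add[OF assms] linear_sum[OF assms] linear_cmul[OF assms])
qed

text \<open>Here the Cauchy-Riemann equation enters \<open>f_perp\<close>. For \<delta> = 0 the sum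
  is -2 A_0123 (i l_1 + j l_2 + k l_3), which the equation turns into 2 A_0123 l_0; the other
  \<delta> behave alike.\<close>

lemma alternating_quat_sum:
  fixes A :: "4 \<Rightarrow> 4 \<Rightarrow> 4 \<Rightarrow> 4 \<Rightarrow> real" and l :: "4 \<Rightarrow> quat"
  assumes s1: "\<And>a b c d. A a b c d = - A b a c d" and s2: "\<And>a b c d. A a b c d = - A a c b d"
    and s3: "\<And>a b c d. A a b c d = - A a b d c"
    and l: "(\<Sum>\<alpha>\<in>UNIV. axis \<alpha> 1 \<bullet>\<^sub>H l \<alpha>) = 0"
  shows "(\<Sum>\<alpha>\<in>UNIV. \<Sum>\<beta>\<in>UNIV. \<Sum>\<gamma>\<in>UNIV. A \<delta> \<alpha> \<beta> \<gamma> *\<^sub>R (qcoef \<alpha> \<beta> \<bullet>\<^sub>H l \<gamma>)) = (2 * A 0 1 2 3) *\<^sub>R l \<delta>"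
proof -
  have z: "A a a c d = 0" "A a b b d = 0" "A a b c c = 0" for a b c d
    using s1[of a a c d] s2[of a b b d] s3[of a b c c] by simp_all
  have z': "A a b a d = 0" "A a b c b = 0" "A a b c a = 0" for a b c d
    using s2[of a b a d] s3[of a b c b] s3[of a b c a] s2[of a b a c] z by simp_all
  \<comment> \<open>Instances oriented so that rewriting sorts the indices into increasing order and
    collects the signs.\<close>
  note ord = s1[of 1 0] s1[of 2 0] s1[of 3 0] s1[of 2 1] s1[of 3 1] s1[of 3 2]
    s2[of _ 1 0] s2[of _ 2 0] s2[of _ 3 0] s2[of _ 2 1] s2[of _ 3 1] s2[of _ 3 2]
    s3[of _ _ 1 0] s3[of _ _ 2 0] s3[of _ _ 3 0] s3[of _ _ 2 1] s3[of _ _ 3 1] s3[of _ _ 3 2]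
  have q: "qcoef 0 1 = axis 1 1" "qcoef 1 0 = - axis 1 1" "qcoef 0 2 = axis 2 1" "qcoef 2 0 = - axis 2 1"
    "qcoef 0 3 = axis 3 1" "qcoef 3 0 = - axis 3 1" "qcoef 1 2 = - axis 3 1" "qcoef 2 1 = axis 3 1"
    "qcoef 2 3 = - axis 1 1" "qcoef 3 2 = axis 1 1" "qcoef 3 1 = - axis 2 1" "qcoef 1 3 = axis 2 1"
    by (simp_all add: quat_eq_iff axis_def)
  have l0: "l 0 = - (axis 1 1 \<bullet>\<^sub>H l 1 + axis 2 1 \<bullet>\<^sub>H l 2 + axis 3 1 \<bullet>\<^sub>H l 3)"
    using l[unfolded sum_quat qmult_one(1)] by (simp only: eq_neg_iff_add_eq_0 add.assoc)
  have "\<forall>\<delta>. (\<Sum>\<alpha>\<in>UNIV. \<Sum>\<beta>\<in>UNIV. \<Sum>\<gamma>\<in>UNIV. A \<delta> \<alpha> \<beta> \<gamma> *\<^sub>R (qcoef \<alpha> \<beta> \<bullet>\<^sub>H l \<gamma>)) = (2 * A 0 1 2 3) *\<^sub>R l \<delta>"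
    unfolding forall_quat sum_quat
    by (simp add: z z' ord q) (simp add: l0 quat_eq_iff axis_def algebra_simps)
  then show ?thesis by blast
qed

lemma alt_form_repeated: "x \<in> set es \<Longrightarrow> alt_form (x # es) w = 0"
  by (rule alt_form_not_distinct) simp

text \<open>Prepending \<nu> turns the seven-forms on v into multiples of one volume V. The first
  summand yields 2 V times the value of L on the q1-part of \<nu>, the second that on the q2-part;
  the factor -1/2 leaves -V L \<nu>.\<close>

lemma normal_form_wedge:
  fixes L :: "quat2 \<Rightarrow> quat"
  assumes lin: "linear L" and \<nu>: "norm \<nu> = 1"
    and dbar: "(\<Sum>\<alpha>\<in>UNIV. axis \<alpha> 1 \<bullet>\<^sub>H L (ddx \<alpha>)) = 0" "(\<Sum>\<alpha>\<in>UNIV. axis \<alpha> 1 \<bullet>\<^sub>H L (ddy \<alpha>)) = 0"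
    and v: "\<And>i. i < 7 \<Longrightarrow> v i \<bullet> \<nu> = 0"
  shows "wedge 6 1 (\<lambda>w. - (1 / 2) *\<^sub>R (wedge 2 4 (wedge 1 1 dq1_bar dq1) dy w + wedge 4 2 dx (wedge 1 1 dq2_bar dq2) w))
       (one_form L) v = - alt_form (xs_frame @ ys_frame) (case_nat \<nu> v) *\<^sub>R L \<nu>"
proof -
  define w where "w = case_nat \<nu> v"
  define V where "V = alt_form (xs_frame @ ys_frame) w"
  have ext: "alt_form J v = (\<Sum>\<delta>\<in>UNIV. fst \<nu> $ \<delta> * alt_form (ddx \<delta> # J) w) + (\<Sum>\<delta>\<in>UNIV. snd \<nu> $ \<delta> * alt_form (ddy \<delta> # J) w)"
    if "length J = 7" for J
  proof -
    have "alt_form J v = alt_form (\<nu> # J) w"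
      unfolding w_def using \<nu> by (subst alt_form_Cons_orthogonal) (auto simp: that v norm_eq_1)
    also have "\<nu> = (\<Sum>b\<in>Basis. (\<nu> \<bullet> b) *\<^sub>R b)" by (rule euclidean_representation[symmetric])
    also have "alt_form ((\<Sum>b\<in>Basis. (\<nu> \<bullet> b) *\<^sub>R b) # J) w = (\<Sum>b\<in>Basis. (\<nu> \<bullet> b) * alt_form (b # J) w)"
      by (rule alt_form_head_sum)
    finally show ?thesis unfolding sum_Basis_quat2 by simp
  qed
  have ymem: "ddy \<gamma> \<in> {ddy 0, ddy 1, ddy 2, ddy 3}" and xmem: "ddx \<gamma> \<in> {ddx 0, ddx 1, ddx 2, ddx 3}" for \<gamma>
    using UNIV_quat by auto
  define A where "A a b c d = alt_form ([ddx a, ddx b, ddx c, ddx d] @ ys_frame) w" for a b c d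
  define A' where "A' a b c d = alt_form (xs_frame @ [ddy a, ddy b, ddy c, ddy d]) w" for a b c d
  have A_alt: "A a b c d = - A b a c d" "A a b c d = - A a c b d" "A a b c d = - A a b d c" for a b c d
    unfolding A_def
    using alt_form_swap[of "[]" "ddx a" "ddx b" "[ddx c, ddx d] @ ys_frame" w]
      alt_form_swap[of "[ddx a]" "ddx b" "ddx c" "[ddx d] @ ys_frame" w]
      alt_form_swap[of "[ddx a, ddx b]" "ddx c" "ddx d" "ys_frame" w] by simp_all
  have A'_alt: "A' a b c d = - A' b a c d" "A' a b c d = - A' a c b d" "A' a b c d = - A' a b d c" for a b c d
    unfolding A'_def
    using alt_form_swap[of "xs_frame" "ddy a" "ddy b" "[ddy c, ddy d]" w]
      alt_form_swap[of "xs_frame @ [ddy a]" "ddy b" "ddy c" "[ddy d]" w]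
      alt_form_swap[of "xs_frame @ [ddy a, ddy b]" "ddy c" "ddy d" "[]" w] by simp_all
  have nd: "alt_form es w = 0" if "\<not> distinct es" for es using alt_form_not_distinct[OF that] .
  \<comment> \<open>Only the q1-part of \<nu> counts, all \<open>ddy\<close> being used up; moving
    \<open>ddx \<gamma>\<close> past the four of them does not change the sign.\<close>
  have x1: "alt_form ([ddx \<alpha>, ddx \<beta>] @ ys_frame @ [ddx \<gamma>]) v = (\<Sum>\<delta>\<in>UNIV. fst \<nu> $ \<delta> * A \<delta> \<alpha> \<beta> \<gamma>)" for \<alpha> \<beta> \<gamma>
  proof -
    have "alt_form (ddy \<delta> # [ddx \<alpha>, ddx \<beta>] @ ys_frame @ [ddx \<gamma>]) w = 0" for \<delta>
      by (rule nd) (use ymem[of \<delta>] in auto)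
    moreover have "alt_form (ddx \<delta> # [ddx \<alpha>, ddx \<beta>] @ ys_frame @ [ddx \<gamma>]) w = A \<delta> \<alpha> \<beta> \<gamma>" for \<delta>
      using alt_form_move[of "[ddx \<delta>, ddx \<alpha>, ddx \<beta>]" "ddx \<gamma>" ys_frame "[]" w] by (simp add: A_def)
    ultimately show ?thesis by (subst ext) simp_all
  qed
  have x2: "alt_form ([ddx \<alpha>, ddx \<beta>] @ ys_frame @ [ddy \<gamma>]) v = 0" for \<alpha> \<beta> \<gamma>
    by (rule alt_form_not_distinct) (use ymem[of \<gamma>] in auto)
  have y1: "alt_form (xs_frame @ [ddy \<alpha>, ddy \<beta>] @ [ddy \<gamma>]) v = (\<Sum>\<delta>\<in>UNIV. snd \<nu> $ \<delta> * A' \<delta> \<alpha> \<beta> \<gamma>)" for \<alpha> \<beta> \<gamma>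
  proof -
    have "alt_form (ddx \<delta> # xs_frame @ [ddy \<alpha>, ddy \<beta>] @ [ddy \<gamma>]) w = 0" for \<delta>
      by (rule nd) (use xmem[of \<delta>] in auto)
    moreover have "alt_form (ddy \<delta> # xs_frame @ [ddy \<alpha>, ddy \<beta>] @ [ddy \<gamma>]) w = A' \<delta> \<alpha> \<beta> \<gamma>" for \<delta>
      using alt_form_move[of "[]" "ddy \<delta>" xs_frame "[ddy \<alpha>, ddy \<beta>, ddy \<gamma>]" w] by (simp add: A'_def)
    ultimately show ?thesis by (subst ext) simp_all
  qed
  have y2: "alt_form (xs_frame @ [ddy \<alpha>, ddy \<beta>] @ [ddx \<gamma>]) v = 0" for \<alpha> \<beta> \<gamma>
    by (rule alt_form_not_distinct) (use xmem[of \<gamma>] in auto)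
  have AV: "A 0 1 2 3 = V" "A' 0 1 2 3 = V" by (simp_all add: A_def A'_def V_def)
  have factor: "(\<Sum>\<alpha>\<in>UNIV. \<Sum>\<beta>\<in>UNIV. \<Sum>\<gamma>\<in>UNIV. (\<Sum>\<delta>\<in>UNIV. c $ \<delta> * B \<delta> \<alpha> \<beta> \<gamma>) *\<^sub>R q \<alpha> \<beta> \<gamma>)
     = (\<Sum>\<delta>\<in>UNIV. c $ \<delta> *\<^sub>R (\<Sum>\<alpha>\<in>UNIV. \<Sum>\<beta>\<in>UNIV. \<Sum>\<gamma>\<in>UNIV. B \<delta> \<alpha> \<beta> \<gamma> *\<^sub>R q \<alpha> \<beta> \<gamma>))"
    for c :: quat and B :: "4 \<Rightarrow> 4 \<Rightarrow> 4 \<Rightarrow> 4 \<Rightarrow> real" and q :: "4 \<Rightarrow> 4 \<Rightarrow> 4 \<Rightarrow> quat"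
  proof -
    have "(\<Sum>\<alpha>\<in>UNIV. \<Sum>\<beta>\<in>UNIV. \<Sum>\<gamma>\<in>UNIV. (\<Sum>\<delta>\<in>UNIV. c $ \<delta> * B \<delta> \<alpha> \<beta> \<gamma>) *\<^sub>R q \<alpha> \<beta> \<gamma>)
      = (\<Sum>\<alpha>\<in>UNIV. \<Sum>\<beta>\<in>UNIV. \<Sum>\<gamma>\<in>UNIV. \<Sum>\<delta>\<in>UNIV. c $ \<delta> *\<^sub>R (B \<delta> \<alpha> \<beta> \<gamma> *\<^sub>R q \<alpha> \<beta> \<gamma>))"
      by (simp add: scaleR_sum_left)
    also have "\<dots> = (\<Sum>\<alpha>\<in>UNIV. \<Sum>\<beta>\<in>UNIV. \<Sum>\<delta>\<in>UNIV. \<Sum>\<gamma>\<in>UNIV. c $ \<delta> *\<^sub>R (B \<delta> \<alpha> \<beta> \<gamma> *\<^sub>R q \<alpha> \<beta> \<gamma>))"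
      by (intro sum.cong refl sum.swap)
    also have "\<dots> = (\<Sum>\<alpha>\<in>UNIV. \<Sum>\<delta>\<in>UNIV. \<Sum>\<beta>\<in>UNIV. \<Sum>\<gamma>\<in>UNIV. c $ \<delta> *\<^sub>R (B \<delta> \<alpha> \<beta> \<gamma> *\<^sub>R q \<alpha> \<beta> \<gamma>))"
      by (intro sum.cong refl sum.swap)
    also have "\<dots> = (\<Sum>\<delta>\<in>UNIV. \<Sum>\<alpha>\<in>UNIV. \<Sum>\<beta>\<in>UNIV. \<Sum>\<gamma>\<in>UNIV. c $ \<delta> *\<^sub>R (B \<delta> \<alpha> \<beta> \<gamma> *\<^sub>R q \<alpha> \<beta> \<gamma>))"
      by (rule sum.swap)
    finally show ?thesis by (simp only: scaleR_sum_right)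
  qed
  have X: "wedge 6 1 (wedge 2 4 (wedge 1 1 dq1_bar dq1) dy) (one_form L) v = (2 * V) *\<^sub>R (\<Sum>\<delta>\<in>UNIV. fst \<nu> $ \<delta> *\<^sub>R L (ddx \<delta>))"
  proof -
    have "wedge 2 4 (wedge 1 1 dq1_bar dq1) dy
      = (\<lambda>w. \<Sum>\<alpha>\<in>UNIV. \<Sum>\<beta>\<in>UNIV. alt_form ([ddx \<alpha>, ddx \<beta>] @ ys_frame) w *\<^sub>R qcoef \<alpha> \<beta>)"
      unfolding dq_bar_wedge_dq dy_eq wedge_sum_left by (simp add: wedge_alt_form)
    then have "wedge 6 1 (wedge 2 4 (wedge 1 1 dq1_bar dq1) dy) (one_form L) v
      = (\<Sum>\<alpha>\<in>UNIV. \<Sum>\<beta>\<in>UNIV.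
          (\<Sum>\<gamma>\<in>UNIV. alt_form ([ddx \<alpha>, ddx \<beta>] @ ys_frame @ [ddx \<gamma>]) v *\<^sub>R (qcoef \<alpha> \<beta> \<bullet>\<^sub>H L (ddx \<gamma>)))
        + (\<Sum>\<gamma>\<in>UNIV. alt_form ([ddx \<alpha>, ddx \<beta>] @ ys_frame @ [ddy \<gamma>]) v *\<^sub>R (qcoef \<alpha> \<beta> \<bullet>\<^sub>H L (ddy \<gamma>))))"
      unfolding one_form_linear[OF lin] by (simp add: wedge_sum_left wedge_add_right wedge_sum_right wedge_alt_form)
    also have "\<dots> = (\<Sum>\<delta>\<in>UNIV. fst \<nu> $ \<delta> *\<^sub>R (\<Sum>\<alpha>\<in>UNIV. \<Sum>\<beta>\<in>UNIV. \<Sum>\<gamma>\<in>UNIV. A \<delta> \<alpha> \<beta> \<gamma> *\<^sub>R (qcoef \<alpha> \<beta> \<bullet>\<^sub>H L (ddx \<gamma>))))"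
      unfolding x1 x2 by (simp only: scaleR_zero_left sum.neutral_const add_0_right factor)
    also have "\<dots> = (\<Sum>\<delta>\<in>UNIV. fst \<nu> $ \<delta> *\<^sub>R ((2 * V) *\<^sub>R L (ddx \<delta>)))"
      unfolding alternating_quat_sum[of A "\<lambda>\<gamma>. L (ddx \<gamma>)", OF A_alt dbar(1)] AV ..
    finally show ?thesis by (simp add: scaleR_sum_right mult.commute)
  qed
  have Y: "wedge 6 1 (wedge 4 2 dx (wedge 1 1 dq2_bar dq2)) (one_form L) v = (2 * V) *\<^sub>R (\<Sum>\<delta>\<in>UNIV. snd \<nu> $ \<delta> *\<^sub>R L (ddy \<delta>))"
  proof -
    have "wedge 4 2 dx (wedge 1 1 dq2_bar dq2)
      = (\<lambda>w. \<Sum>\<alpha>\<in>UNIV. \<Sum>\<beta>\<in>UNIV. alt_form (xs_frame @ [ddy \<alpha>, ddy \<beta>]) w *\<^sub>R qcoef \<alpha> \<beta>)"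
      unfolding dq_bar_wedge_dq dx_eq wedge_sum_right by (simp add: wedge_alt_form)
    then have "wedge 6 1 (wedge 4 2 dx (wedge 1 1 dq2_bar dq2)) (one_form L) v
      = (\<Sum>\<alpha>\<in>UNIV. \<Sum>\<beta>\<in>UNIV.
          (\<Sum>\<gamma>\<in>UNIV. alt_form (xs_frame @ [ddy \<alpha>, ddy \<beta>] @ [ddx \<gamma>]) v *\<^sub>R (qcoef \<alpha> \<beta> \<bullet>\<^sub>H L (ddx \<gamma>)))
        + (\<Sum>\<gamma>\<in>UNIV. alt_form (xs_frame @ [ddy \<alpha>, ddy \<beta>] @ [ddy \<gamma>]) v *\<^sub>R (qcoef \<alpha> \<beta> \<bullet>\<^sub>H L (ddy \<gamma>))))"
      unfolding one_form_linear[OF lin] by (simp add: wedge_sum_left wedge_add_right wedge_sum_right wedge_alt_form)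
    also have "\<dots> = (\<Sum>\<delta>\<in>UNIV. snd \<nu> $ \<delta> *\<^sub>R (\<Sum>\<alpha>\<in>UNIV. \<Sum>\<beta>\<in>UNIV. \<Sum>\<gamma>\<in>UNIV. A' \<delta> \<alpha> \<beta> \<gamma> *\<^sub>R (qcoef \<alpha> \<beta> \<bullet>\<^sub>H L (ddy \<gamma>))))"
      unfolding y1 y2 by (simp only: scaleR_zero_left sum.neutral_const add_0_left factor)
    also have "\<dots> = (\<Sum>\<delta>\<in>UNIV. snd \<nu> $ \<delta> *\<^sub>R ((2 * V) *\<^sub>R L (ddy \<delta>)))"
      unfolding alternating_quat_sum[of A' "\<lambda>\<gamma>. L (ddy \<gamma>)", OF A'_alt dbar(2)] AV ..
    finally show ?thesis by (simp add: scaleR_sum_right mult.commute)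
  qed
  have "L \<nu> = L ((\<Sum>\<alpha>\<in>UNIV. (fst \<nu> $ \<alpha>) *\<^sub>R ddx \<alpha>) + (\<Sum>\<alpha>\<in>UNIV. (snd \<nu> $ \<alpha>) *\<^sub>R ddy \<alpha>))"
    by (subst quat2_representation) simp
  then have L\<nu>: "L \<nu> = (\<Sum>\<delta>\<in>UNIV. fst \<nu> $ \<delta> *\<^sub>R L (ddx \<delta>)) + (\<Sum>\<delta>\<in>UNIV. snd \<nu> $ \<delta> *\<^sub>R L (ddy \<delta>))"
    by (simp add: linear_add[OF lin] linear_sum[OF lin] linear_cmul[OF lin])
  show ?thesis
    unfolding wedge_scaleR_left wedge_add_left X Y
    unfolding w_def[symmetric] V_def[symmetric] L\<nu> by (simp add: scaleR_add_right)
qed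

text \<open>Makes the quaternion in the definition of \<open>f_perp\<close> unique.\<close>

lemma volume_nonzero_on_orthogonal:
  fixes \<nu> :: quat2
  assumes "norm \<nu> = 1"
  shows "\<exists>v. (\<forall>i. v i \<bullet> \<nu> = 0) \<and> alt_form (xs_frame @ ys_frame) (case_nat \<nu> v) \<noteq> 0"
proof -
  have "\<nu> \<noteq> 0" using assms by auto
  then obtain e where e: "e \<in> Basis" "\<nu> \<bullet> e \<noteq> 0" using euclidean_all_zero_iff[of \<nu>] by auto
  have set: "set (xs_frame @ ys_frame) = Basis" unfolding Basis_quat2 using UNIV_quat by auto
  then obtain as bs where ab: "xs_frame @ ys_frame = as @ e # bs" using e(1) split_list by metis
  define J where "J = as @ bs"
  have dist: "distinct (as @ e # bs)" unfolding ab[symmetric] by simp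
  have J: "set J = Basis - {e}" "distinct J" using dist set unfolding ab J_def by auto
  \<comment> \<open>The seven basis vectors other than e, projected along e onto the orthogonal
    complement of \<nu>. They remain dual to the entries of J, as e is not among these.\<close>
  define v where "v k = (if k < length J then J ! k - ((\<nu> \<bullet> J ! k) / (\<nu> \<bullet> e)) *\<^sub>R e else 0)" for k
  have orth: "v k \<bullet> \<nu> = 0" for k
    using e(2) by (simp add: v_def inner_diff_left inner_diff_right inner_commute)
  have mem: "J ! i \<in> Basis" "J ! i \<noteq> e" if "i < length J" for i using nth_mem[OF that] J(1) by auto
  have "v k \<bullet> J ! i = (if i = k then 1 else 0)" if "i < length J" "k < length J" for i k
    using mem[OF that(1)] mem[OF that(2)] e(1) J(2) that
    by (auto simp: v_def inner_diff_left inner_Basis nth_eq_iff_index_eq)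
  then have 1: "alt_form J v = 1" by (rule alt_form_dual)
  have "alt_form (\<nu> # J) (case_nat \<nu> v) = 1"
    using assms by (subst alt_form_Cons_orthogonal) (auto simp: orth 1 norm_eq_1)
  also have "\<nu> = (\<Sum>b\<in>Basis. (\<nu> \<bullet> b) *\<^sub>R b)" by (rule euclidean_representation[symmetric])
  also have "alt_form ((\<Sum>b\<in>Basis. (\<nu> \<bullet> b) *\<^sub>R b) # J) (case_nat (\<Sum>b\<in>Basis. (\<nu> \<bullet> b) *\<^sub>R b) v)
      = (\<Sum>b\<in>Basis. (\<nu> \<bullet> b) * alt_form (b # J) (case_nat \<nu> v))"
    unfolding alt_form_head_sum by (simp add: euclidean_representation)
  also have "\<dots> = (\<nu> \<bullet> e) * alt_form (e # J) (case_nat \<nu> v)"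
  proof -
    have "(\<nu> \<bullet> b) * alt_form (b # J) (case_nat \<nu> v) = 0" if "b \<in> Basis - {e}" for b
      using that J(1) by (simp add: alt_form_repeated)
    then have "(\<Sum>b\<in>Basis - {e}. (\<nu> \<bullet> b) * alt_form (b # J) (case_nat \<nu> v)) = 0"
      by (intro sum.neutral ballI)
    then show ?thesis by (subst sum.remove[OF finite_Basis e(1)]) simp
  qed
  finally have "alt_form (e # J) (case_nat \<nu> v) \<noteq> 0" by auto
  then have "alt_form (xs_frame @ ys_frame) (case_nat \<nu> v) \<noteq> 0"
    using alt_form_move[of "[]" e as bs "case_nat \<nu> v"] unfolding ab J_def by auto
  then show ?thesis using orth by blast
qed

text \<open>To be used with L the full derivative at p of an extension with dbar zero there: f alone
  then determines its normal derivative.\<close>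

lemma f_perp_formula:
  fixes L :: "quat2 \<Rightarrow> quat"
  assumes lin: "linear L" and \<nu>: "norm (\<nu> p) = 1" and T: "tangent_space S p = {v. v \<bullet> \<nu> p = 0}"
    and D: "\<And>v. v \<in> tangent_space S p \<Longrightarrow> surface_diff S f p v = L v"
    and dbar: "(\<Sum>\<alpha>\<in>UNIV. axis \<alpha> 1 \<bullet>\<^sub>H L (ddx \<alpha>)) = 0" "(\<Sum>\<alpha>\<in>UNIV. axis \<alpha> 1 \<bullet>\<^sub>H L (ddy \<alpha>)) = 0"
  shows "f_perp S \<nu> f p = L (\<nu> p)"
proof -
  let ?\<theta> = "\<lambda>w. - (1 / 2) *\<^sub>R (wedge 2 4 (wedge 1 1 dq1_bar dq1) dy w + wedge 4 2 dx (wedge 1 1 dq2_bar dq2) w)"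
  let ?V = "\<lambda>v. alt_form (xs_frame @ ys_frame) (case_nat (\<nu> p) v)"
  have lhs: "wedge 6 1 ?\<theta> (one_form (surface_diff S f p)) v = - ?V v *\<^sub>R L (\<nu> p)"
    if v: "\<forall>i<7. v i \<in> tangent_space S p" for v
  proof -
    \<comment> \<open>Only values of \<open>surface_diff\<close> on tangent vectors enter, and there
      it agrees with L.\<close>
    have "wedge 6 1 ?\<theta> (one_form (surface_diff S f p)) v = wedge 6 1 ?\<theta> (one_form L) v"
      unfolding wedge_def[of 6 1]
    proof (intro arg_cong2[where f = scaleR] sum.cong refl arg_cong2[where f = qmult])
      fix \<sigma> :: "nat \<Rightarrow> nat" assume "\<sigma> \<in> {\<sigma>. \<sigma> permutes {..<6 + 1}}"
      then have "\<sigma> 6 < 7" using permutes_in_image[of \<sigma> "{..<7}" 6] by simp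
      then show "one_form (surface_diff S f p) (\<lambda>i. v (\<sigma> (6 + i))) = one_form L (\<lambda>i. v (\<sigma> (6 + i)))"
        using D v by (simp add: one_form_def)
    qed
    also have "\<dots> = - ?V v *\<^sub>R L (\<nu> p)"
      by (rule normal_form_wedge[OF lin \<nu> dbar]) (use v T in auto)
    finally show ?thesis .
  qed
  have rhs: "h \<bullet>\<^sub>H (- interior_product (\<nu> p) (wedge 4 4 dx dy) v) = - ?V v *\<^sub>R h" for h v
    unfolding interior_product_def volume_form_eq by (simp add: qmult.minus_right qmult.scaleR_right)
  show ?thesis
    unfolding f_perp_def
  proof (rule the_equality)
    show "\<forall>v. (\<forall>i<7. v i \<in> tangent_space S p) \<longrightarrow> wedge 6 1 ?\<theta> (one_form (surface_diff S f p)) v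
      = L (\<nu> p) \<bullet>\<^sub>H (- interior_product (\<nu> p) (wedge 4 4 dx dy) v)"
      using lhs unfolding rhs by blast
    fix h assume h: "\<forall>v. (\<forall>i<7. v i \<in> tangent_space S p) \<longrightarrow> wedge 6 1 ?\<theta> (one_form (surface_diff S f p)) v
      = h \<bullet>\<^sub>H (- interior_product (\<nu> p) (wedge 4 4 dx dy) v)"
    obtain v where v: "\<forall>i. v i \<bullet> \<nu> p = 0" "?V v \<noteq> 0" using volume_nonzero_on_orthogonal[OF \<nu>] by blast
    then have "\<forall>i<7. v i \<in> tangent_space S p" using T by simp
    then have "- ?V v *\<^sub>R L (\<nu> p) = - ?V v *\<^sub>R h"
      using mp[OF spec[OF h[unfolded rhs], of v]] lhs[of v] by (simp only:)
    then show "h = L (\<nu> p)" using v(2) by simp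
  qed
qed

subsection \<open>CRF functions and the sides of a hypersurface\<close>

lemma Cinf_on_imp_continuous_on: "Cinf_on U F \<Longrightarrow> continuous_on U F"
  by (metis Cinf_on_def Ck_on.simps(1))

lemma dbar_eq_qdbar: "dbar1 = qdbar ddx" "dbar2 = qdbar ddy"
  by (auto simp: fun_eq_iff dbar1_def dbar2_def qdbar_def dir_deriv_def)

lemma dbar_quat_of_real:
  assumes "r differentiable (at x)"
  shows "qdbar e (\<lambda>y. quat_of_real (r y)) x = qsymbol e r x"
proof -
  have "bounded_linear quat_of_real"
    unfolding linear_conv_bounded_linear[symmetric]
    by (rule linearI) (simp_all add: quat_of_real_def vec_eq_iff axis_def)
  from dir_deriv_compose_linear[OF this assms]
  have "dir_deriv v (\<lambda>y. quat_of_real (r y)) x = dir_deriv v r x *\<^sub>R axis 0 1" for v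
    by (simp add: quat_of_real_def vec_eq_iff axis_def)
  then show ?thesis
    using sum_axis_scaleR(1)[of "qsymbol e r x" "axis 0 1"] by (simp add: qdbar_def qsymbol_def)
qed

text \<open>Subtracting \<rho> B from the given extension does it, because on S dbar of \<rho> B is
  the symbol of \<rho> times B.\<close>

lemma CRF_imp_extension:
  assumes "CRF S f"
  shows "\<exists>U F. open U \<and> S \<subseteq> U \<and> Cinf_on U F \<and> (\<forall>p\<in>S. F p = f p \<and> qdbar ddx F p = 0 \<and> qdbar ddy F p = 0)"
proof -
  obtain U \<rho> F A B where def: "defining_function S U \<rho>" and sm: "smooth_on U F" "smooth_on U B"
    and f: "\<forall>p\<in>S. F p = f p"
    and D: "\<forall>x\<in>U. Dbar F x = \<rho> x *\<^sub>R A x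
            + (dbar1 (\<lambda>y. quat_of_real (\<rho> y)) x \<bullet>\<^sub>H B x, dbar2 (\<lambda>y. quat_of_real (\<rho> y)) x \<bullet>\<^sub>H B x)"
    using assms unfolding CRF_def by blast
  have U: "open U" "S \<subseteq> U" and \<rho>: "Cinf_on U \<rho>" "\<And>p. p \<in> S \<Longrightarrow> \<rho> p = 0"
    using def by (auto simp: defining_function_def smooth_on_iff_Cinf_on)
  have C: "Cinf_on U F" "Cinf_on U B" using sm by (simp_all add: smooth_on_iff_Cinf_on)
  define F' where "F' x = F x - \<rho> x *\<^sub>R B x" for x
  have "Cinf_on U F'" unfolding F'_def[abs_def] by (intro Cinf_on_diff Cinf_on_scaleR U C \<rho>)
  moreover have "F' p = f p \<and> qdbar ddx F' p = 0 \<and> qdbar ddy F' p = 0" if p: "p \<in> S" for p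
  proof -
    have pU: "p \<in> U" using p U by blast
    have d: "F differentiable (at p)" "B differentiable (at p)" "\<rho> differentiable (at p)"
      "(\<lambda>x. \<rho> x *\<^sub>R B x) differentiable (at p)"
      using C \<rho> by (auto intro!: Cinf_on_differentiable[OF _ U(1) pU] Cinf_on_scaleR U)
    have "qdbar e F' p = qdbar e F p - qsymbol e \<rho> p \<bullet>\<^sub>H B p" for e
      unfolding F'_def[abs_def] qdbar_diff[OF d(1,4)] qdbar_scaleR[OF d(3,2)] using \<rho>(2)[OF p] by simp
    then show ?thesis
      using D pU \<rho>(2)[OF p] f p by (auto simp: F'_def Dbar_def dbar_eq_qdbar dbar_quat_of_real[OF d(3)])
  qed
  ultimately show ?thesis using U by blast
qed

text \<open>The neighbourhood is shrunk into W and to the points where the gradient is nonzero, so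
  that N is available on all of it.\<close>

lemma level_set_defining_function:
  assumes def: "defining_function S U \<rho>" and W: "open W" "S \<subseteq> W"
  shows "level_set S {x \<in> U \<inter> W. grad_sq \<rho> x \<noteq> 0} \<rho>"
proof
  have U: "open U" "S \<subseteq> U" and \<rho>: "Cinf_on U \<rho>" "S = {x \<in> U. \<rho> x = 0}"
    and nz: "\<forall>p\<in>S. frechet_derivative \<rho> (at p) \<noteq> (\<lambda>v. 0)"
    using def by (auto simp: defining_function_def smooth_on_iff_Cinf_on)
  have "Cinf_on (U \<inter> W) (grad_sq \<rho>)"
    unfolding grad_sq_def[abs_def]
    using U W by (intro Cinf_on_sum Cinf_on_mult Cinf_on_dir_deriv Cinf_on_subset[OF \<rho>(1)]) auto
  then have "continuous_on (U \<inter> W) (grad_sq \<rho>)"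
    by (rule Cinf_on_imp_continuous_on)
  then show "open {x \<in> U \<inter> W. grad_sq \<rho> x \<noteq> 0}"
  proof -
    assume "continuous_on (U \<inter> W) (grad_sq \<rho>)"
    then have "open ((U \<inter> W) \<inter> grad_sq \<rho> -` (- {0}))"
      using U W by (intro continuous_open_preimage) auto
    also have "(U \<inter> W) \<inter> grad_sq \<rho> -` (- {0}) = {x \<in> U \<inter> W. grad_sq \<rho> x \<noteq> 0}" by auto
    finally show ?thesis .
  qed
  have "grad_sq \<rho> p \<noteq> 0" if p: "p \<in> S" for p
  proof
    assume "grad_sq \<rho> p = 0"
    then have z: "dir_deriv b \<rho> p = 0" if "b \<in> Basis" for b
      using that by (auto simp: grad_sq_def sum_nonneg_eq_0_iff)
    have "\<rho> differentiable (at p)" by (rule Cinf_on_differentiable[OF \<rho>(1) U(1) subsetD[OF U(2) p]])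
    then have "dir_deriv v \<rho> p = 0" for v using dir_deriv_basis_sum[of \<rho> p v] z by simp
    then show False using nz p by (auto simp: dir_deriv_def fun_eq_iff)
  qed
  then show "S = {x \<in> {x \<in> U \<inter> W. grad_sq \<rho> x \<noteq> 0}. \<rho> x = 0}" using \<rho>(2) W(2) by blast
  show "Cinf_on {x \<in> U \<inter> W. grad_sq \<rho> x \<noteq> 0} \<rho>" by (rule Cinf_on_subset[OF \<rho>(1)]) auto
qed auto

text \<open>Every defining function is zero on S, so its differential vanishes on the kernel of any
  other one by \<open>derivative_within_level_set_tangent\<close>.\<close>

lemma tangent_space_eq:
  assumes def: "defining_function S U \<rho>" and p: "p \<in> S"
  shows "tangent_space S p = {v. dir_deriv v \<rho> p = 0}"
proof
  show "{v. dir_deriv v \<rho> p = 0} \<subseteq> tangent_space S p"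
    using def by (auto simp: tangent_space_def dir_deriv_def)
  show "tangent_space S p \<subseteq> {v. dir_deriv v \<rho> p = 0}"
  proof
    fix v assume "v \<in> tangent_space S p"
    then obtain U' \<rho>' where def': "defining_function S U' \<rho>'" and v: "dir_deriv v \<rho>' p = 0"
      by (auto simp: tangent_space_def dir_deriv_def)
    interpret level_set S "{x \<in> U' \<inter> UNIV. grad_sq \<rho>' x \<noteq> 0}" \<rho>'
      by (rule level_set_defining_function[OF def']) auto
    have U: "open U" "S \<subseteq> U" "Cinf_on U \<rho>" "\<And>x. x \<in> S \<Longrightarrow> \<rho> x = 0"
      using def by (auto simp: defining_function_def smooth_on_iff_Cinf_on)
    have "\<rho> differentiable (at p)" by (rule Cinf_on_differentiable[OF U(3,1) subsetD[OF U(2) p]])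
    from derivative_within_level_set_tangent[OF p v has_derivative_at_withinI[OF has_derivative_dir_deriv[OF this]] U(4)]
    show "v \<in> {v. dir_deriv v \<rho> p = 0}" by simp
  qed
qed

context level_set
begin

text \<open>Subtracting the normal component of v gives v \<bullet> n = d\<rho>(v) (normal p
  \<bullet> n); the last factor is nonzero, because v = n gives 1 on the left.\<close>

lemma kernel_eq_orthogonal:
  assumes p: "p \<in> S" and n: "norm n = 1" "\<And>v. dir_deriv v \<rho> p = 0 \<Longrightarrow> v \<bullet> n = 0"
  shows "{v. dir_deriv v \<rho> p = 0} = {v. v \<bullet> n = 0}"
proof -
  have pU: "p \<in> U" using p S_subset by blast
  note lin = has_derivative_linear[OF has_derivative_dir_deriv[OF \<rho>_diff[OF pU]]]
  have split: "v \<bullet> n = dir_deriv v \<rho> p * (normal p \<bullet> n)" for v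
  proof -
    have "dir_deriv (v - dir_deriv v \<rho> p *\<^sub>R normal p) \<rho> p = 0"
      using dir_deriv_normal[OF \<rho>_diff[OF pU]] normal_deriv_\<rho>[OF pU]
      by (simp add: linear_diff[OF lin] linear_cmul[OF lin])
    from n(2)[OF this] show ?thesis by (simp add: inner_diff_left)
  qed
  have "normal p \<bullet> n \<noteq> 0" using split[of n] n(1) by (auto simp: norm_eq_1)
  then have "dir_deriv v \<rho> p = 0 \<longleftrightarrow> v \<bullet> n = 0" for v using split[of v] by simp
  then show ?thesis by simp
qed

end

lemma f_deriv_eq:
  assumes def: "defining_function S U \<rho>" and \<nu>: "unit_normal_field S \<nu>" and p: "p \<in> S"
    and V: "open V" "S \<subseteq> V" "Cinf_on V F" "\<And>x. x \<in> S \<Longrightarrow> F x = f x"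
    and dbar: "qdbar ddx F p = 0" "qdbar ddy F p = 0"
  shows "f_deriv S \<nu> f e p = dir_deriv e F p"
proof -
  interpret level_set S "{x \<in> U \<inter> UNIV. grad_sq \<rho> x \<noteq> 0}" \<rho>
    by (rule level_set_defining_function[OF def]) auto
  have dF: "(F has_derivative (\<lambda>v. dir_deriv v F p)) (at p)"
    by (rule has_derivative_dir_deriv[OF Cinf_on_differentiable[OF V(3,1) subsetD[OF V(2) p]]])
  note lin = has_derivative_linear[OF dF]
  have tan: "tangent_space S p = {v. dir_deriv v \<rho> p = 0}" by (rule tangent_space_eq[OF def p])
  have n1: "norm (\<nu> p) = 1" and n2: "\<And>v. v \<in> tangent_space S p \<Longrightarrow> v \<bullet> \<nu> p = 0"
    using \<nu> p by (auto simp: unit_normal_field_def)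
  have T: "tangent_space S p = {v. v \<bullet> \<nu> p = 0}"
    using kernel_eq_orthogonal[OF p n1] n2 unfolding tan by simp
  have fS: "(f has_derivative (\<lambda>v. dir_deriv v F p)) (at p within S)"
    by (rule has_derivative_transform[OF p _ has_derivative_at_withinI[OF dF]]) (use V(4) in simp)
  then have "(f has_derivative surface_diff S f p) (at p within S)"
    unfolding surface_diff_def frechet_derivative_works[symmetric] differentiable_def by blast
  \<comment> \<open>f - F is zero on S, so this difference of derivatives vanishes on tangent
    vectors.\<close>
  from has_derivative_diff[OF this has_derivative_at_withinI[OF dF]]
  have K: "((\<lambda>x. f x - F x) has_derivative (\<lambda>v. surface_diff S f p v - dir_deriv v F p)) (at p within S)" .
  have D: "surface_diff S f p v = dir_deriv v F p" if "v \<in> tangent_space S p" for v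
    using derivative_within_level_set_tangent[OF p _ K, of v] that V(4) unfolding tan by simp
  have perp: "f_perp S \<nu> f p = dir_deriv (\<nu> p) F p"
    by (rule f_perp_formula[where L = "\<lambda>v. dir_deriv v F p" and \<nu> = \<nu> and p = p and S = S and f = f, OF lin n1 T D]) (use dbar in \<open>auto simp: qdbar_def\<close>)
  have "e - (e \<bullet> \<nu> p) *\<^sub>R \<nu> p \<in> tangent_space S p"
    using n1 unfolding T by (simp add: inner_diff_left norm_eq_1)
  from D[OF this] show ?thesis
    unfolding f_deriv_def perp by (simp add: linear_diff[OF lin] linear_cmul[OF lin])
qed

lemma qnorm_sq_frame: "qnorm_sq (qsymbol ddx \<rho> x) + qnorm_sq (qsymbol ddy \<rho> x) = grad_sq \<rho> x"
  by (simp add: qnorm_sq_def qsymbol_def grad_sq_def sum_Basis_quat2)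

text \<open>The CRF extension \<open>G b\<close> of a derivative of F need agree with that
  derivative on S only. The normal derivative of the discrepancy \<open>K b\<close> then expresses
  dbar of the derivatives of F on S.\<close>

lemma admissible_extension:
  assumes hyp: "smooth_hypersurface S" and adm: "admissible S f"
  shows "\<exists>U \<rho>. level_set S U \<rho> \<and> (\<forall>k. \<exists>F. Cinf_on U F \<and> (\<forall>p\<in>S. F p = f p) \<and>
    flat_on k S (qdbar ddx F) \<and> flat_on k S (qdbar ddy F))"
proof -
  obtain U0 \<rho> where def: "defining_function S U0 \<rho>" using hyp by (auto simp: smooth_hypersurface_def)
  obtain \<nu> where crf: "CRF S f" and \<nu>: "unit_normal_field S \<nu>"
    and frame: "\<forall>\<alpha>. CRF S (f_deriv S \<nu> f (ddx \<alpha>)) \<and> CRF S (f_deriv S \<nu> f (ddy \<alpha>))"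
    using adm unfolding admissible_def by blast
  have crf': "CRF S (f_deriv S \<nu> f b)" if "b \<in> Basis" for b
    using frame that unfolding Basis_quat2 by blast
  obtain U1 F where U1: "open U1" "S \<subseteq> U1" "Cinf_on U1 F"
    and F: "\<And>p. p \<in> S \<Longrightarrow> F p = f p" "\<And>p. p \<in> S \<Longrightarrow> qdbar ddx F p = 0" "\<And>p. p \<in> S \<Longrightarrow> qdbar ddy F p = 0"
    using CRF_imp_extension[OF crf] by blast
  have fd: "f_deriv S \<nu> f b p = dir_deriv b F p" if "p \<in> S" for b p
    by (rule f_deriv_eq[OF def \<nu> that U1 F(1) F(2,3)[OF that]])
  have "\<exists>V G. open V \<and> S \<subseteq> V \<and> Cinf_on V G \<and> (\<forall>p\<in>S. G p = dir_deriv b F p \<and> qdbar ddx G p = 0 \<and> qdbar ddy G p = 0)"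
    if "b \<in> Basis" for b
    using CRF_imp_extension[OF crf'[OF that]] fd by simp
  then obtain V G where V: "\<And>b. b \<in> Basis \<Longrightarrow> open (V b) \<and> S \<subseteq> V b \<and> Cinf_on (V b) (G b)"
    and G: "\<And>b p. b \<in> Basis \<Longrightarrow> p \<in> S \<Longrightarrow> G b p = dir_deriv b F p \<and> qdbar ddx (G b) p = 0 \<and> qdbar ddy (G b) p = 0"
    by metis
  define W where "W = U1 \<inter> (\<Inter>b\<in>Basis. V b)"
  have W: "open W" "S \<subseteq> W" unfolding W_def using V U1 by (auto intro!: open_Int open_INT)
  define U where "U = {x \<in> U0 \<inter> W. grad_sq \<rho> x \<noteq> 0}"
  interpret level_set S U \<rho> unfolding U_def by (rule level_set_defining_function[OF def W])
  have UW: "U \<subseteq> W" by (auto simp: U_def)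
  have FC: "Cinf_on U F" by (rule Cinf_on_subset[OF U1(3)]) (use UW in \<open>auto simp: W_def\<close>)
  have GC: "Cinf_on U (G b)" if "b \<in> Basis" for b
  proof -
    have "U \<subseteq> V b" using UW that by (auto simp: W_def)
    then show ?thesis using V[OF that] Cinf_on_subset by blast
  qed
  define K where "K b x = G b x - dir_deriv b F x" for b x
  have KC: "Cinf_on U (K b)" if "b \<in> Basis" for b
    unfolding K_def[abs_def] by (intro Cinf_on_diff Cinf_on_dir_deriv GC that FC open_U)
  have K0: "K b p = 0" if "b \<in> Basis" "p \<in> S" for b p using G[OF that] by (simp add: K_def)
  \<comment> \<open>\<open>K b\<close> is zero on S, so its dbar there is the symbol of \<rho> times
    its normal derivative, while dbar of \<open>G b\<close> is zero.\<close>
  have DK: "dir_deriv b (qdbar d F) p = - (qsymbol d \<rho> p \<bullet>\<^sub>H N (K b) p)"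
    if b: "b \<in> Basis" and p: "p \<in> S" and Gd: "qdbar d (G b) p = 0" for b p d
  proof -
    have pU: "p \<in> U" using p S_subset by blast
    have "qdbar d (K b) p = (\<Sum>\<alpha>\<in>UNIV. axis \<alpha> 1 \<bullet>\<^sub>H (dir_deriv (d \<alpha>) \<rho> p *\<^sub>R N (K b) p))"
      unfolding qdbar_def
      using dir_deriv_on_level_set[OF Cinf_on_differentiable[OF KC[OF b] open_U pU] K0[OF b] p] by simp
    also have "\<dots> = qsymbol d \<rho> p \<bullet>\<^sub>H N (K b) p"
      using sum_axis_scaleR(1)[of "qsymbol d \<rho> p" "N (K b) p"] by (simp add: qsymbol_def)
    finally have 1: "qdbar d (K b) p = qsymbol d \<rho> p \<bullet>\<^sub>H N (K b) p" .
    have "qdbar d (K b) p = qdbar d (G b) p - qdbar d (dir_deriv b F) p"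
      unfolding K_def[abs_def]
      by (intro qdbar_diff Cinf_on_differentiable[OF _ open_U pU] GC b Cinf_on_dir_deriv FC)
    also have "qdbar d (dir_deriv b F) p = dir_deriv b (qdbar d F) p"
      using FC by (intro dir_deriv_qdbar_eq[OF open_U _ pU, symmetric]) (simp add: Cinf_on_def)
    finally show ?thesis using 1 Gd by simp
  qed
  have sol: "\<exists>c. N (qdbar ddx F) p = qsymbol ddx \<rho> p \<bullet>\<^sub>H c \<and> N (qdbar ddy F) p = qsymbol ddy \<rho> p \<bullet>\<^sub>H c" if p: "p \<in> S" for p
  proof -
    \<comment> \<open>One c serves both variables, since \<open>K b\<close> does not depend on the
      variable in which dbar is taken.\<close>
    define c where "c = - (\<Sum>b\<in>Basis. (dir_deriv b \<rho> p * inverse (grad_sq \<rho> p)) *\<^sub>R N (K b) p)"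
    have "N (qdbar d F) p = qsymbol d \<rho> p \<bullet>\<^sub>H c" if "\<And>b. b \<in> Basis \<Longrightarrow> qdbar d (G b) p = 0" for d
      unfolding normal_deriv_def[of \<rho> "qdbar d F"] c_def
      by (simp add: DK[OF _ p that] qmult.minus_right qmult.sum_right qmult.scaleR_right sum_negf)
    then show ?thesis using G p by blast
  qed
  have flat1: "flat_on 1 S (qdbar ddx F)" "flat_on 1 S (qdbar ddy F)" using F by simp_all
  have "\<exists>F'. Cinf_on U F' \<and> (\<forall>p\<in>S. F' p = f p) \<and> flat_on k S (qdbar ddx F') \<and> flat_on k S (qdbar ddy F')" for k
    using extension_to_infinite_order[OF qnorm_sq_frame FC flat1 sol, of k] F(1) by auto
  then show ?thesis using level_set_axioms by blast
qed

section \<open>The two sides of a hypersurface\<close>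

context level_set
begin

text \<open>
  Near a point of \<open>S\<close> the side \<open>\<rho> > 0\<close> is connected: flow all its points along the gradient
  direction at \<open>p\<close> into a translated ball lying in \<open>\<rho> > 0\<close>.
\<close>

lemma positive_side_connected:
  assumes p: "p \<in> S"
  shows "\<exists>V P. open V \<and> p \<in> V \<and> V \<subseteq> U \<and> connected P \<and> P \<inter> S = {} \<and> {x \<in> V. 0 < \<rho> x} \<subseteq> P \<and> S \<inter> V \<subseteq> closure P"
proof -
  have pU: "p \<in> U" using p S_subset by blast
  let ?e = "normal p"
  have De: "dir_deriv ?e \<rho> p = 1" using dir_deriv_normal[OF \<rho>_diff[OF pU]] normal_deriv_\<rho>[OF pU] by simp
  have "?e \<noteq> 0"
    using De has_derivative_linear[OF has_derivative_dir_deriv[OF \<rho>_diff[OF pU]]] linear_0 by fastforce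
  then have ne: "norm ?e > 0" by simp
  have cont: "continuous_on U \<rho>" "continuous_on U (dir_deriv ?e \<rho>)"
    by (intro Cinf_on_imp_continuous_on Cinf_on_dir_deriv smooth_\<rho>)+
  have "open {x \<in> U. dir_deriv ?e \<rho> x \<in> {1/2<..}}"
    using continuous_open_preimage[OF cont(2) open_U, of "{1/2<..}"] by (simp add: vimage_def Int_def)
  moreover have "p \<in> {x \<in> U. dir_deriv ?e \<rho> x \<in> {1/2<..}}" using pU De by simp
  ultimately obtain r where r: "r > 0" "ball p r \<subseteq> {x \<in> U. dir_deriv ?e \<rho> x \<in> {1/2<..}}" by (meson open_contains_ball)
  \<comment> \<open>Moving a point of the ball of radius r/2 by at most s times the vector
    \<open>normal p\<close> keeps it in the ball of radius r.\<close>
  define s where "s = r / (2 * norm ?e)"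
  have s: "s > 0" "s * norm ?e = r / 2" using r(1) ne by (auto simp: s_def)
  \<comment> \<open>Where \<rho> > -s/2, the shift by s makes \<rho> positive, as \<rho> grows at
    least at rate 1/2 along the flow.\<close>
  have "open {x \<in> U. \<rho> x \<in> {- (s / 2)<..<s / 2}}"
    using continuous_open_preimage[OF cont(1) open_U, of "{- (s / 2)<..<s / 2}"] by (simp add: vimage_def Int_def)
  moreover have "p \<in> {x \<in> U. \<rho> x \<in> {- (s / 2)<..<s / 2}}" using pU \<rho>_zero[OF p] s by simp
  ultimately obtain r0 where r0: "r0 > 0" "ball p r0 \<subseteq> {x \<in> U. \<rho> x \<in> {- (s / 2)<..<s / 2}}" by (meson open_contains_ball)
  define r' where "r' = min r0 (r / 2)"
  have r': "r' > 0" "r' \<le> r / 2" "ball p r' \<subseteq> ball p r0" using r r0 by (auto simp: r'_def)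
  let ?V = "ball p r'"
  have \<rho>V: "- (s / 2) < \<rho> x" "x \<in> U" if "x \<in> ?V" for x using that r'(3) r0(2) by auto
  have stay: "x + t *\<^sub>R ?e \<in> ball p r" if x: "x \<in> ?V" and t: "0 \<le> t" "t \<le> s" for x t
  proof -
    have "norm (t *\<^sub>R ?e) \<le> r / 2" using t s(2) mult_right_mono[OF t(2), of "norm ?e"] by simp
    moreover have "dist p (x + t *\<^sub>R ?e) \<le> dist p x + norm (t *\<^sub>R ?e)"
      using dist_triangle[of p "x + t *\<^sub>R ?e" x] by (simp add: dist_norm)
    ultimately show ?thesis using x r'(2) by simp
  qed
  have grow: "\<rho> x + t / 2 \<le> \<rho> (x + t *\<^sub>R ?e)" if x: "x \<in> ?V" and t: "0 \<le> t" "t \<le> s" for x t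
  proof (cases "t = 0")
    case False
    then have t0: "0 < t" using t by simp
    have "\<exists>z>0. z < t \<and> \<rho> (x + t *\<^sub>R ?e) - \<rho> (x + 0 *\<^sub>R ?e) = (t - 0) * dir_deriv ?e \<rho> (x + z *\<^sub>R ?e)"
    proof (rule MVT2[OF t0])
      fix z assume "0 \<le> z" "z \<le> t"
      then have "x + z *\<^sub>R ?e \<in> U" using stay[OF x, of z] t r(2) by auto
      then show "((\<lambda>t. \<rho> (x + t *\<^sub>R ?e)) has_real_derivative dir_deriv ?e \<rho> (x + z *\<^sub>R ?e)) (at z)"
        by (rule has_real_derivative_along_line[OF \<rho>_diff])
    qed
    then obtain z where z: "0 < z" "z < t" "\<rho> (x + t *\<^sub>R ?e) - \<rho> x = t * dir_deriv ?e \<rho> (x + z *\<^sub>R ?e)" by auto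
    have "1 / 2 < dir_deriv ?e \<rho> (x + z *\<^sub>R ?e)" using stay[OF x, of z] z t r(2) by auto
    then have "t * (1 / 2) \<le> t * dir_deriv ?e \<rho> (x + z *\<^sub>R ?e)" using t0 by (intro mult_left_mono) auto
    then show ?thesis using z(3) by simp
  qed simp
  define B where "B = (\<lambda>x. x + s *\<^sub>R ?e) ` ?V"
  define seg where "seg x = (\<lambda>t. x + t *\<^sub>R ?e) ` {0..s}" for x
  define P where "P = B \<union> \<Union> (seg ` {x \<in> ?V. 0 < \<rho> x})"
  have "connected B" unfolding B_def by (intro connected_continuous_image continuous_intros connected_ball)
  moreover have "connected X" if "X \<in> seg ` {x \<in> ?V. 0 < \<rho> x}" for X
    using that unfolding seg_def by (auto intro!: connected_continuous_image continuous_intros)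
  moreover have "B \<inter> X \<noteq> {}" if "X \<in> seg ` {x \<in> ?V. 0 < \<rho> x}" for X
    using that s unfolding seg_def B_def by fastforce
  ultimately have "connected P" unfolding P_def by (rule connected_Un_UN)
  moreover have "0 < \<rho> y" if "y \<in> P" for y
    using that unfolding P_def
  proof
    assume "y \<in> B"
    then obtain x where x: "x \<in> ?V" "y = x + s *\<^sub>R ?e" by (auto simp: B_def)
    then show ?thesis using grow[OF x(1), of s] \<rho>V(1)[OF x(1)] s by simp
  next
    assume "y \<in> \<Union> (seg ` {x \<in> ?V. 0 < \<rho> x})"
    then obtain x t where x: "x \<in> ?V" "0 < \<rho> x" "0 \<le> t" "t \<le> s" "y = x + t *\<^sub>R ?e" by (auto simp: seg_def)
    then show ?thesis using grow[OF x(1,3,4)] by simp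
  qed
  then have "P \<inter> S = {}" using \<rho>_zero by force
  moreover have inP: "{x \<in> ?V. 0 < \<rho> x} \<subseteq> P"
  proof
    fix x assume x: "x \<in> {x \<in> ?V. 0 < \<rho> x}"
    have "x \<in> seg x" unfolding seg_def using s by (intro image_eqI[of _ _ 0]) auto
    then show "x \<in> P" unfolding P_def using x by blast
  qed
  moreover have "S \<inter> ?V \<subseteq> closure P"
  proof
    fix x assume x: "x \<in> S \<inter> ?V"
    show "x \<in> closure P"
      unfolding closure_approachable
    proof (intro allI impI)
      fix \<epsilon> :: real assume \<epsilon>: "0 < \<epsilon>"
      obtain d where d: "d > 0" "ball x d \<subseteq> ?V" using x open_ball[of p r'] by (meson IntD2 open_contains_ball)
      define t where "t = min s (min \<epsilon> d / (2 * norm ?e))"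
      have t: "0 < t" "t \<le> s" using s \<epsilon> d ne by (auto simp: t_def)
      have "t * norm ?e \<le> min \<epsilon> d / (2 * norm ?e) * norm ?e" by (intro mult_right_mono) (auto simp: t_def)
      then have tn: "t * norm ?e < \<epsilon>" "t * norm ?e < d" using ne \<epsilon> d by auto
      have "x + t *\<^sub>R ?e \<in> ?V" using d(2) tn(2) t by (intro subsetD[OF d(2)]) (simp add: dist_norm)
      moreover have "0 < \<rho> (x + t *\<^sub>R ?e)" using grow[of x t] x t \<rho>_zero[of x] by simp
      ultimately have "x + t *\<^sub>R ?e \<in> P" using inP by blast
      moreover have "dist (x + t *\<^sub>R ?e) x < \<epsilon>" using tn(1) t by (simp add: dist_norm)
      ultimately show "\<exists>y\<in>P. dist y x < \<epsilon>" by blast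
    qed
  qed
  moreover have "?V \<subseteq> U" using \<rho>V(2) by blast
  moreover have "open ?V" "p \<in> ?V" using r'(1) by simp_all
  ultimately show ?thesis by (intro exI conjI)
qed

lemma level_set_uminus: "level_set S U (\<lambda>x. - \<rho> x)"
proof
  have m: "dir_deriv b (\<lambda>x. - \<rho> x) x = - dir_deriv b \<rho> x" if "x \<in> U" for b x
    by (rule dir_deriv_minus[OF \<rho>_diff[OF that]])
  show "grad_sq (\<lambda>x. - \<rho> x) x \<noteq> 0" if "x \<in> U" for x
    using grad_nonzero[OF that] m[OF that] by (simp add: grad_sq_def)
qed (use open_U S_eq smooth_\<rho> in \<open>auto intro: Cinf_on_minus\<close>)

lemma local_sides:
  assumes p: "p \<in> S"
  shows "\<exists>V P Q. open V \<and> p \<in> V \<and> connected P \<and> connected Q \<and> P \<inter> S = {} \<and> Q \<inter> S = {} \<and>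
    V - S \<subseteq> P \<union> Q \<and> S \<inter> V \<subseteq> closure P \<and> S \<inter> V \<subseteq> closure Q"
proof -
  interpret neg: level_set S U "\<lambda>x. - \<rho> x" by (rule level_set_uminus)
  obtain V P where 1: "open V" "p \<in> V" "V \<subseteq> U" "connected P" "P \<inter> S = {}" "{x \<in> V. 0 < \<rho> x} \<subseteq> P" "S \<inter> V \<subseteq> closure P"
    using positive_side_connected[OF p] by blast
  obtain V' Q where 2: "open V'" "p \<in> V'" "V' \<subseteq> U" "connected Q" "Q \<inter> S = {}" "{x \<in> V'. 0 < - \<rho> x} \<subseteq> Q" "S \<inter> V' \<subseteq> closure Q"
    using neg.positive_side_connected[OF p] by blast
  have "V \<inter> V' - S \<subseteq> P \<union> Q"
  proof
    fix x assume x: "x \<in> V \<inter> V' - S"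
    then have "\<rho> x \<noteq> 0" using S_eq 1(3) by blast
    then have "0 < \<rho> x \<or> 0 < - \<rho> x" by linarith
    then show "x \<in> P \<union> Q" using x 1(6) 2(6) by blast
  qed
  moreover have "open (V \<inter> V')" "p \<in> V \<inter> V'" using 1(1,2) 2(1,2) by (auto intro: open_Int)
  moreover have "S \<inter> (V \<inter> V') \<subseteq> closure P" "S \<inter> (V \<inter> V') \<subseteq> closure Q" using 1(7) 2(7) by auto
  ultimately show ?thesis using 1(4,5) 2(4,5) by (intro exI conjI)
qed

text \<open>The part of S in the closure of the component W is nonempty, closed and open in S. Open,
  because near a point of S there are just two connected local sides, each having all of S nearby in
  its closure, and W contains one of them.\<close>

lemma boundary_in_closure_of_outer_component:
  assumes \<Omega>: "open \<Omega>" "\<Omega> \<noteq> {}" and S: "S = frontier \<Omega>" "connected S" and q: "q \<notin> closure \<Omega>"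
  shows "S \<subseteq> closure (connected_component_set (- closure \<Omega>) q)"
proof -
  define W where "W = connected_component_set (- closure \<Omega>) q"
  have W: "open W" "W \<subseteq> - closure \<Omega>" "q \<in> W"
    unfolding W_def using q connected_component_subset[of "- closure \<Omega>" q]
    by (auto intro: open_connected_component simp: connected_component_refl_eq)
  have closS: "closure \<Omega> = \<Omega> \<union> S" using \<Omega>(1) S(1) by (auto simp: frontier_def interior_open closure_def)
  have frW: "frontier W \<subseteq> S"
  proof
    fix x assume x: "x \<in> frontier W"
    have "x \<notin> \<Omega>"
    proof
      assume "x \<in> \<Omega>"
      then have "\<Omega> \<inter> W \<noteq> {}" using x \<Omega>(1) by (auto simp: frontier_def open_Int_closure_eq_empty dest: closure_iff_nhds_not_empty[THEN iffD1])
      then show False using W(2) closS by blast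
    qed
    moreover have "x \<notin> - closure \<Omega>"
    proof
      assume xo: "x \<in> - closure \<Omega>"
      let ?X = "connected_component_set (- closure \<Omega>) x"
      have X: "open ?X" "x \<in> ?X" using xo by (auto intro: open_connected_component simp: connected_component_refl_eq)
      have "x \<in> closure W" using x by (simp add: frontier_def)
      then have "?X \<inter> W \<noteq> {}" using X open_Int_closure_eq_empty[OF X(1), of W] by blast
      then have "?X = W" unfolding W_def by (metis connected_component_overlap disjoint_iff)
      then show False using x X W(1) by (simp add: frontier_def interior_open)
    qed
    ultimately show "x \<in> S" using closS by blast
  qed
  have "W \<noteq> {}" "W \<noteq> UNIV" using W \<Omega> closS by auto
  then obtain z where z: "z \<in> frontier W" using frontier_not_empty by blast
  define Z where "Z = S \<inter> closure W"
  have "closedin (top_of_set S) Z" unfolding Z_def by (simp add: closedin_closed_Int)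
  moreover have "openin (top_of_set S) Z"
    unfolding openin_contains_ball
  proof (intro conjI ballI)
    show "Z \<subseteq> S" by (simp add: Z_def)
    fix p assume p: "p \<in> Z"
    then obtain V P Q where V: "open V" "p \<in> V" "V - S \<subseteq> P \<union> Q"
      and PQ: "connected P" "connected Q" "P \<inter> S = {}" "Q \<inter> S = {}" "S \<inter> V \<subseteq> closure P" "S \<inter> V \<subseteq> closure Q"
      using local_sides[of p] by (auto simp: Z_def)
    \<comment> \<open>A connected set that meets W and misses S cannot enter \<Omega>, since it
      would have to cross the frontier.\<close>
    have sub: "X \<subseteq> W" if X: "connected X" "X \<inter> S = {}" "X \<inter> W \<noteq> {}" for X
    proof -
      have "X \<inter> \<Omega> = {}"
      proof (rule ccontr)
        assume "X \<inter> \<Omega> \<noteq> {}"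
        moreover have "X - \<Omega> \<noteq> {}" using X(3) W(2) closS by blast
        ultimately have "X \<inter> frontier \<Omega> \<noteq> {}" by (rule connected_Int_frontier[OF X(1)])
        then show False using X(2) S(1) by simp
      qed
      then have Xo: "X \<subseteq> - closure \<Omega>" using X(2) closS by blast
      obtain y where y: "y \<in> X" "y \<in> W" using X(3) by blast
      then have "X \<subseteq> connected_component_set (- closure \<Omega>) y" by (intro connected_component_maximal X(1) Xo)
      also have "\<dots> = W" using y(2) unfolding W_def by (metis connected_component_eq)
      finally show ?thesis .
    qed
    have "p \<in> closure W" using p by (simp add: Z_def)
    then have "V \<inter> W \<noteq> {}" using V(1,2) open_Int_closure_eq_empty[OF V(1), of W] by blast
    then obtain y where y: "y \<in> V" "y \<in> W" by blast
    then have "y \<notin> S" using W(2) closS by blast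
    then have "y \<in> P \<or> y \<in> Q" using y V(3) by blast
    then have "P \<subseteq> W \<or> Q \<subseteq> W" using sub[of P] sub[of Q] PQ y by blast
    then have "S \<inter> V \<subseteq> closure W" using PQ(5,6) closure_mono by blast
    moreover obtain e where "e > 0" "ball p e \<subseteq> V" using V(1,2) by (meson open_contains_ball)
    ultimately show "\<exists>e>0. ball p e \<inter> S \<subseteq> Z" unfolding Z_def by (intro exI[of _ e]) auto
  qed
  moreover have "z \<in> Z" using z frW by (auto simp: Z_def frontier_def)
  ultimately have "Z = S" using S(2) unfolding connected_clopen by blast
  then show ?thesis by (auto simp: Z_def W_def)
qed

end

subsection \<open>Extension by solving the inhomogeneous system\<close>

lemma DIM_quat: "DIM(quat) = 4"
  by simp

lemma sum_Basis_quat: "(\<Sum>b\<in>(Basis :: quat set). g b) = (\<Sum>\<alpha>\<in>UNIV. g (axis \<alpha> 1))"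
proof -
  have "(Basis :: quat set) = range (\<lambda>\<alpha>. axis \<alpha> 1)" by (auto simp: Basis_vec_def)
  moreover have inj: "inj (\<lambda>\<alpha>::4. axis \<alpha> (1::real))" by (auto simp: inj_def axis_eq_axis)
  ultimately show ?thesis using sum.reindex[OF inj, of g] by (simp only: o_def)
qed

text \<open>Flatness of order k + 1 means that the derivatives up to order k vanish on the frontier,
  so those of the extension are continuous there.\<close>

lemma Ck_on_extend_by_zero:
  fixes h :: "'a::euclidean_space \<Rightarrow> 'b::real_normed_vector"
  assumes \<Omega>: "open \<Omega>"
  shows "Ck_on k UNIV h \<Longrightarrow> flat_on (Suc k) (frontier \<Omega>) h \<Longrightarrow> Ck_on k UNIV (\<lambda>x. if x \<in> \<Omega> then h x else 0)"
proof (induction k arbitrary: h)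
  case 0
  have "continuous_on (closure \<Omega> \<union> - \<Omega>) (\<lambda>x. if x \<in> \<Omega> then h x else 0)"
  proof (rule continuous_on_cases)
    show "\<forall>x. x \<in> closure \<Omega> \<and> x \<notin> \<Omega> \<or> x \<in> - \<Omega> \<and> x \<in> \<Omega> \<longrightarrow> h x = 0"
      using 0(2) \<Omega> by (auto simp: frontier_def interior_open)
  qed (use \<Omega> 0(1) in \<open>auto intro: continuous_on_subset\<close>)
  moreover have "closure \<Omega> \<union> - \<Omega> = UNIV" using closure_subset by blast
  ultimately show ?case by simp
next
  case (Suc k)
  let ?g = "\<lambda>x. if x \<in> \<Omega> then h x else 0"
  have dh: "h differentiable (at x)" for x using Ck_on_differentiable[OF Suc.prems(1)] by simp
  have der: "(?g has_derivative (\<lambda>v. if x \<in> \<Omega> then dir_deriv v h x else 0)) (at x)" for x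
  proof -
    consider "x \<in> \<Omega>" | "x \<in> - closure \<Omega>" | "x \<in> frontier \<Omega>"
      using \<Omega> by (auto simp: frontier_def interior_open)
    then show ?thesis
    proof cases
      case 1
      have "(?g has_derivative (\<lambda>v. dir_deriv v h x)) (at x)"
        by (rule has_derivative_transform_within_open[OF has_derivative_dir_deriv[OF dh] \<Omega> 1]) simp
      then show ?thesis using 1 by simp
    next
      case 2
      then have x: "x \<notin> \<Omega>" using closure_subset by blast
      have "(?g has_derivative (\<lambda>v. 0)) (at x)"
        by (rule has_derivative_transform_within_open[OF has_derivative_const _ 2])
           (use closure_subset in \<open>auto simp: open_Compl\<close>)
      then show ?thesis using x by simp
    next
      case 3
      have x: "x \<notin> \<Omega>" using 3 \<Omega> by (simp add: frontier_def interior_open)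
      have "h x = 0" "dir_deriv v h x = 0" for v using Suc.prems(2) 3 by auto
      then have "(h has_derivative (\<lambda>v. 0)) (at x)" using has_derivative_dir_deriv[OF dh, of x] by simp
      \<comment> \<open>At a frontier point h is o(|y - x|), and setting some of its values to zero
        only decreases its size.\<close>
      then have "(?g has_derivative (\<lambda>v. 0)) (at x)"
        unfolding has_derivative_at_alt using \<open>h x = 0\<close> x by (auto simp: mult_nonneg_nonneg less_imp_le) (meson)+
      then show ?thesis using x by simp
    qed
  qed
  have "dir_deriv v ?g = (\<lambda>x. if x \<in> \<Omega> then dir_deriv v h x else 0)" for v
    using dir_deriv_eqI[OF der] by auto
  moreover have "Ck_on k UNIV (\<lambda>x. if x \<in> \<Omega> then dir_deriv v h x else 0)" for v
    by (rule Suc.IH) (use Suc.prems in auto)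
  moreover have "?g differentiable_on UNIV" using der by (auto simp: differentiable_on_def differentiable_def)
  ultimately show ?case by simp
qed

lemma quat_sum_symmetric':
  fixes M :: "4 \<Rightarrow> 4 \<Rightarrow> quat"
  assumes M: "\<And>\<alpha> \<gamma>. M \<alpha> \<gamma> = M \<gamma> \<alpha>"
  shows "(\<Sum>\<alpha>\<in>UNIV. \<Sum>\<gamma>\<in>UNIV. axis \<alpha> 1 \<bullet>\<^sub>H (qcnj (axis \<gamma> 1) \<bullet>\<^sub>H M \<alpha> \<gamma>)) = (\<Sum>\<alpha>\<in>UNIV. M \<alpha> \<alpha>)"
  using M[of 1 0] M[of 2 0] M[of 3 0] M[of 2 1] M[of 3 1] M[of 3 2]
  by (simp add: quat_eq_iff sum_quat axis_def)

text \<open>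
  Solves \<open>\<partial>\<bar>\<^sub>1 u = g\<^sub>1, \<partial>\<bar>\<^sub>2 u = g\<^sub>2\<close> by \<open>u = \<Delta>\<^sub>1\<^sup>-\<^sup>1 \<partial>\<^sub>1 g\<^sub>1\<close>,
  where \<open>\<Delta>\<^sub>1\<^sup>-\<^sup>1\<close> is convolution with the Newton kernel in \<open>q\<^sub>1\<close>.
\<close>

lemma solve_dbar:
  fixes g1 g2 :: "quat2 \<Rightarrow> quat"
  assumes g: "Ck_on (Suc (Suc k)) UNIV g1" "Ck_on (Suc (Suc k)) UNIV g2" and supp: "vanishes_outside r g1" "vanishes_outside r g2"
    and compat: "\<And>x. (\<Sum>\<alpha>\<in>UNIV. dir_deriv (ddx \<alpha>) (dir_deriv (ddx \<alpha>) g2) x)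
      = (\<Sum>\<beta>\<in>UNIV. axis \<beta> 1 \<bullet>\<^sub>H (\<Sum>\<alpha>\<in>UNIV. qcnj (axis \<alpha> 1) \<bullet>\<^sub>H dir_deriv (ddy \<beta>) (dir_deriv (ddx \<alpha>) g1) x))"
  shows "\<exists>u. Ck_on (Suc k) UNIV u \<and> (\<forall>x. qdbar ddx u x = g1 x \<and> qdbar ddy u x = g2 x) \<and> (\<forall>p. r < norm (snd p) \<longrightarrow> u p = 0)"
proof -
  define \<iota> :: "quat \<Rightarrow> quat2" where "\<iota> \<zeta> = (\<zeta>, 0)" for \<zeta>
  have \<iota>: "linear \<iota>" "\<And>\<zeta>. norm (\<iota> \<zeta>) = norm \<zeta>" by (auto simp: \<iota>_def linear_iff norm_Pair)
  interpret convolution_kernel newton_kernel \<iota> by (rule convolution_kernel_newton[OF DIM_quat \<iota>])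
  define M where "M = newton_mass TYPE(quat)"
  have M: "M > 0" unfolding M_def by (rule newton_mass_pos[OF DIM_quat])
  \<comment> \<open>The first dbar of w is the Laplacian in q1 of g1 and, by \<open>compat\<close>,
    the second is that of g2; the Newton potential returns g1 and g2 up to the factor -M.\<close>
  define w where "w x = (\<Sum>\<alpha>\<in>UNIV. qcnj (axis \<alpha> 1) \<bullet>\<^sub>H dir_deriv (ddx \<alpha>) g1 x)" for x
  define u where "u p = - (1 / M) *\<^sub>R conv w p" for p
  have L: "bounded_linear (\<lambda>x. c \<bullet>\<^sub>H x)" for c by (rule qmult.bounded_linear_right)
  have wC: "Ck_on (Suc k) UNIV w"
    unfolding w_def[abs_def] by (intro Ck_on_sum Ck_on_compose_linear[OF L] Ck_on_dir_deriv g open_UNIV)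
  have wS: "vanishes_outside r w"
    using vanishes_outsideD[OF vanishes_outside_dir_deriv[OF supp(1)]] by (auto simp: vanishes_outside_def w_def qmult.zero_right)
  have w1: "Ck_on 1 UNIV w" by (rule Ck_on_le[OF wC]) simp
  have dw: "continuous_on UNIV (dir_deriv v w)" for v
    by (rule Ck_on_imp_continuous_on[OF Ck_on_dir_deriv[OF w1[unfolded One_nat_def]]])
  have uC: "Ck_on (Suc k) UNIV u"
    unfolding u_def[abs_def] by (intro Ck_on_scaleR Ck_on_const Ck_on_conv[OF wC wS] open_UNIV)
  have g12: "Ck_on 2 UNIV g1" "Ck_on 2 UNIV g2" using g by (auto elim!: Ck_on_le simp del: Ck_on.simps)
  have Dw: "dir_deriv v w x = (\<Sum>\<alpha>\<in>UNIV. qcnj (axis \<alpha> 1) \<bullet>\<^sub>H dir_deriv v (dir_deriv (ddx \<alpha>) g1) x)" for v x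
  proof -
    have d: "dir_deriv b g1 differentiable (at x)" for b
      by (rule Ck_on_differentiable[OF Ck_on_dir_deriv[OF g12(1)[unfolded numeral_2_eq_2]]]) auto
    have "dir_deriv v w x = (\<Sum>\<alpha>\<in>UNIV. dir_deriv v (\<lambda>x. qcnj (axis \<alpha> 1) \<bullet>\<^sub>H dir_deriv (ddx \<alpha>) g1 x) x)"
      unfolding w_def[abs_def]
      by (rule dir_deriv_sum) (intro differentiable_compose[OF bounded_linear_imp_differentiable[OF L]] d)
    then show ?thesis by (simp add: dir_deriv_compose_linear[OF L d])
  qed
  have key: "qdbar e u p = - (1 / M) *\<^sub>R conv (\<lambda>x. \<Sum>\<beta>\<in>UNIV. axis \<beta> 1 \<bullet>\<^sub>H dir_deriv (e \<beta>) w x) p" for e p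
  proof -
    have cd: "conv w differentiable (at p)"
      using conv_has_derivative[OF w1 wS, of p] unfolding differentiable_def by blast
    have "dir_deriv v u p = - (1 / M) *\<^sub>R conv (dir_deriv v w) p" for v
      unfolding u_def[abs_def]
      using dir_deriv_compose_linear[OF bounded_linear_scaleR_right cd, of v "- (1 / M)"]
      by (simp add: dir_deriv_conv[OF w1 wS])
    then have "qdbar e u p = (\<Sum>\<beta>\<in>UNIV. axis \<beta> 1 \<bullet>\<^sub>H (- (1 / M) *\<^sub>R conv (dir_deriv (e \<beta>) w) p))"
      unfolding qdbar_def by simp
    also have "\<dots> = - (1 / M) *\<^sub>R (\<Sum>\<beta>\<in>UNIV. axis \<beta> 1 \<bullet>\<^sub>H conv (dir_deriv (e \<beta>) w) p)"
      unfolding qmult.scaleR_right scaleR_sum_right ..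
    also have "(\<Sum>\<beta>\<in>UNIV. axis \<beta> 1 \<bullet>\<^sub>H conv (dir_deriv (e \<beta>) w) p) = (\<Sum>\<beta>\<in>UNIV. conv (\<lambda>x. axis \<beta> 1 \<bullet>\<^sub>H dir_deriv (e \<beta>) w x) p)"
      by (intro sum.cong refl conv_linear[OF L dw vanishes_outside_dir_deriv[OF wS], symmetric])
    also have "\<dots> = conv (\<lambda>x. \<Sum>\<beta>\<in>UNIV. axis \<beta> 1 \<bullet>\<^sub>H dir_deriv (e \<beta>) w x) p"
    proof (rule conv_sum[symmetric])
      show "continuous_on UNIV (\<lambda>x. axis \<beta> 1 \<bullet>\<^sub>H dir_deriv (e \<beta>) w x)" for \<beta>
        by (intro qmult.continuous_on continuous_on_const dw)
      show "vanishes_outside r (\<lambda>x. axis \<beta> 1 \<bullet>\<^sub>H dir_deriv (e \<beta>) w x)" for \<beta>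
        using vanishes_outsideD[OF vanishes_outside_dir_deriv[OF wS]]
        by (auto simp: vanishes_outside_def qmult.zero_right)
    qed
    finally show ?thesis .
  qed
  have newton: "conv (\<lambda>x. \<Sum>\<alpha>\<in>UNIV. dir_deriv (ddx \<alpha>) (dir_deriv (ddx \<alpha>) G) x) p = - M *\<^sub>R G p"
    if "Ck_on 2 UNIV G" "vanishes_outside r G" for G :: "quat2 \<Rightarrow> quat" and p
    using newton_potential_laplacian[OF DIM_quat \<iota> that, of p]
    unfolding sum_Basis_quat \<iota>_def ddx_def[symmetric] M_def .
  have "(\<Sum>\<beta>\<in>UNIV. axis \<beta> 1 \<bullet>\<^sub>H dir_deriv (ddx \<beta>) w x) = (\<Sum>\<alpha>\<in>UNIV. dir_deriv (ddx \<alpha>) (dir_deriv (ddx \<alpha>) g1) x)" for x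
    unfolding Dw qmult.sum_right by (rule quat_sum_symmetric') (rule dir_deriv_commute[OF open_UNIV g12(1) UNIV_I])
  then have "qdbar ddx u p = g1 p" for p
    unfolding key using newton[OF g12(1) supp(1), of p] M by simp
  moreover have "(\<Sum>\<beta>\<in>UNIV. axis \<beta> 1 \<bullet>\<^sub>H dir_deriv (ddy \<beta>) w x) = (\<Sum>\<alpha>\<in>UNIV. dir_deriv (ddx \<alpha>) (dir_deriv (ddx \<alpha>) g2) x)" for x
    unfolding Dw compat ..
  then have "qdbar ddy u p = g2 p" for p
    unfolding key using newton[OF g12(2) supp(2), of p] M by simp
  \<comment> \<open>The convolution moves q1 only, so all points p - \<iota> \<zeta> share the
    second component of p.\<close>
  moreover have "u p = 0" if p: "r < norm (snd p)" for p
  proof -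
    have "w (p - \<iota> \<zeta>) = 0" for \<zeta>
    proof (rule vanishes_outsideD[OF wS])
      show "r < norm (p - \<iota> \<zeta>)" using p norm_snd_le[of "snd p" "fst p - \<zeta>"] by (cases p) (simp add: \<iota>_def)
    qed
    then show ?thesis by (simp add: u_def conv_def)
  qed
  ultimately show ?thesis using uC by blast
qed

section \<open>Uniqueness of holomorphic functions and the extension of class C^k\<close>

lemma dbar_zero_imp_harmonic:
  assumes U: "open U" "Ck_on 2 U F" and e: "\<And>x. x \<in> U \<Longrightarrow> qdbar e F x = 0" and x: "x \<in> U"
  shows "(\<Sum>\<alpha>\<in>UNIV. dir_deriv (e \<alpha>) (dir_deriv (e \<alpha>) F) x) = 0"
proof -
  have "dir_deriv v (qdbar e F) x = dir_deriv v (\<lambda>_. 0) x" for v by (rule dir_deriv_cong[OF U(1) x e])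
  then show ?thesis using qdbar_laplacian[OF U x, of e] by (simp add: qmult.zero_right)
qed

lemma dir_deriv2_inner:
  assumes U: "open U" "Ck_on 2 U F" "x \<in> U"
  shows "dir_deriv w (dir_deriv v (\<lambda>x. F x \<bullet> c)) x = dir_deriv w (dir_deriv v F) x \<bullet> c"
proof -
  have L: "bounded_linear (\<lambda>y. y \<bullet> c)" by (rule bounded_linear_inner_left)
  have d: "F differentiable (at y)" "dir_deriv v F differentiable (at y)" if "y \<in> U" for y
    using U that by (auto simp: numeral_2_eq_2 intro: differentiable_on_openD)
  have "dir_deriv w (dir_deriv v (\<lambda>x. F x \<bullet> c)) x = dir_deriv w (\<lambda>x. dir_deriv v F x \<bullet> c) x"
    by (rule dir_deriv_cong[OF U(1,3)]) (rule dir_deriv_compose_linear[OF L d(1)])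
  also have "\<dots> = dir_deriv w (dir_deriv v F) x \<bullet> c" by (rule dir_deriv_compose_linear[OF L d(2)[OF U(3)]])
  finally show ?thesis .
qed

lemma holomorphic_unique_continuation:
  fixes u :: "quat2 \<Rightarrow> quat"
  assumes U: "open U" "connected U" "Ck_on 2 U u"
    and d: "\<And>x. x \<in> U \<Longrightarrow> qdbar ddx u x = 0" "\<And>x. x \<in> U \<Longrightarrow> qdbar ddy u x = 0"
    and W: "open W" "W \<noteq> {}" "W \<subseteq> U" "\<And>p. p \<in> W \<Longrightarrow> u p = 0" and p: "p \<in> U"
  shows "u p = 0"
proof (rule euclidean_eqI)
  fix c :: quat
  have "u p \<bullet> c = 0"
  proof (rule biharmonic_unique_continuation[where u = "\<lambda>x. u x \<bullet> c", OF DIM_quat DIM_quat U(1) _ U(2)])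
    show "Ck_on 2 U (\<lambda>x. u x \<bullet> c)" by (rule Ck_on_compose_linear[OF bounded_linear_inner_left U(1,3)])
    show "(\<Sum>b\<in>Basis. dir_deriv (b, 0) (dir_deriv (b, 0) (\<lambda>x. u x \<bullet> c)) q) = 0" if "q \<in> U" for q
      unfolding sum_Basis_quat ddx_def[symmetric] dir_deriv2_inner[OF U(1,3) that] inner_sum_left[symmetric]
      using dbar_zero_imp_harmonic[OF U(1,3) d(1) that] by simp
    show "(\<Sum>b\<in>Basis. dir_deriv (0, b) (dir_deriv (0, b) (\<lambda>x. u x \<bullet> c)) q) = 0" if "q \<in> U" for q
      unfolding sum_Basis_quat ddy_def[symmetric] dir_deriv2_inner[OF U(1,3) that] inner_sum_left[symmetric]
      using dbar_zero_imp_harmonic[OF U(1,3) d(2) that] by simp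
  qed (use W p in auto)
  then show "u p \<bullet> c = 0 \<bullet> c" by simp
qed

text \<open>The maximum principle bounds every real component H \<bullet> c of the difference H by
  0; then c = H x is chosen.\<close>

lemma holomorphic_boundary_uniqueness:
  fixes F G :: "quat2 \<Rightarrow> quat"
  assumes \<Omega>: "open \<Omega>" "bounded \<Omega>" and C: "Ck_on 2 UNIV F" "Ck_on 2 UNIV G"
    and dF: "\<And>x. x \<in> \<Omega> \<Longrightarrow> qdbar ddx F x = 0 \<and> qdbar ddy F x = 0"
    and dG: "\<And>x. x \<in> \<Omega> \<Longrightarrow> qdbar ddx G x = 0 \<and> qdbar ddy G x = 0"
    and eq: "\<And>p. p \<in> frontier \<Omega> \<Longrightarrow> F p = G p" and x: "x \<in> \<Omega>"
  shows "F x = G x"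
proof -
  define H where "H x = F x - G x" for x
  have HC: "Ck_on 2 UNIV H" unfolding H_def[abs_def] by (intro Ck_on_diff C open_UNIV)
  have H\<Omega>: "Ck_on 2 \<Omega> H" by (rule Ck_on_subset[OF HC]) simp
  have dd: "F differentiable (at x)" "G differentiable (at x)" for x
    using Ck_on_differentiable[OF C(1)] Ck_on_differentiable[OF C(2)] by simp_all
  have dH: "qdbar ddx H x = 0" "qdbar ddy H x = 0" if "x \<in> \<Omega>" for x
    unfolding H_def[abs_def] qdbar_diff[OF dd] using dF[OF that] dG[OF that] by simp_all
  have le: "H x \<bullet> c \<le> 0" for c
  proof (rule maximum_principle[OF \<Omega>, where u = "\<lambda>x. H x \<bullet> c"])
    show "continuous_on (closure \<Omega>) (\<lambda>x. H x \<bullet> c)"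
      using Ck_on_imp_continuous_on[OF HC] by (intro continuous_intros continuous_on_subset[where s = UNIV and t = "closure \<Omega>" and f = H]) auto
    show "Ck_on 2 \<Omega> (\<lambda>x. H x \<bullet> c)" by (rule Ck_on_compose_linear[OF bounded_linear_inner_left \<Omega>(1) H\<Omega>])
    show "(\<Sum>b\<in>Basis. dir_deriv b (dir_deriv b (\<lambda>x. H x \<bullet> c)) q) = 0" if "q \<in> \<Omega>" for q
      unfolding sum_Basis_quat2 dir_deriv2_inner[OF \<Omega>(1) H\<Omega> that] inner_sum_left[symmetric]
      using dbar_zero_imp_harmonic[OF \<Omega>(1) H\<Omega> dH(1) that] dbar_zero_imp_harmonic[OF \<Omega>(1) H\<Omega> dH(2) that] by simp
    show "H q \<bullet> c \<le> 0" if "q \<in> frontier \<Omega>" for q using eq[OF that] by (simp add: H_def)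
  qed (rule x)
  have "H x \<bullet> H x = 0" using le[of "H x"] inner_ge_zero[of "H x"] by (rule antisym)
  then have "H x = 0" by simp
  then show ?thesis by (simp add: H_def)
qed

text \<open>Counting derivatives: the cut-off extension has class C^(k+4); its dbar, extended by
  zero thanks to flatness of order k + 4, has class C^(k+3); the potential, built from one
  derivative of these data, has class C^(k+2).\<close>

lemma holomorphic_extension_Ck:
  fixes f :: "quat2 \<Rightarrow> quat"
  assumes \<Omega>: "open \<Omega>" "\<Omega> \<noteq> {}" "bounded \<Omega>" "connected (frontier \<Omega>)"
    and lev: "level_set (frontier \<Omega>) U \<rho>"
    and F: "Cinf_on U F" "\<And>p. p \<in> frontier \<Omega> \<Longrightarrow> F p = f p"
    and flat: "flat_on (k + 4) (frontier \<Omega>) (qdbar ddx F)" "flat_on (k + 4) (frontier \<Omega>) (qdbar ddy F)"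
  shows "\<exists>G. Ck_on (k + 2) UNIV G \<and> (\<forall>x\<in>\<Omega>. qdbar ddx G x = 0 \<and> qdbar ddy G x = 0) \<and> (\<forall>p\<in>frontier \<Omega>. G p = f p)"
proof -
  interpret level_set "frontier \<Omega>" U \<rho> by (rule lev)
  let ?S = "frontier \<Omega>"
  have cS: "compact ?S" using \<Omega>(3) by (simp add: compact_frontier_bounded)
  obtain \<psi> V C where \<psi>: "Ck_on (k + 4) UNIV \<psi>" "\<forall>x\<in>V. \<psi> x = (1::real)" "\<forall>x. x \<notin> C \<longrightarrow> \<psi> x = 0"
    and VC: "open V" "?S \<subseteq> V" "compact C" "V \<subseteq> C" "C \<subseteq> U"
    using cutoff_exists[OF cS open_U S_subset, of "k + 4"] by blast
  define \<Phi> where "\<Phi> x = \<psi> x *\<^sub>R F x" for x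
  have oC: "open (- C)" using VC(3) by (simp add: compact_imp_closed open_Compl)
  have \<Phi>C: "Ck_on (k + 4) UNIV \<Phi>"
  proof -
    have "Ck_on (k + 4) U \<Phi>"
      unfolding \<Phi>_def[abs_def] using F(1) by (intro Ck_on_scaleR open_U Ck_on_subset[OF \<psi>(1)]) (auto simp: Cinf_on_def)
    moreover have "Ck_on (k + 4) (- C) \<Phi>"
      by (subst Ck_on_cong[OF oC, of _ "\<lambda>_. 0"]) (use \<psi>(3) in \<open>auto simp: \<Phi>_def\<close>)
    moreover have "U \<union> - C = UNIV" using VC(5) by auto
    ultimately show ?thesis using Ck_on_Un[OF open_U oC] by metis
  qed
  define h where "h e = qdbar e \<Phi>" for e
  have hC: "Ck_on (k + 3) UNIV (h e)" for e
    unfolding h_def using \<Phi>C by (intro Ck_on_qdbar open_UNIV) (simp add: numeral_eq_Suc)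
  have hV: "h e x = qdbar e F x" if "x \<in> V" for e x
    unfolding h_def by (rule qdbar_cong[OF VC(1) that]) (use \<psi>(2) in \<open>simp add: \<Phi>_def\<close>)
  have hflat: "flat_on (k + 4) ?S (h e)" if "flat_on (k + 4) ?S (qdbar e F)" for e
    using that flat_on_cong[OF VC(1,2) hV] by simp
  define g where "g e x = (if x \<in> \<Omega> then h e x else 0)" for e x
  have gC: "Ck_on (k + 3) UNIV (g e)" if "flat_on (k + 4) ?S (qdbar e F)" for e
    unfolding g_def[abs_def] using hflat[OF that]
    by (intro Ck_on_extend_by_zero \<Omega>(1) hC) (simp add: numeral_eq_Suc)
  note gC12 = gC[OF flat(1)] gC[OF flat(2)]
  obtain r where r: "r > 0" "closure \<Omega> \<subseteq> cball 0 r"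
    using bounded_subset_cball_0[OF bounded_closure[OF \<Omega>(3)]] by blast
  have gS: "vanishes_outside r (g e)" for e
    using r(2) closure_subset[of \<Omega>] by (force simp: vanishes_outside_def g_def)
  \<comment> \<open>Inside \<Omega> the data are dbar of a function, outside the closure they are
    zero, and on the frontier the identity persists by continuity of second derivatives.\<close>
  have compat: "(\<Sum>\<alpha>\<in>UNIV. dir_deriv (ddx \<alpha>) (dir_deriv (ddx \<alpha>) (g ddy)) x)
      = (\<Sum>\<beta>\<in>UNIV. axis \<beta> 1 \<bullet>\<^sub>H (\<Sum>\<alpha>\<in>UNIV. qcnj (axis \<alpha> 1) \<bullet>\<^sub>H dir_deriv (ddy \<beta>) (dir_deriv (ddx \<alpha>) (g ddx)) x))" (is "?l x = ?r x") for x
  proof -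
    have cong2: "dir_deriv b (dir_deriv a (g e)) x = dir_deriv b (dir_deriv a G) x"
      if "open X" "x \<in> X" "\<And>y. y \<in> X \<Longrightarrow> g e y = G y" for a b e x X and G :: "quat2 \<Rightarrow> quat"
      by (rule dir_deriv_cong[OF that(1,2)]) (rule dir_deriv_cong[OF that(1) _ that(3)])
    have in_\<Omega>: "?l x = ?r x" if x: "x \<in> \<Omega>" for x
    proof -
      have e: "dir_deriv b (dir_deriv a (g e)) x = dir_deriv b (dir_deriv a (qdbar e \<Phi>)) x" for a b e
        by (rule cong2[OF \<Omega>(1) x]) (simp add: g_def h_def)
      have "Ck_on 3 UNIV \<Phi>" by (rule Ck_on_le[OF \<Phi>C]) simp
      from qdbar_compatibility[OF open_UNIV this UNIV_I] show ?thesis unfolding e .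
    qed
    have out: "?l x = ?r x" if x: "x \<in> - closure \<Omega>" for x
    proof -
      have "dir_deriv b (dir_deriv a (g e)) x = dir_deriv b (dir_deriv a (\<lambda>_. 0)) x" for a b e
        by (rule cong2[OF _ x]) (use closure_subset in \<open>auto simp: g_def open_Compl\<close>)
      then show ?thesis by (simp add: qmult.zero_right)
    qed
    have cont: "continuous_on UNIV (dir_deriv b (dir_deriv a (g e)))" if "Ck_on (k + 3) UNIV (g e)" for a b e
    proof -
      have "Ck_on 2 UNIV (g e)" by (rule Ck_on_le[OF that]) simp
      from Ck_on_dir_deriv[OF Ck_on_dir_deriv[OF this[unfolded numeral_2_eq_2]]]
      show ?thesis by (rule Ck_on_imp_continuous_on)
    qed
    have "continuous_on UNIV (\<lambda>x. ?l x - ?r x)"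
      by (intro continuous_on_diff continuous_on_sum qmult.continuous_on continuous_on_const cont gC12)
    then have "continuous_on (closure \<Omega>) (\<lambda>x. ?l x - ?r x)" by (rule continuous_on_subset) simp
    moreover have "?l x - ?r x = 0" if "x \<in> \<Omega>" for x using in_\<Omega>[OF that] by simp
    ultimately have "?l x - ?r x = 0" if "x \<in> closure \<Omega>" for x
      using continuous_constant_on_closure[of \<Omega> "\<lambda>x. ?l x - ?r x" 0] that by blast
    then show ?thesis using out[of x] by (cases "x \<in> closure \<Omega>") auto
  qed
  have "Ck_on (Suc (Suc (k + 1))) UNIV (g e)" if "Ck_on (k + 3) UNIV (g e)" for e
    using that by (simp add: numeral_eq_Suc)
  from solve_dbar[OF this[OF gC12(1)] this[OF gC12(2)] gS gS compat]
  obtain u where u: "Ck_on (Suc (k + 1)) UNIV u" "\<And>x. qdbar ddx u x = g ddx x" "\<And>x. qdbar ddy u x = g ddy x"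
    "\<And>p. r < norm (snd p) \<Longrightarrow> u p = 0" by blast
  have u2: "Ck_on 2 UNIV u" by (rule Ck_on_le[OF u(1)]) simp
  \<comment> \<open>An exterior point with |q2| > r, so that its component W of the exterior meets
    the region where u is known to vanish in a nonempty open set.\<close>
  define q :: quat2 where "q = (0, (r + 1) *\<^sub>R axis 0 1)"
  have q: "r < norm (snd q)" using r(1) by (simp add: q_def)
  have q_out: "q \<notin> closure \<Omega>"
    using q r(2) norm_snd_le[of "snd q" "fst q"] by auto
  define W where "W = connected_component_set (- closure \<Omega>) q"
  have W: "open W" "connected W" "W \<subseteq> - closure \<Omega>" "q \<in> W"
    unfolding W_def using q_out connected_component_subset[of "- closure \<Omega>" q]
    by (auto intro: open_connected_component simp: connected_component_refl_eq)
  have uW: "u p = 0" if "p \<in> W" for p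
  proof (rule holomorphic_unique_continuation[OF W(1,2) Ck_on_subset[OF u2] _ _ _ _ _ _ that])
    have gz: "g e x = 0" if "x \<in> W" for e x using that W(3) closure_subset[of \<Omega>] by (auto simp: g_def)
    show "qdbar ddx u x = 0" "qdbar ddy u x = 0" if "x \<in> W" for x using gz[OF that] u by simp_all
    show "open (W \<inter> {p. r < norm (snd p)})"
      by (intro open_Int W open_Collect_less continuous_intros)
    show "W \<inter> {p. r < norm (snd p)} \<noteq> {}" using W(4) q by blast
  qed (use u(4) in auto)
  have uS: "u p = 0" if p: "p \<in> ?S" for p
  proof -
    have "p \<in> closure W"
      using boundary_in_closure_of_outer_component[OF \<Omega>(1,2) refl \<Omega>(4) q_out] p by (auto simp: W_def)
    moreover have "continuous_on (closure W) u" using Ck_on_imp_continuous_on[OF u2] by (rule continuous_on_subset) simp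
    ultimately show ?thesis using continuous_constant_on_closure[of W u 0] uW by blast
  qed
  define G where "G x = \<Phi> x - u x" for x
  have "Ck_on (k + 2) UNIV G"
    unfolding G_def[abs_def] using u(1) by (intro Ck_on_diff Ck_on_le[OF \<Phi>C] open_UNIV) (simp_all add: numeral_eq_Suc)
  moreover have "qdbar e G x = 0" if x: "x \<in> \<Omega>" and e: "qdbar e u x = g e x" for x e
  proof -
    have "\<Phi> differentiable (at x)" by (rule Ck_on_differentiable[OF \<Phi>C]) auto
    moreover have "u differentiable (at x)" by (rule Ck_on_differentiable[OF u(1)]) auto
    ultimately show ?thesis unfolding G_def[abs_def] using x e by (simp add: qdbar_diff g_def h_def)
  qed
  moreover have "G p = f p" if p: "p \<in> ?S" for p
    using uS[OF p] \<psi>(2) VC(2) F(2)[OF p] p by (auto simp: G_def \<Phi>_def)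
  ultimately show ?thesis using u(2,3) by blast
qed

theorem theorem2p10:
  fixes \<Omega> :: "quat2 set" and f :: "quat2 \<Rightarrow> quat"
  assumes "open \<Omega>" and "connected \<Omega>" and "\<Omega> \<noteq> {}" and "bounded \<Omega>"
    and "connected (frontier \<Omega>)" and "smooth_hypersurface (frontier \<Omega>)"
    and "admissible (frontier \<Omega>) f"
  shows "\<exists>F. H_holomorphic_on \<Omega> F \<and> smooth_up_to_boundary \<Omega> F \<and> (\<forall>p\<in>frontier \<Omega>. F p = f p)"
proof -
  obtain U \<rho> where lev: "level_set (frontier \<Omega>) U \<rho>"
    and ext: "\<And>k. \<exists>F. Cinf_on U F \<and> (\<forall>p\<in>frontier \<Omega>. F p = f p) \<and>
      flat_on k (frontier \<Omega>) (qdbar ddx F) \<and> flat_on k (frontier \<Omega>) (qdbar ddy F)"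
    using admissible_extension[OF assms(6,7)] by blast
  have "\<exists>G. Ck_on (k + 2) UNIV G \<and> (\<forall>x\<in>\<Omega>. qdbar ddx G x = 0 \<and> qdbar ddy G x = 0) \<and> (\<forall>p\<in>frontier \<Omega>. G p = f p)" for k
    using ext[of "k + 4"] holomorphic_extension_Ck[OF assms(1,3,4,5) lev] by blast
  then obtain G where C: "\<And>k. Ck_on (k + 2) UNIV (G k)"
    and hol: "\<And>k x. x \<in> \<Omega> \<Longrightarrow> qdbar ddx (G k) x = 0 \<and> qdbar ddy (G k) x = 0"
    and bd: "\<And>k p. p \<in> frontier \<Omega> \<Longrightarrow> G k p = f p" by metis
  have C2: "Ck_on 2 UNIV (G k)" for k by (rule Ck_on_le[OF C]) simp
  \<comment> \<open>All \<open>G k\<close> agree on \<Omega>, so each of them certifies its own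
    differentiability class for \<open>G 0\<close>.\<close>
  have eq: "G 0 x = G k x" if "x \<in> \<Omega>" for k x
    by (rule holomorphic_boundary_uniqueness[OF assms(1,4) C2 C2 hol hol _ that]) (simp_all add: bd)
  have cinf: "Cinf_on \<Omega> (G 0)"
    unfolding Cinf_on_def
  proof
    fix k
    have "Ck_on k \<Omega> (G k)" by (rule Ck_on_subset[OF Ck_on_le[OF C[of k]]]) auto
    then show "Ck_on k \<Omega> (G 0)" using Ck_on_cong[OF assms(1), of "G 0" "G k" k] eq by blast
  qed
  have "Ck_on 1 \<Omega> (G 0)" using cinf by (simp add: Cinf_on_def del: Ck_on.simps)
  then have "H_holomorphic_on \<Omega> (G 0)"
    using hol[of _ 0] by (auto simp: H_holomorphic_on_def Dbar_def dbar_eq_qdbar dir_deriv_def zero_prod_def)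
  moreover have "smooth_up_to_boundary \<Omega> (G 0)"
    unfolding smooth_up_to_boundary_def
  proof (intro conjI allI)
    show "smooth_on \<Omega> (G 0)" using cinf by (simp add: smooth_on_iff_Cinf_on)
    show "continuous_on (closure \<Omega>) (G 0)"
      by (rule continuous_on_subset[OF Ck_on_imp_continuous_on[OF C2]]) simp
    fix vs :: "quat2 list"
    \<comment> \<open>\<open>G (length vs)\<close> has enough continuous derivatives on the whole
      space, hence up to the boundary, and agrees with \<open>G 0\<close> on \<Omega>.\<close>
    let ?D = "iterated_derivative vs (G (length vs))"
    have "continuous_on UNIV ?D" by (rule continuous_on_iterated_derivative[OF Ck_on_le[OF C]]) simp
    then have "continuous_on (closure \<Omega>) ?D" by (rule continuous_on_subset) simp
    moreover have "?D x = iterated_derivative vs (G 0) x" if "x \<in> \<Omega>" for x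
      by (rule iterated_derivative_cong[OF assms(1) eq[symmetric] that])
    ultimately show "\<exists>D. continuous_on (closure \<Omega>) D \<and> (\<forall>x\<in>\<Omega>. D x = iterated_derivative vs (G 0) x)" by blast
  qed
  ultimately show ?thesis using bd[of _ 0] by blast
qed

end
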